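(* Let $f\colon\Sigma\to\mathbb{R}^3$ be a front with a cuspidal edge at $p\in\Sigma$ and let $\nu\colon\Sigma\to S^2$ be its Gauss map. Suppose that the Gaussian curvature $K$ of $f$ is bounded on a sufficiently small neighborhood $U$ of $p$. If $p$ is a non-degenerate singular point of $\nu$ but $\nu$ does not have a fold at $p$, then $K$ is positive (resp. negative) on $U$ if and only if the singular curvature $\kappa_s$ of $f$ is negative (resp. positive) at $p$.
   Context: **Setting.** $\Sigma\subset\mathbb{R}^2$ is a domain, all maps are $C^\infty$, $\langle\cdot,\cdot\rangle$ is the Euclidean inner product of $\mathbb{R}^3$ and $S^2\subset\mathbb{R}^3$ is the unit sphere. Two map germs are $\mathcal{A}$-equivalent if they coincide up to diffeomorphism germs on the source and on the target. **Fronts and cuspidal edges.** A $C^\infty$ map $f\colon\Sigma\to\mathbb{R}^3$ is a front if there is a $C^\infty$ map $\nu\colon\Sigma\to S^2$ (the Gauss map of $f$) such that $\langle df_q(X),\nu(q)\rangle=0$ for all $q\in\Sigma$, $X\in T_q\Sigma$, and $(f,\nu)\colon\Sigma\to\mathbb{R}^3\times S^2$ is an immersion. The singular set is $S(f)=\{q\in\Sigma : \operatorname{rank} df_q<2\}$. A point $p\in S(f)$ is a cuspidal edge if the germ of $f$ at $p$ is $\mathcal{A}$-equivalent to $(u,v)\mapsto(u,v^2,v^3)$ at the origin. Near a cuspidal edge, $S(f)$ is the image of a regular curve $\gamma$ (the singular curve), consisting of cuspidal edges, and there is a null vector field, i.e. a nowhere zero vector field $\eta$ near $p$ with $df_q(\eta_q)=0$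 for $q\in S(f)$. **Adapted coordinates and singular curvature.** The signed area density function is $\lambda=\det(f_u,f_v,\nu)$. Coordinates $(u,v)$ centered at the cuspidal edge $p$ are adapted if they are compatible with the orientation of $\Sigma$, the $u$-axis is the singular curve ($\gamma(u)=(u,0)$) and contains all singular points of $f$ in the chart, and $\partial_v$ is a null vector field. In adapted coordinates the singular curvature is, along the $u$-axis, $$\kappa_s=\operatorname{sgn}(\lambda_v)\frac{\det(f_u,f_{uu},\nu)}{|f_u|^3}.$$ **Gaussian curvature.** $K$ is the Gaussian curvature of $f$ on the regular set $\Sigma\setminus S(f)$; "bounded on $U$" refers to $K$ on $U\setminus S(f)$. If $K$ is bounded near the cuspidal edge $p$, then it extends to a $C^\infty$ function near $p$, and values of $K$ at points of $S(f)$ are those of this extension. "Sufficiently small neighborhood $U$" means that the statement holds for all neighborhoods $U$ of $p$ contained in some fixed neighborhood of $p$. **Singularities of the Gauss map.** Let $H$ be the mean curvature of $f$ on the regular set. Near a cuspidal edge $p$ there is a bounded $C^\infty$ function $\kappa$ on a neighborhood of $p$ that equals, at each regular point, one of the principal curvatures $H\pm\sqrt{H^2-K}$ (the other one diverges on approaching $S(f)$). The singular points of $\nu$ are the zeros of $\Lambda=\det(\nu_u,\nu_v,\nu)$; near a cuspidal edge these are exactly the zeros of $\kappa$. A singular point $q$ of $\nu$ is non-degenerate if $(\kappa_u(q),\kappa_v(q))\neq(0,0)$. The map $\nu$ has a fold at $p$ if its germ at $p$ (as a map between 2-manifolds) is $\mathcal{A}$-equivalent to $(u,v)\mapsto(u,v^2)$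 at the origin. *)

theory Defs
  imports "HOL-Analysis.Analysis"
begin

section \<open>Smooth maps, diffeomorphisms and equivalence of map germs\<close>

text \<open>On an open set \<open>S\<close>, \<open>Ck_on n S f\<close> says that all iterated directional derivatives of \<open>f\<close> of
  order at most \<open>n\<close> exist and are continuous on \<open>S\<close>. It is only used for open \<open>S\<close>.\<close>

primrec Ck_on ::
  "nat \<Rightarrow> 'a::euclidean_space set \<Rightarrow> ('a \<Rightarrow> 'b::euclidean_space) \<Rightarrow> bool" where
  "Ck_on 0 S f \<longleftrightarrow> continuous_on S f"
| "Ck_on (Suc n) S f \<longleftrightarrow>
     (\<forall>x\<in>S. f differentiable (at x)) \<and> (\<forall>h. Ck_on n S (\<lambda>x. frechet_derivative f (at x) h))"

text \<open>Smoothness on an arbitrary subset of a Euclidean space, as local extendability to smooth maps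
  on open sets. For a submanifold (here: the unit sphere) this is the usual notion; for an open set
  it is plain smoothness, see \<open>smooth_on_open_iff\<close> below.\<close>

definition smooth_on :: "'a::euclidean_space set \<Rightarrow> ('a \<Rightarrow> 'b::euclidean_space) \<Rightarrow> bool" where
  "smooth_on S f \<longleftrightarrow>
     (\<forall>x\<in>S. \<exists>T g. open T \<and> x \<in> T \<and> (\<forall>n. Ck_on n T g) \<and> (\<forall>y\<in>S \<inter> T. g y = f y))"

lemma Ck_on_cong:
  assumes "open S" "\<And>x. x \<in> S \<Longrightarrow> f x = g x" "Ck_on n S f"
  shows "Ck_on n S g"
  using assms(2,3)
proof (induction n arbitrary: f g)
  case 0
  then show ?case by (simp cong: continuous_on_cong)
next
  case (Suc n)
  have d: "(g has_derivative frechet_derivative f (at x)) (at x)" if "x \<in> S" for x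
  proof (rule has_derivative_transform_within_open[OF _ assms(1) that])
    show "(f has_derivative frechet_derivative f (at x)) (at x)"
      using Suc.prems(2) that by (simp add: frechet_derivative_works)
  qed (use Suc.prems(1) in auto)
  have e: "frechet_derivative f (at x) h = frechet_derivative g (at x) h" if "x \<in> S" for x h
    using frechet_derivative_at[OF d[OF that]] by simp
  have "Ck_on n S (\<lambda>x. frechet_derivative g (at x) h)" for h
    by (rule Suc.IH[of "\<lambda>x. frechet_derivative f (at x) h"]) (use e Suc.prems(2) in auto)
  moreover have "\<forall>x\<in>S. g differentiable (at x)"
    using d differentiableI by blast
  ultimately show ?case by simp
qed

lemma Ck_on_subset: "Ck_on n S f \<Longrightarrow> T \<subseteq> S \<Longrightarrow> Ck_on n T f"
  by (induction n arbitrary: f) (auto intro: continuous_on_subset)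

lemma Ck_on_local:
  assumes "open S" "\<And>x. x \<in> S \<Longrightarrow> \<exists>T. open T \<and> x \<in> T \<and> Ck_on n T f"
  shows "Ck_on n S f"
  using assms(2)
proof (induction n arbitrary: f)
  case 0
  then show ?case
    by (metis Ck_on.simps(1) continuous_at_imp_continuous_on continuous_on_eq_continuous_at)
next
  case (Suc n)
  have "Ck_on n S (\<lambda>x. frechet_derivative f (at x) h)" for h
    by (rule Suc.IH) (use Suc.prems in fastforce)
  then show ?case using Suc.prems by fastforce
qed

lemma smooth_on_open_iff:
  assumes "open S"
  shows "smooth_on S f \<longleftrightarrow> (\<forall>n. Ck_on n S f)"
proof
  assume f: "smooth_on S f"
  show "\<forall>n. Ck_on n S f"
  proof (intro allI Ck_on_local[OF assms])
    fix n x assume "x \<in> S"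
    then obtain T g where T: "open T" "x \<in> T" "\<forall>n. Ck_on n T g" "\<forall>y\<in>S \<inter> T. g y = f y"
      using f unfolding smooth_on_def by meson
    have "Ck_on n (S \<inter> T) f"
      by (rule Ck_on_cong[of _ g]) (use T assms Ck_on_subset[of n T g "S \<inter> T"] in auto)
    then show "\<exists>T. open T \<and> x \<in> T \<and> Ck_on n T f"
      using T \<open>x \<in> S\<close> assms by blast
  qed
next
  assume "\<forall>n. Ck_on n S f"
  then show "smooth_on S f"
    unfolding smooth_on_def using assms by blast
qed

definition diffeomorphism ::
  "'a::euclidean_space set \<Rightarrow> 'b::euclidean_space set \<Rightarrow> ('a \<Rightarrow> 'b) \<Rightarrow> ('b \<Rightarrow> 'a) \<Rightarrow> bool" where
  "diffeomorphism S T f g \<longleftrightarrow> homeomorphism S T f g \<and> smooth_on S f \<and> smooth_on T g"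

text \<open>The germ at \<open>p\<close> of a map \<open>f\<close> into \<open>M\<close> is equivalent to the germ at \<open>q\<close> of a map \<open>g\<close> into \<open>N\<close>.
  The targets \<open>M\<close> and \<open>N\<close> are submanifolds of Euclidean spaces; the sources are open subsets of
  Euclidean spaces.\<close>

definition A_equivalent ::
  "'m::euclidean_space set \<Rightarrow> ('a::euclidean_space \<Rightarrow> 'm) \<Rightarrow> 'a \<Rightarrow>
   'n::euclidean_space set \<Rightarrow> ('b::euclidean_space \<Rightarrow> 'n) \<Rightarrow> 'b \<Rightarrow> bool" where
  "A_equivalent M f p N g q \<longleftrightarrow>
     (\<exists>U U' \<phi> \<phi>' W W' \<Phi> \<Phi>'.
        open U \<and> p \<in> U \<and> open U' \<and> q \<in> U' \<and> diffeomorphism U U' \<phi> \<phi>' \<and> \<phi> p = q \<and>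
        openin (top_of_set M) W \<and> f p \<in> W \<and> openin (top_of_set N) W' \<and> g q \<in> W' \<and>
        diffeomorphism W W' \<Phi> \<Phi>' \<and>
        f ` U \<subseteq> W \<and> (\<forall>x\<in>U. g (\<phi> x) = \<Phi> (f x)))"

section \<open>Fronts and cuspidal edges\<close>

definition D\<^sub>u :: "(real^2 \<Rightarrow> 'b::real_normed_vector) \<Rightarrow> real^2 \<Rightarrow> 'b" where
  "D\<^sub>u f q = frechet_derivative f (at q) (axis 1 1)"

definition D\<^sub>v :: "(real^2 \<Rightarrow> 'b::real_normed_vector) \<Rightarrow> real^2 \<Rightarrow> 'b" where
  "D\<^sub>v f q = frechet_derivative f (at q) (axis 2 1)"

definition det3 :: "real^3 \<Rightarrow> real^3 \<Rightarrow> real^3 \<Rightarrow> real" where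
  "det3 a b c = det (vector [a, b, c] :: real^3^3)"

definition front :: "(real^2) set \<Rightarrow> (real^2 \<Rightarrow> real^3) \<Rightarrow> (real^2 \<Rightarrow> real^3) \<Rightarrow> bool" where
  "front \<Sigma> f \<nu> \<longleftrightarrow>
     smooth_on \<Sigma> f \<and> smooth_on \<Sigma> \<nu> \<and>
     (\<forall>q\<in>\<Sigma>. \<nu> q \<in> sphere 0 1 \<and>
        (\<forall>X. frechet_derivative f (at q) X \<bullet> \<nu> q = 0) \<and>
        inj (frechet_derivative (\<lambda>x. (f x, \<nu> x)) (at q)))"

definition singular_set :: "(real^2) set \<Rightarrow> (real^2 \<Rightarrow> real^3) \<Rightarrow> (real^2) set" where
  "singular_set \<Sigma> f = {q \<in> \<Sigma>. rank (matrix (frechet_derivative f (at q))) < 2}"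

definition cuspidal_edge :: "(real^2) set \<Rightarrow> (real^2 \<Rightarrow> real^3) \<Rightarrow> real^2 \<Rightarrow> bool" where
  "cuspidal_edge \<Sigma> f p \<longleftrightarrow>
     p \<in> singular_set \<Sigma> f \<and>
     A_equivalent UNIV f p UNIV (\<lambda>x. vector [x$1, (x$2)^2, (x$2)^3] :: real^3) (0 :: real^2)"

section \<open>Adapted coordinates and singular curvature\<close>

text \<open>A chart is given by its parametrization \<open>\<phi>\<close>, defined on an open set \<open>O'\<close> of the
  \<open>(u,v)\<close>-plane.\<close>

definition adapted_coordinates ::
  "(real^2) set \<Rightarrow> (real^2 \<Rightarrow> real^3) \<Rightarrow> real^2 \<Rightarrow> (real^2) set \<Rightarrow> (real^2 \<Rightarrow> real^2) \<Rightarrow> bool" where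
  "adapted_coordinates \<Sigma> f p O' \<phi> \<longleftrightarrow>
     open O' \<and> 0 \<in> O' \<and> \<phi> 0 = p \<and> open (\<phi> ` O') \<and> \<phi> ` O' \<subseteq> \<Sigma> \<and>
     (\<exists>\<phi>'. diffeomorphism O' (\<phi> ` O') \<phi> \<phi>') \<and>
     (\<forall>x\<in>O'. det (matrix (frechet_derivative \<phi> (at x))) > 0) \<and>
     (\<forall>x\<in>O'. \<phi> x \<in> singular_set \<Sigma> f \<longleftrightarrow> x$2 = 0) \<and>
     (\<forall>x\<in>O'. x$2 = 0 \<longrightarrow> D\<^sub>v (f \<circ> \<phi>) x = 0)"

definition area_density :: "(real^2 \<Rightarrow> real^3) \<Rightarrow> (real^2 \<Rightarrow> real^3) \<Rightarrow> real^2 \<Rightarrow> real" where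
  "area_density f \<nu> q = det3 (D\<^sub>u f q) (D\<^sub>v f q) (\<nu> q)"

text \<open>The formula for the singular curvature, for \<open>f\<close> and \<open>\<nu>\<close> expressed in adapted coordinates.\<close>

definition coord_singular_curvature ::
  "(real^2 \<Rightarrow> real^3) \<Rightarrow> (real^2 \<Rightarrow> real^3) \<Rightarrow> real^2 \<Rightarrow> real" where
  "coord_singular_curvature f \<nu> q =
     sgn (D\<^sub>v (area_density f \<nu>) q) * det3 (D\<^sub>u f q) (D\<^sub>u (D\<^sub>u f) q) (\<nu> q) / norm (D\<^sub>u f q) ^ 3"

text \<open>The value does not depend on the adapted coordinates chosen, and such coordinates exist at
  every cuspidal edge.\<close>

definition singular_curvature ::
  "(real^2) set \<Rightarrow> (real^2 \<Rightarrow> real^3) \<Rightarrow> (real^2 \<Rightarrow> real^3) \<Rightarrow> real^2 \<Rightarrow> real" where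
  "singular_curvature \<Sigma> f \<nu> p =
     (let \<phi> = (SOME \<phi>. \<exists>O'. adapted_coordinates \<Sigma> f p O' \<phi>)
      in coord_singular_curvature (f \<circ> \<phi>) (\<nu> \<circ> \<phi>) 0)"

section \<open>Gaussian, mean and principal curvatures\<close>

definition first_E :: "(real^2 \<Rightarrow> real^3) \<Rightarrow> real^2 \<Rightarrow> real" where
  "first_E f q = D\<^sub>u f q \<bullet> D\<^sub>u f q"

definition first_F :: "(real^2 \<Rightarrow> real^3) \<Rightarrow> real^2 \<Rightarrow> real" where
  "first_F f q = D\<^sub>u f q \<bullet> D\<^sub>v f q"

definition first_G :: "(real^2 \<Rightarrow> real^3) \<Rightarrow> real^2 \<Rightarrow> real" where
  "first_G f q = D\<^sub>v f q \<bullet> D\<^sub>v f q"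

definition second_L :: "(real^2 \<Rightarrow> real^3) \<Rightarrow> (real^2 \<Rightarrow> real^3) \<Rightarrow> real^2 \<Rightarrow> real" where
  "second_L f \<nu> q = D\<^sub>u (D\<^sub>u f) q \<bullet> \<nu> q"

definition second_M :: "(real^2 \<Rightarrow> real^3) \<Rightarrow> (real^2 \<Rightarrow> real^3) \<Rightarrow> real^2 \<Rightarrow> real" where
  "second_M f \<nu> q = D\<^sub>v (D\<^sub>u f) q \<bullet> \<nu> q"

definition second_N :: "(real^2 \<Rightarrow> real^3) \<Rightarrow> (real^2 \<Rightarrow> real^3) \<Rightarrow> real^2 \<Rightarrow> real" where
  "second_N f \<nu> q = D\<^sub>v (D\<^sub>v f) q \<bullet> \<nu> q"

text \<open>These two are meaningful at regular points only.\<close>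

definition gaussian_curvature ::
  "(real^2 \<Rightarrow> real^3) \<Rightarrow> (real^2 \<Rightarrow> real^3) \<Rightarrow> real^2 \<Rightarrow> real" where
  "gaussian_curvature f \<nu> q =
     (second_L f \<nu> q * second_N f \<nu> q - (second_M f \<nu> q)\<^sup>2) /
     (first_E f q * first_G f q - (first_F f q)\<^sup>2)"

definition mean_curvature ::
  "(real^2 \<Rightarrow> real^3) \<Rightarrow> (real^2 \<Rightarrow> real^3) \<Rightarrow> real^2 \<Rightarrow> real" where
  "mean_curvature f \<nu> q =
     (first_E f q * second_N f \<nu> q - 2 * first_F f q * second_M f \<nu> q
        + first_G f q * second_L f \<nu> q) /
     (2 * (first_E f q * first_G f q - (first_F f q)\<^sup>2))"

text \<open>At a singular point, the value of the smooth extension of the Gaussian curvature is its limit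
  along regular points (which are dense near a cuspidal edge).\<close>

definition extended_gaussian_curvature ::
  "(real^2) set \<Rightarrow> (real^2 \<Rightarrow> real^3) \<Rightarrow> (real^2 \<Rightarrow> real^3) \<Rightarrow> real^2 \<Rightarrow> real" where
  "extended_gaussian_curvature \<Sigma> f \<nu> q =
     (if q \<in> singular_set \<Sigma> f
      then Lim (at q within \<Sigma> - singular_set \<Sigma> f) (gaussian_curvature f \<nu>)
      else gaussian_curvature f \<nu> q)"

section \<open>Singularities of the Gauss map\<close>

text \<open>The germ of \<open>\<kappa>\<close> at a cuspidal edge \<open>p\<close> is uniquely determined, because the other principal
  curvature is unbounded.\<close>

definition bounded_principal_curvature ::
  "(real^2) set \<Rightarrow> (real^2 \<Rightarrow> real^3) \<Rightarrow> (real^2 \<Rightarrow> real^3) \<Rightarrow> real^2 \<Rightarrow>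
   (real^2) set \<Rightarrow> (real^2 \<Rightarrow> real) \<Rightarrow> bool" where
  "bounded_principal_curvature \<Sigma> f \<nu> p W \<kappa> \<longleftrightarrow>
     open W \<and> p \<in> W \<and> W \<subseteq> \<Sigma> \<and> smooth_on W \<kappa> \<and> bounded (\<kappa> ` W) \<and>
     (\<forall>q\<in>W - singular_set \<Sigma> f.
        let H = mean_curvature f \<nu> q; K = gaussian_curvature f \<nu> q
        in \<kappa> q = H + sqrt (H\<^sup>2 - K) \<or> \<kappa> q = H - sqrt (H\<^sup>2 - K))"

definition gauss_map_singular :: "(real^2 \<Rightarrow> real^3) \<Rightarrow> real^2 \<Rightarrow> bool" where
  "gauss_map_singular \<nu> q \<longleftrightarrow> det3 (D\<^sub>u \<nu> q) (D\<^sub>v \<nu> q) (\<nu> q) = 0"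

definition gauss_map_nondegenerate_singular ::
  "(real^2) set \<Rightarrow> (real^2 \<Rightarrow> real^3) \<Rightarrow> (real^2 \<Rightarrow> real^3) \<Rightarrow> real^2 \<Rightarrow> bool" where
  "gauss_map_nondegenerate_singular \<Sigma> f \<nu> p \<longleftrightarrow>
     gauss_map_singular \<nu> p \<and>
     (\<exists>W \<kappa>. bounded_principal_curvature \<Sigma> f \<nu> p W \<kappa> \<and> (D\<^sub>u \<kappa> p, D\<^sub>v \<kappa> p) \<noteq> (0, 0))"

definition gauss_map_fold :: "(real^2 \<Rightarrow> real^3) \<Rightarrow> real^2 \<Rightarrow> bool" where
  "gauss_map_fold \<nu> p \<longleftrightarrow>
     A_equivalent (sphere 0 1) \<nu> p UNIV (\<lambda>x. vector [x$1, (x$2)^2] :: real^2) (0 :: real^2)"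

end

theory Submission
  imports Defs
begin

text \<open>
  In adapted coordinates around \<open>p\<close> write \<open>F\<close> and \<open>N\<close> for the front and its Gauss map, and consider
  the signed area densities \<open>\<lambda> = det(F\<^sub>u, F\<^sub>v, N)\<close> of the front and \<open>\<Lambda> = det(N\<^sub>u, N\<^sub>v, N)\<close> of the
  Gauss map. Off the singular curve, the \<open>u\<close>-axis, the Gaussian curvature is the quotient
  \<open>K = \<Lambda> / \<lambda>\<close> (\<open>gaussian_curvature_eq\<close>). At a cuspidal edge \<open>\<lambda>\<close> vanishes on the axis to first
  order only. If \<open>K\<close> is bounded, then \<open>\<Lambda>\<close> vanishes on the axis as well, both densities can be divided
  by \<open>v\<close>, and \<open>K\<close> extends continuously with the value \<open>\<Lambda>\<^sub>v / \<lambda>\<^sub>v\<close> at \<open>p\<close>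
  (\<open>density_quotient_extends\<close>). It remains to see that this value is nonzero and to find its sign.

  The bounded principal curvature \<open>\<kappa>\<close> makes \<open>dN + \<kappa> dF\<close> singular. Expanding the determinant of this
  map along the axis shows that \<open>\<kappa>\<close> vanishes there, and that its \<open>v\<close>-derivative at \<open>p\<close> is a multiple of
  \<open>\<Lambda>\<^sub>v\<close>; so a nondegenerate singular point has \<open>\<Lambda>\<^sub>v \<noteq> 0\<close> (\<open>principal_curvature_nondegenerate\<close>).
  The Gauss map is then singular exactly along the axis near \<open>p\<close>. If the kernel of its derivative at
  \<open>p\<close> were transversal to the axis, that is, if \<open>N\<^sub>u \<noteq> 0\<close>, it would have a fold there, by Whitney's
  normal form (\<open>fold_if_kernel_transversal\<close>). So \<open>N\<^sub>u = 0\<close> at \<open>p\<close>, and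
  \<open>\<Lambda>\<^sub>v = det(N\<^sub>u\<^sub>v, N\<^sub>v, N)\<close>. As \<open>N\<^sub>v\<close> is orthogonal to \<open>F\<^sub>u\<close> and \<open>N\<close> along the axis, this determinant
  is a multiple of \<open>N\<^sub>u\<^sub>v \<bullet> F\<^sub>u = - F\<^sub>u\<^sub>u \<bullet> N\<^sub>v\<close>, while \<open>det(F\<^sub>u, F\<^sub>u\<^sub>u, N)\<close> is one of
  \<open>F\<^sub>u\<^sub>u \<bullet> N\<^sub>v\<close>; the two have opposite signs (\<open>gauss_density_derivative_sign\<close>). Since
  \<open>\<kappa>\<^sub>s\<close> has the sign of \<open>\<lambda>\<^sub>v det(F\<^sub>u, F\<^sub>u\<^sub>u, N)\<close>, it follows that \<open>K\<close> and \<open>\<kappa>\<^sub>s\<close> have opposite signs.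

  The singular curvature is computed in coordinates that are known only to be adapted. That they
  exist, and that \<open>\<lambda>\<^sub>v \<noteq> 0\<close> in all of them, is read off from the normal form of a cuspidal edge
  (\<open>adapted_coordinates_exist\<close>, \<open>adapted_front_in_adapted_coordinates\<close>). The analytic tools are
  Schwarz's theorem, Hadamard's division lemma (\<open>smooth_division_by_v\<close>) and the smooth inverse
  function theorem in the plane.
\<close>



section \<open>Calculus of smooth maps\<close>

abbreviation \<D> :: "('a::real_normed_vector \<Rightarrow> 'b::real_normed_vector) \<Rightarrow> 'a \<Rightarrow> 'a \<Rightarrow> 'b" where
  "\<D> f x \<equiv> frechet_derivative f (at x)"

lemma Ck_on_SucI:
  assumes "open S" "\<And>x. x \<in> S \<Longrightarrow> (f has_derivative f' x) (at x)" "\<And>h. Ck_on n S (\<lambda>x. f' x h)"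
  shows "Ck_on (Suc n) S f"
proof -
  have e: "\<D> f x h = f' x h" if "x \<in> S" for x h
    using frechet_derivative_at[OF assms(2)[OF that]] by simp
  have "Ck_on n S (\<lambda>x. \<D> f x h)" for h
    by (rule Ck_on_cong[OF assms(1) _ assms(3)[of h]]) (simp add: e)
  moreover have "f differentiable (at x)" if "x \<in> S" for x
    using assms(2)[OF that] by (rule differentiableI)
  ultimately show ?thesis by simp
qed

lemma Ck_on_Suc_has_derivative:
  assumes "Ck_on (Suc n) S f" "x \<in> S"
  shows "(f has_derivative \<D> f x) (at x)"
  using assms by (simp add: frechet_derivative_works)

lemma Ck_on_SucD: "Ck_on (Suc n) S f \<Longrightarrow> Ck_on n S f"
proof (induction n arbitrary: f)
  case 0
  then have "continuous (at x within S) f" if "x \<in> S" for x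
    using that differentiable_imp_continuous_within differentiable_at_withinI
    by (metis Ck_on.simps(2))
  then show ?case by (simp add: continuous_on_eq_continuous_within)
qed auto

lemma Ck_on_const: "open S \<Longrightarrow> Ck_on n S (\<lambda>x. c)"
proof (induction n arbitrary: c)
  case (Suc n)
  then show ?case by (intro Ck_on_SucI[where f' = "\<lambda>x h. 0"]) auto
qed auto

lemma Ck_on_bounded_linear:
  assumes "open S" "bounded_linear L" "Ck_on n S f"
  shows "Ck_on n S (\<lambda>x. L (f x))"
  using assms(3)
proof (induction n arbitrary: f)
  case 0
  then show ?case using assms(2) by (simp add: bounded_linear.continuous_on)
next
  case (Suc n)
  show ?case
  proof (rule Ck_on_SucI[OF assms(1)])
    show "((\<lambda>x. L (f x)) has_derivative (\<lambda>h. L (\<D> f x h))) (at x)"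
      if "x \<in> S" for x
      using bounded_linear.has_derivative[OF assms(2) Ck_on_Suc_has_derivative[OF Suc.prems that]] .
  qed (use Suc in auto)
qed

lemma Ck_on_add:
  assumes "open S" "Ck_on n S f" "Ck_on n S g"
  shows "Ck_on n S (\<lambda>x. f x + g x)"
  using assms(2,3)
proof (induction n arbitrary: f g)
  case 0
  then show ?case by (simp add: continuous_on_add)
next
  case (Suc n)
  show ?case
  proof (rule Ck_on_SucI[OF assms(1)])
    show "((\<lambda>x. f x + g x) has_derivative
        (\<lambda>h. \<D> f x h + \<D> g x h)) (at x)"
      if "x \<in> S" for x
      by (rule has_derivative_add[OF Ck_on_Suc_has_derivative[OF Suc.prems(1) that]
            Ck_on_Suc_has_derivative[OF Suc.prems(2) that]])
  qed (use Suc in auto)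
qed

lemma Ck_on_sum:
  assumes "open S" "finite I" "\<And>i. i \<in> I \<Longrightarrow> Ck_on n S (f i)"
  shows "Ck_on n S (\<lambda>x. \<Sum>i\<in>I. f i x)"
  using assms(2,3)
  by (induction rule: finite_induct) (auto intro!: Ck_on_const Ck_on_add assms(1))

lemma Ck_on_bounded_bilinear:
  assumes "open S" "bounded_bilinear b" "Ck_on n S f" "Ck_on n S g"
  shows "Ck_on n S (\<lambda>x. b (f x) (g x))"
  using assms(3,4)
proof (induction n arbitrary: f g)
  case 0
  then show ?case using assms(2) by (simp add: bounded_bilinear.continuous_on)
next
  case (Suc n)
  show ?case
  proof (rule Ck_on_SucI[OF assms(1)])
    show "((\<lambda>x. b (f x) (g x)) has_derivative
        (\<lambda>h. b (f x) (\<D> g x h) + b (\<D> f x h) (g x))) (at x)"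
      if "x \<in> S" for x
      by (rule bounded_bilinear.FDERIV[OF assms(2)
            Ck_on_Suc_has_derivative[OF Suc.prems(1) that] Ck_on_Suc_has_derivative[OF Suc.prems(2) that]])
    show "Ck_on n S (\<lambda>x. b (f x) (\<D> g x h)
        + b (\<D> f x h) (g x))" for h
      by (rule Ck_on_add[OF assms(1)]; rule Suc.IH)
         (use Suc.prems Ck_on_SucD[OF Suc.prems(1)] Ck_on_SucD[OF Suc.prems(2)] in auto)
  qed
qed

lemma linear_eq_sum_Basis:
  fixes L :: "'a::euclidean_space \<Rightarrow> 'b::real_vector"
  assumes "linear L"
  shows "L k = (\<Sum>i\<in>Basis. (k \<bullet> i) *\<^sub>R L i)"
proof -
  have "L k = L (\<Sum>i\<in>Basis. (k \<bullet> i) *\<^sub>R i)" by (simp only: euclidean_representation)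
  then show ?thesis by (simp only: linear_sum[OF assms] linear_scale[OF assms])
qed

lemma frechet_derivative_compose_Basis:
  fixes g :: "'a::euclidean_space \<Rightarrow> 'b::euclidean_space" and f :: "'b \<Rightarrow> 'c::euclidean_space"
  assumes "g differentiable (at x)" "f differentiable (at (g x))"
  shows "((\<lambda>x. f (g x)) has_derivative
    (\<lambda>h. \<Sum>i\<in>Basis. (\<D> g x h \<bullet> i) *\<^sub>R \<D> f (g x) i)) (at x)"
  unfolding linear_eq_sum_Basis[OF linear_frechet_derivative[OF assms(2)], symmetric]
  by (rule has_derivative_compose[OF assms[unfolded frechet_derivative_works]])

text \<open>In the step the derivative of the composition is expanded over a basis: it is a finite sum of
  products of functions of the smaller class \<open>n\<close>, to which the induction hypothesis and the
  product rule apply.\<close>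

lemma Ck_on_compose:
  assumes "open S" "open T" "Ck_on n S g" "Ck_on n T f" "g ` S \<subseteq> T"
  shows "Ck_on n S (\<lambda>x. f (g x))"
  using assms(3,4)
proof (induction n arbitrary: f)
  case 0
  then show ?case using assms(5) by (auto intro: continuous_on_compose2)
next
  case (Suc n)
  show ?case
  proof (rule Ck_on_SucI[OF assms(1)])
    show "((\<lambda>x. f (g x)) has_derivative (\<lambda>h. \<Sum>i\<in>Basis. (\<D> g x h \<bullet> i)
        *\<^sub>R \<D> f (g x) i)) (at x)" if "x \<in> S" for x
      using Suc.prems assms(5) that by (intro frechet_derivative_compose_Basis) auto
    have "Ck_on n S (\<lambda>x. \<D> f (g x) i)" for i
      using Suc.prems Ck_on_SucD by (intro Suc.IH) auto
    moreover have "Ck_on n S (\<lambda>x. \<D> g x h \<bullet> i)" for h i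
      by (rule Ck_on_bounded_linear[OF assms(1) bounded_linear_inner_left]) (use Suc.prems in simp)
    ultimately show "Ck_on n S (\<lambda>x. \<Sum>i\<in>Basis. (\<D> g x h \<bullet> i)
        *\<^sub>R \<D> f (g x) i)" for h
      by - (rule Ck_on_sum[OF assms(1) finite_Basis],
          rule Ck_on_bounded_bilinear[OF assms(1) bounded_bilinear_scaleR])
  qed
qed

lemma Ck_on_Pair:
  assumes "open S" "Ck_on n S f" "Ck_on n S g"
  shows "Ck_on n S (\<lambda>x. (f x, g x))"
proof -
  have l: "bounded_linear (\<lambda>y. (y, 0))" "bounded_linear (\<lambda>y. (0, y))"
    by (rule bounded_linear_Pair bounded_linear_ident bounded_linear_zero)+
  show ?thesis
    using Ck_on_add[OF assms(1) Ck_on_bounded_linear[OF assms(1) l(1) assms(2)]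
        Ck_on_bounded_linear[OF assms(1) l(2) assms(3)]]
    by (simp only: add_Pair add_0 add_0_right)
qed

lemma smooth_onE:
  assumes "smooth_on S f" "x \<in> S"
  obtains T g where "open T" "x \<in> T" "\<And>n. Ck_on n T g" "\<And>y. y \<in> S \<Longrightarrow> y \<in> T \<Longrightarrow> g y = f y"
proof -
  from assms obtain T g where "open T \<and> x \<in> T \<and> (\<forall>n. Ck_on n T g) \<and> (\<forall>y\<in>S \<inter> T. g y = f y)"
    unfolding smooth_on_def by meson
  then show thesis by (intro that[of T g]) auto
qed

lemma smooth_onI:
  assumes "\<And>x. x \<in> S \<Longrightarrow>
    \<exists>T g. open T \<and> x \<in> T \<and> (\<forall>n. Ck_on n T g) \<and> (\<forall>y\<in>S \<inter> T. g y = f y)"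
  shows "smooth_on S f"
  unfolding smooth_on_def using assms by (rule ballI)

lemma smooth_on_openI: "open S \<Longrightarrow> (\<And>n. Ck_on n S f) \<Longrightarrow> smooth_on S f"
  and smooth_on_openD: "open S \<Longrightarrow> smooth_on S f \<Longrightarrow> Ck_on n S f"
  by (simp_all add: smooth_on_open_iff)

lemma smooth_on_subset:
  assumes "smooth_on S f" "T \<subseteq> S"
  shows "smooth_on T f"
proof (rule smooth_onI)
  fix x assume "x \<in> T"
  then have "x \<in> S" using assms(2) by blast
  with assms(1) obtain A g where "open A" "x \<in> A" "\<And>n. Ck_on n A g"
    "\<And>y. y \<in> S \<Longrightarrow> y \<in> A \<Longrightarrow> g y = f y" by (rule smooth_onE) (rule that)
  then show "\<exists>A g. open A \<and> x \<in> A \<and> (\<forall>n. Ck_on n A g) \<and> (\<forall>y\<in>T \<inter> A. g y = f y)"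
    using assms(2) by blast
qed

text \<open>Composition, pairing and the rules derived from them hold on arbitrary sets, because local
  extensions can be composed; this covers maps defined on pieces of the sphere.\<close>

lemma smooth_on_compose:
  assumes "smooth_on S f" "smooth_on T g" "f ` S \<subseteq> T"
  shows "smooth_on S (\<lambda>x. g (f x))"
proof (rule smooth_onI)
  fix x assume x: "x \<in> S"
  obtain A f' where A: "open A" "x \<in> A" "\<And>n. Ck_on n A f'" "\<And>y. y \<in> S \<Longrightarrow> y \<in> A \<Longrightarrow> f' y = f y"
    using assms(1) x by (rule smooth_onE) (rule that)
  have "f x \<in> T" using assms(3) x by blast
  with assms(2) obtain B g' where B: "open B" "f x \<in> B" "\<And>n. Ck_on n B g'" "\<And>y. y \<in> T \<Longrightarrow> y \<in> B \<Longrightarrow> g' y = g y"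
    by (rule smooth_onE) (rule that)
  let ?C = "A \<inter> f' -` B"
  have "continuous_on A f'" using A(3)[of 0] by simp
  then have o: "open ?C" using A(1) B(1) by (rule continuous_open_preimage)
  have "Ck_on n ?C (\<lambda>x. g' (f' x))" for n
    by (rule Ck_on_compose[OF o B(1) Ck_on_subset[OF A(3)] B(3)]) auto
  moreover have "x \<in> ?C" using x A(2,4) B(2) by simp
  moreover have "g' (f' y) = g (f y)" if "y \<in> S" "y \<in> ?C" for y
    using that A(4) B(4) assms(3) by auto
  ultimately show "\<exists>C h. open C \<and> x \<in> C \<and> (\<forall>n. Ck_on n C h) \<and>
      (\<forall>y\<in>S \<inter> C. h y = g (f y))"
    using o by (intro exI[of _ ?C] exI[of _ "\<lambda>x. g' (f' x)"]) simp
qed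

lemma smooth_on_Pair:
  assumes "smooth_on S f" "smooth_on S g"
  shows "smooth_on S (\<lambda>x. (f x, g x))"
proof (rule smooth_onI)
  fix x assume x: "x \<in> S"
  obtain A f' where A: "open A" "x \<in> A" "\<And>n. Ck_on n A f'" "\<And>y. y \<in> S \<Longrightarrow> y \<in> A \<Longrightarrow> f' y = f y"
    using assms(1) x by (rule smooth_onE) (rule that)
  obtain B g' where B: "open B" "x \<in> B" "\<And>n. Ck_on n B g'" "\<And>y. y \<in> S \<Longrightarrow> y \<in> B \<Longrightarrow> g' y = g y"
    using assms(2) x by (rule smooth_onE) (rule that)
  have "Ck_on n (A \<inter> B) (\<lambda>x. (f' x, g' x))" for n
    using A(1) B(1) by (intro Ck_on_Pair Ck_on_subset[OF A(3)] Ck_on_subset[OF B(3)]) auto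
  then show "\<exists>C h. open C \<and> x \<in> C \<and> (\<forall>n. Ck_on n C h) \<and>
      (\<forall>y\<in>S \<inter> C. h y = (f y, g y))"
    using A B by (intro exI[of _ "A \<inter> B"] exI[of _ "\<lambda>x. (f' x, g' x)"]) auto
qed

lemma smooth_on_const: "smooth_on S (\<lambda>x. c)"
  by (rule smooth_on_subset[OF _ subset_UNIV]) (simp add: smooth_on_open_iff Ck_on_const)

lemma smooth_on_id: "smooth_on S (\<lambda>x. x)"
proof -
  have "Ck_on n UNIV (\<lambda>x::'a. x)" for n
    by (cases n) (auto intro!: Ck_on_SucI[where f' = "\<lambda>x h. h"] Ck_on_const)
  then have "smooth_on UNIV (\<lambda>x::'a. x)" by (simp add: smooth_on_open_iff)
  then show ?thesis by (rule smooth_on_subset) simp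
qed

lemma smooth_on_bounded_linear:
  assumes "bounded_linear L" "smooth_on S f"
  shows "smooth_on S (\<lambda>x. L (f x))"
proof (rule smooth_on_compose[OF assms(2)])
  show "smooth_on UNIV L"
    by (rule smooth_on_openI[OF open_UNIV Ck_on_bounded_linear[OF open_UNIV assms(1)
            smooth_on_openD[OF open_UNIV smooth_on_id]]])
qed simp

lemma smooth_on_bounded_bilinear:
  fixes b :: "'b::euclidean_space \<Rightarrow> 'c::euclidean_space \<Rightarrow> 'd::euclidean_space"
  assumes "bounded_bilinear b" "smooth_on S f" "smooth_on S g"
  shows "smooth_on S (\<lambda>x. b (f x) (g x))"
proof -
  have p: "Ck_on n UNIV (fst :: 'b \<times> 'c \<Rightarrow> 'b)" "Ck_on n UNIV (snd :: 'b \<times> 'c \<Rightarrow> 'c)" for n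
    using smooth_on_bounded_linear[OF bounded_linear_fst smooth_on_id[of "UNIV :: ('b \<times> 'c) set"]]
      smooth_on_bounded_linear[OF bounded_linear_snd smooth_on_id[of "UNIV :: ('b \<times> 'c) set"]]
    by (simp_all add: smooth_on_openD)
  have "smooth_on UNIV (\<lambda>p :: 'b \<times> 'c. b (fst p) (snd p))"
    by (rule smooth_on_openI[OF open_UNIV Ck_on_bounded_bilinear[OF open_UNIV assms(1) p]])
  from smooth_on_compose[OF smooth_on_Pair[OF assms(2,3)] this] show ?thesis by simp
qed

lemmas smooth_on_scaleR = smooth_on_bounded_bilinear[OF bounded_bilinear_scaleR]
lemmas smooth_on_mult = smooth_on_bounded_bilinear[OF bounded_bilinear_mult]
lemmas smooth_on_inner = smooth_on_bounded_bilinear[OF bounded_bilinear_inner]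
lemmas smooth_on_nth = smooth_on_bounded_linear[OF bounded_linear_vec_nth]

lemma smooth_on_add:
  assumes "smooth_on S f" "smooth_on S g"
  shows "smooth_on S (\<lambda>x. f x + g x)"
  using smooth_on_bounded_linear[OF bounded_linear_add[OF bounded_linear_fst bounded_linear_snd]
      smooth_on_Pair[OF assms]] by simp

lemma smooth_on_minus: "smooth_on S f \<Longrightarrow> smooth_on S (\<lambda>x. - f x)"
  using smooth_on_bounded_linear[OF bounded_linear_minus[OF bounded_linear_ident]] .

lemma smooth_on_diff:
  assumes "smooth_on S f" "smooth_on S g"
  shows "smooth_on S (\<lambda>x. f x - g x)"
  using smooth_on_add[OF assms(1) smooth_on_minus[OF assms(2)]] by simp

lemma smooth_on_power:
  fixes f :: "'a::euclidean_space \<Rightarrow> real"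
  assumes "smooth_on S f"
  shows "smooth_on S (\<lambda>x. f x ^ n)"
proof (induction n)
  case (Suc n)
  show ?case using smooth_on_mult[OF assms Suc] by simp
qed (simp add: smooth_on_const)

lemma smooth_on_inverse:
  assumes "smooth_on S f" "\<And>x. x \<in> S \<Longrightarrow> f x \<noteq> (0::real)"
  shows "smooth_on S (\<lambda>x. inverse (f x))"
proof (rule smooth_on_compose[OF assms(1)])
  have "Ck_on n (- {0::real}) inverse" for n
  proof (induction n)
    case (Suc n)
    show ?case
    proof (rule Ck_on_SucI)
      show "(inverse has_derivative (\<lambda>h. inverse x * inverse x * - h)) (at x)"
        if "x \<in> - {0::real}" for x
        by (rule has_derivative_eq_rhs[OF has_derivative_inverse']) (use that in \<open>auto simp: mult_ac\<close>)
      show "Ck_on n (- {0::real}) (\<lambda>x. inverse x * inverse x * - h)" for h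
        by (rule Ck_on_bounded_bilinear[OF _ bounded_bilinear_mult
              Ck_on_bounded_bilinear[OF _ bounded_bilinear_mult Suc Suc] Ck_on_const]) auto
    qed auto
  qed (auto intro: continuous_intros)
  then show "smooth_on (- {0::real}) inverse" by (intro smooth_on_openI) auto
qed (use assms(2) in auto)

lemma smooth_on_divide:
  assumes "smooth_on S f" "smooth_on S g" "\<And>x. x \<in> S \<Longrightarrow> g x \<noteq> (0::real)"
  shows "smooth_on S (\<lambda>x. f x / g x)"
  using smooth_on_mult[OF assms(1) smooth_on_inverse[OF assms(2,3)]] by (simp add: divide_inverse)

lemma smooth_on_sqrt:
  assumes "smooth_on S f" "\<And>x. x \<in> S \<Longrightarrow> f x > (0::real)"
  shows "smooth_on S (\<lambda>x. sqrt (f x))"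
proof (rule smooth_on_compose[OF assms(1)])
  have "Ck_on n {0::real<..} sqrt" for n
  proof (induction n)
    case (Suc n)
    show ?case
    proof (rule Ck_on_SucI)
      show "(sqrt has_derivative (\<lambda>h. inverse (sqrt x) * (h / 2))) (at x)"
        if "x \<in> {0::real<..}" for x
        by (rule has_derivative_eq_rhs[OF DERIV_real_sqrt[unfolded has_field_derivative_def]])
           (use that in \<open>auto simp: fun_eq_iff\<close>)
      have "smooth_on (- {0::real}) inverse"
        by (rule smooth_on_inverse[OF smooth_on_id]) simp
      then have "Ck_on n (- {0::real}) inverse" by (intro smooth_on_openD) auto
      then have "Ck_on n {0::real<..} (\<lambda>x. inverse (sqrt x))"
        by (rule Ck_on_compose[OF _ _ Suc, rotated 2]) auto
      then show "Ck_on n {0::real<..} (\<lambda>x. inverse (sqrt x) * (h / 2))" for h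
        by (rule Ck_on_bounded_bilinear[OF _ bounded_bilinear_mult _ Ck_on_const, rotated]) auto
    qed auto
  qed (auto intro: continuous_intros)
  then show "smooth_on {0::real<..} sqrt" by (intro smooth_on_openI) auto
qed (use assms(2) in auto)

lemma smooth_on_vec_lambda:
  fixes f :: "'a::euclidean_space \<Rightarrow> real ^ 'n"
  assumes "\<And>i. smooth_on S (\<lambda>x. f x $ i)"
  shows "smooth_on S f"
proof -
  have e: "f x = (\<Sum>i\<in>UNIV. f x $ i *\<^sub>R (axis i 1 :: real ^ 'n))" for x
    by (simp add: vec_eq_iff axis_def if_distrib cong: if_cong)
  have "smooth_on S (\<lambda>x. \<Sum>i\<in>I. f x $ i *\<^sub>R (axis i 1 :: real ^ 'n))" if "finite I" for I
    using that
  proof induction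
    case (insert j I)
    have "smooth_on S (\<lambda>x. f x $ j *\<^sub>R (axis j 1 :: real ^ 'n))"
      by (rule smooth_on_scaleR[OF assms smooth_on_const])
    from smooth_on_add[OF this insert.IH] show ?case using insert.hyps by simp
  qed (simp add: smooth_on_const)
  then have "smooth_on S (\<lambda>x. \<Sum>i\<in>UNIV. f x $ i *\<^sub>R (axis i 1 :: real ^ 'n))" by simp
  then show ?thesis using e by simp
qed

lemma smooth_on_vector_2:
  assumes "smooth_on S f" "smooth_on S g"
  shows "smooth_on S (\<lambda>x. vector [f x, g x] :: real^2)"
proof (rule smooth_on_vec_lambda)
  show "smooth_on S (\<lambda>x. (vector [f x, g x] :: real^2) $ i)" for i :: 2
    using assms exhaust_2[of i] by auto
qed

lemma smooth_on_vector_3: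
  assumes "smooth_on S f" "smooth_on S g" "smooth_on S h"
  shows "smooth_on S (\<lambda>x. vector [f x, g x, h x] :: real^3)"
proof (rule smooth_on_vec_lambda)
  show "smooth_on S (\<lambda>x. (vector [f x, g x, h x] :: real^3) $ i)" for i :: 3
    using assms exhaust_3[of i] by auto
qed

lemma smooth_on_frechet_derivative:
  assumes "open S" "smooth_on S f"
  shows "smooth_on S (\<lambda>x. \<D> f x h)"
proof -
  have "Ck_on (Suc n) S f" for n using assms by (simp add: smooth_on_open_iff)
  then show ?thesis using assms(1) by (simp add: smooth_on_open_iff)
qed

lemma smooth_on_continuous_on:
  assumes "smooth_on S f"
  shows "continuous_on S f"
proof -
  have "continuous (at x within S) f" if x: "x \<in> S" for x
  proof -
    obtain T g where T: "open T" "x \<in> T" "\<And>n. Ck_on n T g" "\<And>y. y \<in> S \<Longrightarrow> y \<in> T \<Longrightarrow> g y = f y"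
      using assms x by (rule smooth_onE) (rule that)
    have "continuous (at x) g"
      using T(1,2) T(3)[of 0] by (simp add: continuous_on_eq_continuous_at)
    then have "continuous (at x within S) g" by (rule continuous_at_imp_continuous_at_within)
    then show ?thesis
      by (rule continuous_transform_within_openin[where S = "S \<inter> T" and f = g])
         (use T x in \<open>auto simp: openin_open_Int\<close>)
  qed
  then show ?thesis by (simp add: continuous_on_eq_continuous_within)
qed

lemma smooth_on_differentiable:
  assumes "open S" "smooth_on S f" "x \<in> S"
  shows "f differentiable (at x)"
proof -
  have "Ck_on (Suc 0) S f" using assms by (simp add: smooth_on_open_iff del: Ck_on.simps)
  then show ?thesis using assms(3) by simp
qed

lemma frechet_derivative_cong_on_open:
  assumes "open S" "x \<in> S" "\<And>y. y \<in> S \<Longrightarrow> f y = g y"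
  shows "\<D> f x = \<D> g x"
proof -
  have "(f has_derivative d) (at x) \<longleftrightarrow> (g has_derivative d) (at x)" for d
    using has_derivative_transform_within_open[OF _ assms(1,2), of f d UNIV g]
      has_derivative_transform_within_open[OF _ assms(1,2), of g d UNIV f] assms(3) by auto
  then show ?thesis by (simp add: frechet_derivative_def)
qed


section \<open>Diffeomorphisms\<close>

lemma diffeomorphism_sym: "diffeomorphism S T f g \<Longrightarrow> diffeomorphism T S g f"
  unfolding diffeomorphism_def by (meson homeomorphism_symD)

lemma diffeomorphism_compose:
  assumes "diffeomorphism S T f g" "diffeomorphism T U f' g'"
  shows "diffeomorphism S U (f' \<circ> f) (g \<circ> g')"
proof -
  have im: "f ` S = T" "g' ` U = T"
    using assms by (auto simp: diffeomorphism_def homeomorphism_def)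
  show ?thesis
    using assms im homeomorphism_compose[of S T f g U f' g'] smooth_on_compose[of S f T f']
      smooth_on_compose[of U g' T g]
    unfolding diffeomorphism_def by (simp add: o_def)
qed

lemma diffeomorphism_restrict:
  assumes "diffeomorphism S T f g" "S' \<subseteq> S" "T' = f ` S'"
  shows "diffeomorphism S' T' f g"
proof -
  have "T' \<subseteq> T" using assms by (auto simp: diffeomorphism_def homeomorphism_def)
  then show ?thesis
    using assms smooth_on_subset[of S f S'] smooth_on_subset[of T g T']
      homeomorphism_of_subsets[of S T f g S' T']
    unfolding diffeomorphism_def by simp
qed

lemma diffeomorphism_apply:
  assumes "diffeomorphism S T f g"
  shows "x \<in> S \<Longrightarrow> f x \<in> T" "x \<in> S \<Longrightarrow> g (f x) = x" "y \<in> T \<Longrightarrow> g y \<in> S" "y \<in> T \<Longrightarrow> f (g y) = y"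
  using assms by (auto simp: diffeomorphism_def homeomorphism_def)

lemma diffeomorphism_smooth:
  assumes "diffeomorphism S T f g"
  shows "smooth_on S f" "smooth_on T g"
  using assms by (auto simp: diffeomorphism_def)

lemma diffeomorphism_image: "diffeomorphism S T f g \<Longrightarrow> f ` S = T"
  by (auto simp: diffeomorphism_def homeomorphism_def)

text \<open>An image is a preimage under the continuous inverse; this is how images of open sets are seen to be
  open.\<close>

lemma diffeomorphism_image_eq:
  assumes "diffeomorphism S T f g" "S' \<subseteq> S"
  shows "f ` S' = {y \<in> T. g y \<in> S'}"
  using assms diffeomorphism_apply[OF assms(1)] by force

lemma diffeomorphism_open_image:
  assumes "diffeomorphism S T f g" "open T" "open S'" "S' \<subseteq> S"
  shows "open (f ` S')"
proof -
  have "open (T \<inter> g -` S')"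
    using assms(2,3)
    by (rule continuous_open_preimage[OF smooth_on_continuous_on[OF diffeomorphism_smooth(2)[OF assms(1)]]])
  moreover have "f ` S' = T \<inter> g -` S'"
    by (auto simp: diffeomorphism_image_eq[OF assms(1,4)])
  ultimately show ?thesis by simp
qed

lemma diffeomorphism_derivative:
  assumes "diffeomorphism S T f g" "open S" "open T" "x \<in> S"
  shows "\<D> g (f x) (\<D> f x h) = h"
proof -
  have "f differentiable (at x)"
    using smooth_on_differentiable[OF assms(2) diffeomorphism_smooth(1)[OF assms(1)] assms(4)] .
  moreover have "g differentiable (at (f x))"
    using smooth_on_differentiable[OF assms(3) diffeomorphism_smooth(2)[OF assms(1)]
        diffeomorphism_apply(1)[OF assms(1,4)]] .
  ultimately have d: "(f has_derivative \<D> f x) (at x)"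
    "(g has_derivative \<D> g (f x)) (at (f x))"
    by (simp_all add: frechet_derivative_works)
  have "((\<lambda>x. g (f x)) has_derivative
      (\<lambda>h. \<D> g (f x) (\<D> f x h))) (at x)"
    by (rule has_derivative_compose[OF d])
  then have "((\<lambda>x. x) has_derivative
      (\<lambda>h. \<D> g (f x) (\<D> f x h))) (at x)"
    by (rule has_derivative_transform_within_open[OF _ assms(2,4)])
       (use diffeomorphism_apply[OF assms(1)] in auto)
  from has_derivative_unique[OF this has_derivative_ident] show ?thesis by (rule fun_cong)
qed


section \<open>Partial derivatives in the plane\<close>

lemma frechet_derivative_eq: "(f has_derivative f') (at x) \<Longrightarrow> \<D> f x h = f' h"
  using frechet_derivative_at by metis

lemma frechet_derivative_bilinear:
  assumes "bounded_bilinear b" "f differentiable (at x)" "g differentiable (at x)"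
  shows "\<D> (\<lambda>x. b (f x) (g x)) x h
    = b (f x) (\<D> g x h) + b (\<D> f x h) (g x)"
  by (rule frechet_derivative_eq[OF bounded_bilinear.FDERIV[OF assms(1)
        assms(2,3)[unfolded frechet_derivative_works]]])

lemma frechet_derivative_linear:
  assumes "bounded_linear L" "f differentiable (at x)"
  shows "\<D> (\<lambda>x. L (f x)) x h = L (\<D> f x h)"
  by (rule frechet_derivative_eq[OF bounded_linear.has_derivative[OF assms(1)
        assms(2)[unfolded frechet_derivative_works]]])

lemma frechet_derivative_chain:
  assumes "g differentiable (at x)" "f differentiable (at (g x))"
  shows "\<D> (\<lambda>x. f (g x)) x h
    = \<D> f (g x) (\<D> g x h)"
  by (rule frechet_derivative_eq[OF has_derivative_compose[OF assms[unfolded frechet_derivative_works]]])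

lemma frechet_derivative_add_fun:
  assumes "f differentiable (at x)" "g differentiable (at x)"
  shows "\<D> (\<lambda>x. f x + g x) x h
    = \<D> f x h + \<D> g x h"
  by (rule frechet_derivative_eq[OF has_derivative_add[OF assms[unfolded frechet_derivative_works]]])

lemma frechet_derivative_diff_fun:
  assumes "f differentiable (at x)" "g differentiable (at x)"
  shows "\<D> (\<lambda>x. f x - g x) x h
    = \<D> f x h - \<D> g x h"
  by (rule frechet_derivative_eq[OF has_derivative_diff[OF assms[unfolded frechet_derivative_works]]])

lemma partials_bilinear:
  assumes "bounded_bilinear b" "f differentiable (at x)" "g differentiable (at x)"
  shows "D\<^sub>u (\<lambda>x. b (f x) (g x)) x = b (f x) (D\<^sub>u g x) + b (D\<^sub>u f x) (g x)"
    "D\<^sub>v (\<lambda>x. b (f x) (g x)) x = b (f x) (D\<^sub>v g x) + b (D\<^sub>v f x) (g x)"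
  unfolding D\<^sub>u_def D\<^sub>v_def by (rule frechet_derivative_bilinear[OF assms])+

lemmas partials_inner = partials_bilinear[OF bounded_bilinear_inner]
lemmas partials_mult = partials_bilinear[OF bounded_bilinear_mult]

lemma partials_linear:
  assumes "bounded_linear L" "f differentiable (at x)"
  shows "D\<^sub>u (\<lambda>x. L (f x)) x = L (D\<^sub>u f x)" "D\<^sub>v (\<lambda>x. L (f x)) x = L (D\<^sub>v f x)"
  unfolding D\<^sub>u_def D\<^sub>v_def by (rule frechet_derivative_linear[OF assms])+

lemma partials_const: "D\<^sub>u (\<lambda>x. c) x = 0" "D\<^sub>v (\<lambda>x. c) x = 0"
  unfolding D\<^sub>u_def D\<^sub>v_def by (simp_all add: frechet_derivative_const)

lemma partials_add:
  assumes "f differentiable (at x)" "g differentiable (at x)"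
  shows "D\<^sub>u (\<lambda>x. f x + g x) x = D\<^sub>u f x + D\<^sub>u g x" "D\<^sub>v (\<lambda>x. f x + g x) x = D\<^sub>v f x + D\<^sub>v g x"
  unfolding D\<^sub>u_def D\<^sub>v_def by (rule frechet_derivative_add_fun[OF assms])+

lemma partials_diff:
  assumes "f differentiable (at x)" "g differentiable (at x)"
  shows "D\<^sub>u (\<lambda>x. f x - g x) x = D\<^sub>u f x - D\<^sub>u g x" "D\<^sub>v (\<lambda>x. f x - g x) x = D\<^sub>v f x - D\<^sub>v g x"
  unfolding D\<^sub>u_def D\<^sub>v_def by (rule frechet_derivative_diff_fun[OF assms])+

lemma partials_cong:
  assumes "open S" "x \<in> S" "\<And>y. y \<in> S \<Longrightarrow> f y = g y"
  shows "D\<^sub>u f x = D\<^sub>u g x" "D\<^sub>v f x = D\<^sub>v g x"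
  unfolding D\<^sub>u_def D\<^sub>v_def by (simp_all only: frechet_derivative_cong_on_open[OF assms])

lemma partials_coordinates:
  "D\<^sub>u (\<lambda>x. x $ 1) x = 1" "D\<^sub>v (\<lambda>x. x $ 1) x = 0" "D\<^sub>u (\<lambda>x. x $ 2) x = 0" "D\<^sub>v (\<lambda>x. x $ 2) x = 1"
  unfolding D\<^sub>u_def D\<^sub>v_def
  by (simp_all add: frechet_derivative_eq[OF bounded_linear_imp_has_derivative[OF bounded_linear_vec_nth]]
      axis_def)

lemma partials_eq:
  "D\<^sub>u f = (\<lambda>q. \<D> f q (axis 1 1))"
  "D\<^sub>v f = (\<lambda>q. \<D> f q (axis 2 1))"
  by (auto simp: D\<^sub>u_def D\<^sub>v_def)

lemma smooth_on_partials:
  assumes "open S" "smooth_on S f"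
  shows "smooth_on S (D\<^sub>u f)" "smooth_on S (D\<^sub>v f)"
  unfolding partials_eq by (rule smooth_on_frechet_derivative[OF assms])+

lemma frechet_derivative_partials:
  fixes f :: "real^2 \<Rightarrow> 'b::real_normed_vector"
  assumes "f differentiable (at x)"
  shows "\<D> f x h = h $ 1 *\<^sub>R D\<^sub>u f x + h $ 2 *\<^sub>R D\<^sub>v f x"
proof -
  have l: "linear (\<D> f x)"
    using assms by (rule linear_frechet_derivative)
  have "h = h $ 1 *\<^sub>R axis 1 1 + h $ 2 *\<^sub>R axis 2 1"
    by (simp add: vec_eq_iff forall_2 axis_def)
  then have "\<D> f x h
      = \<D> f x (h $ 1 *\<^sub>R axis 1 1 + h $ 2 *\<^sub>R axis 2 1)" by (rule arg_cong)
  then show ?thesis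
    by (simp only: linear_add[OF l] linear_scale[OF l] D\<^sub>u_def D\<^sub>v_def)
qed

lemma partials_chain:
  fixes g :: "real^2 \<Rightarrow> real^2"
  assumes "g differentiable (at x)" "f differentiable (at (g x))"
  shows "D\<^sub>u (\<lambda>x. f (g x)) x = D\<^sub>u g x $ 1 *\<^sub>R D\<^sub>u f (g x) + D\<^sub>u g x $ 2 *\<^sub>R D\<^sub>v f (g x)"
    "D\<^sub>v (\<lambda>x. f (g x)) x = D\<^sub>v g x $ 1 *\<^sub>R D\<^sub>u f (g x) + D\<^sub>v g x $ 2 *\<^sub>R D\<^sub>v f (g x)"
  unfolding frechet_derivative_partials[OF assms(2), symmetric]
  unfolding D\<^sub>u_def D\<^sub>v_def by (rule frechet_derivative_chain[OF assms])+

text \<open>The restriction of \<open>f\<close> to the line through \<open>x\<close> parallel to the axis vanishes near \<open>x\<close>.\<close>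

lemma D\<^sub>u_zero_on_axis:
  fixes f :: "real^2 \<Rightarrow> 'b::real_normed_vector"
  assumes "open S" "x \<in> S" "x $ 2 = 0" "f differentiable (at x)"
    "\<And>y. y \<in> S \<Longrightarrow> y $ 2 = 0 \<Longrightarrow> f y = 0"
  shows "D\<^sub>u f x = 0"
proof -
  let ?l = "\<lambda>t::real. x + t *\<^sub>R axis 1 1"
  have l: "(?l has_derivative (\<lambda>t. t *\<^sub>R axis 1 1)) (at 0)"
    by (auto intro!: derivative_eq_intros)
  have "(f has_derivative \<D> f x) (at (?l 0))"
    using assms(4) by (simp add: frechet_derivative_works)
  from has_derivative_compose[OF l this]
  have d: "((\<lambda>t. f (?l t)) has_derivative (\<lambda>t. \<D> f x (t *\<^sub>R axis 1 1))) (at 0)" .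
  have "continuous_on UNIV ?l" by (intro continuous_intros)
  then have o: "open (?l -` S)" using assms(1) by (intro open_vimage)
  have "((\<lambda>t. 0) has_derivative (\<lambda>t. \<D> f x (t *\<^sub>R axis 1 1))) (at 0)"
    by (rule has_derivative_transform_within_open[OF d o])
       (use assms in \<open>auto simp: axis_def\<close>)
  from has_derivative_unique[OF this has_derivative_const]
  have "\<D> f x (1 *\<^sub>R axis 1 1) = 0" by (rule fun_cong)
  then show ?thesis by (simp add: D\<^sub>u_def)
qed

text \<open>Schwarz's theorem: both iterated derivatives are limits of the same second difference, to which
  the mean value theorem is applied once in each direction.\<close>

lemma second_difference_mean_value:
  fixes f :: "'a::euclidean_space \<Rightarrow> real"
  assumes f: "smooth_on (ball x d) f" and s: "0 < s" "s * (norm h + norm k) < d"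
  shows "\<exists>y\<in>ball x d. f (x + s *\<^sub>R h + s *\<^sub>R k) - f (x + s *\<^sub>R h) - (f (x + s *\<^sub>R k) - f x)
    = s * s * \<D> (\<lambda>y. \<D> f y h) y k"
proof -
  have inb: "x + t *\<^sub>R h + r *\<^sub>R k \<in> ball x d" if "0 \<le> t" "t \<le> s" "0 \<le> r" "r \<le> s" for t r
  proof -
    have "norm (t *\<^sub>R h + r *\<^sub>R k) \<le> t * norm h + r * norm k"
      using norm_triangle_ineq[of "t *\<^sub>R h" "r *\<^sub>R k"] that by simp
    also have "\<dots> \<le> s * (norm h + norm k)"
      using that by (simp add: distrib_left add_mono mult_right_mono)
    finally have "norm (t *\<^sub>R h + r *\<^sub>R k) < d" using s by simp
    then show ?thesis using norm_minus_cancel[of "t *\<^sub>R h + r *\<^sub>R k"] by (simp add: dist_norm add.assoc add.commute)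
  qed
  have der: "((\<lambda>t. g (c + t *\<^sub>R w)) has_real_derivative \<D> g (c + t *\<^sub>R w) w) (at t)"
    if "smooth_on (ball x d) g" "c + t *\<^sub>R w \<in> ball x d" for g :: "'a \<Rightarrow> real" and c w t
  proof -
    have g: "g differentiable (at (c + t *\<^sub>R w))"
      by (rule smooth_on_differentiable[OF _ that]) simp
    have 1: "((\<lambda>t. c + t *\<^sub>R w) has_derivative (\<lambda>t. t *\<^sub>R w)) (at t)"
      by (auto intro!: derivative_eq_intros)
    show ?thesis
      unfolding has_field_derivative_def
      by (rule has_derivative_eq_rhs[OF has_derivative_compose[OF 1 g[unfolded frechet_derivative_works]]])
         (simp add: fun_eq_iff linear_scale[OF linear_frechet_derivative[OF g]])
  qed
  let ?D = "\<lambda>y. \<D> f y h"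
  have sD: "smooth_on (ball x d) ?D" using smooth_on_frechet_derivative[OF _ f] by simp
  let ?\<phi> = "\<lambda>t. f (x + s *\<^sub>R k + t *\<^sub>R h) - f (x + t *\<^sub>R h)"
  have "(?\<phi> has_real_derivative (?D (x + s *\<^sub>R k + t *\<^sub>R h) - ?D (x + t *\<^sub>R h))) (at t)"
    if "0 \<le> t" "t \<le> s" for t
    using inb[OF that, of s] inb[OF that, of 0] s(1)
    by (intro DERIV_diff der f) (simp_all add: algebra_simps)
  from MVT2[OF s(1) this] obtain t where t: "0 < t" "t < s"
    "?\<phi> s - ?\<phi> 0 = (s - 0) * (?D (x + s *\<^sub>R k + t *\<^sub>R h) - ?D (x + t *\<^sub>R h))" by auto
  have "((\<lambda>r. ?D (x + t *\<^sub>R h + r *\<^sub>R k)) has_real_derivative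
      \<D> ?D (x + t *\<^sub>R h + r *\<^sub>R k) k) (at r)" if "0 \<le> r" "r \<le> s" for r
    using inb[of t r] t that by (intro der sD) simp
  from MVT2[OF s(1) this] obtain r where r: "0 < r" "r < s"
    "?D (x + t *\<^sub>R h + s *\<^sub>R k) - ?D (x + t *\<^sub>R h + 0 *\<^sub>R k)
      = (s - 0) * \<D> ?D (x + t *\<^sub>R h + r *\<^sub>R k) k" by auto
  have "x + t *\<^sub>R h + r *\<^sub>R k \<in> ball x d" using inb t r by simp
  moreover have "f (x + s *\<^sub>R h + s *\<^sub>R k) - f (x + s *\<^sub>R h) - (f (x + s *\<^sub>R k) - f x)
      = s * s * \<D> ?D (x + t *\<^sub>R h + r *\<^sub>R k) k"
    using t(3) r(3) by (simp add: add_ac)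
  ultimately show ?thesis by blast
qed

lemma second_derivative_symmetric_real:
  fixes f :: "'a::euclidean_space \<Rightarrow> real"
  assumes S: "open S" and f: "smooth_on S f" and x: "x \<in> S"
  shows "\<D> (\<lambda>y. \<D> f y h) x k
    = \<D> (\<lambda>y. \<D> f y k) x h" (is "?A x = ?B x")
proof (rule ccontr)
  assume "?A x \<noteq> ?B x"
  define e where "e = \<bar>?A x - ?B x\<bar> / 2"
  have e: "e > 0" using \<open>?A x \<noteq> ?B x\<close> by (simp add: e_def)
  have "smooth_on S ?A" "smooth_on S ?B"
    using smooth_on_frechet_derivative[OF S smooth_on_frechet_derivative[OF S f]] by simp_all
  then have "continuous_on S ?A" "continuous_on S ?B" by (simp_all add: smooth_on_continuous_on)
  then have "isCont ?A x" "isCont ?B x" using S x by (simp_all add: continuous_on_eq_continuous_at)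
  then obtain d1 d2 where d: "d1 > 0" "d2 > 0"
    "\<And>y. dist y x < d1 \<Longrightarrow> dist (?A y) (?A x) < e" "\<And>y. dist y x < d2 \<Longrightarrow> dist (?B y) (?B x) < e"
    using e by (fastforce simp: continuous_at_eps_delta)
  obtain d3 where d3: "d3 > 0" "ball x d3 \<subseteq> S" using S x openE by blast
  define d where "d = min d1 (min d2 d3)"
  have d0: "d > 0" using d d3 by (simp add: d_def)
  define s where "s = d / (2 * (norm h + norm k + 1))"
  have n0: "norm h + norm k + 1 > 0" using norm_ge_zero[of h] norm_ge_zero[of k] by linarith
  have s0: "s > 0" using d0 n0 by (simp add: s_def)
  have "s * (norm h + norm k) < s * (norm h + norm k + 1)" using s0 by simp
  also have "\<dots> = d / 2" using n0 by (simp add: s_def field_simps)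
  finally have s1: "s * (norm h + norm k) < d" using d0 by simp
  then have s2: "s * (norm k + norm h) < d" by (simp add: add.commute)
  have fb: "smooth_on (ball x d) f"
    by (rule smooth_on_subset[OF f]) (use d3 in \<open>auto simp: d_def\<close>)
  obtain y where y: "y \<in> ball x d"
    "f (x + s *\<^sub>R h + s *\<^sub>R k) - f (x + s *\<^sub>R h) - (f (x + s *\<^sub>R k) - f x) = s * s * ?A y"
    using second_difference_mean_value[OF fb s0 s1] by blast
  obtain z where z: "z \<in> ball x d"
    "f (x + s *\<^sub>R k + s *\<^sub>R h) - f (x + s *\<^sub>R k) - (f (x + s *\<^sub>R h) - f x) = s * s * ?B z"
    using second_difference_mean_value[OF fb s0 s2] by blast
  have c: "x + s *\<^sub>R k + s *\<^sub>R h = x + s *\<^sub>R h + s *\<^sub>R k" by (simp add: add_ac)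
  have "s * s * ?A y = s * s * ?B z" using y(2) z(2) unfolding c by linarith
  then have "?A y = ?B z" using s0 by simp
  moreover have "\<bar>?A y - ?A x\<bar> < e" "\<bar>?B z - ?B x\<bar> < e"
    using d(3)[of y] d(4)[of z] y(1) z(1) by (simp_all add: dist_commute d_def dist_real_def)
  ultimately have "\<bar>?A x - ?B x\<bar> < 2 * e" by linarith
  then show False by (simp add: e_def)
qed

lemma second_derivative_symmetric:
  fixes f :: "'a::euclidean_space \<Rightarrow> 'b::euclidean_space"
  assumes S: "open S" and f: "smooth_on S f" and x: "x \<in> S"
  shows "\<D> (\<lambda>y. \<D> f y h) x k
    = \<D> (\<lambda>y. \<D> f y k) x h"
proof (rule euclidean_eqI)
  fix i :: 'b
  let ?f = "\<lambda>y. f y \<bullet> i"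
  have 1: "\<D> ?f y w = \<D> f y w \<bullet> i" if "y \<in> S" for y w
    by (rule frechet_derivative_linear[OF bounded_linear_inner_left smooth_on_differentiable[OF S f that]])
  have 2: "\<D> (\<lambda>y. \<D> ?f y w) x z
      = \<D> (\<lambda>y. \<D> f y w) x z \<bullet> i" for w z
  proof -
    have "\<D> (\<lambda>y. \<D> ?f y w) x
        = \<D> (\<lambda>y. \<D> f y w \<bullet> i) x"
      by (rule frechet_derivative_cong_on_open[OF S x 1])
    then show ?thesis
      using frechet_derivative_linear[OF bounded_linear_inner_left
          smooth_on_differentiable[OF S smooth_on_frechet_derivative[OF S f] x]] by simp
  qed
  show "\<D> (\<lambda>y. \<D> f y h) x k \<bullet> i
      = \<D> (\<lambda>y. \<D> f y k) x h \<bullet> i"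
    using second_derivative_symmetric_real[OF S smooth_on_inner[OF f smooth_on_const] x, of i h k]
    by (simp only: 2)
qed

lemma partials_commute:
  fixes f :: "real^2 \<Rightarrow> 'b::euclidean_space"
  assumes "open S" "smooth_on S f" "x \<in> S"
  shows "D\<^sub>v (D\<^sub>u f) x = D\<^sub>u (D\<^sub>v f) x"
  unfolding partials_eq by (rule second_derivative_symmetric[OF assms])


section \<open>Dividing by a coordinate\<close>

definition contract_v :: "real \<Rightarrow> real^2 \<Rightarrow> real^2" where
  "contract_v t x = vector [x $ 1, t * x $ 2]"

lemma contract_v_nth [simp]: "contract_v t x $ 1 = x $ 1" "contract_v t x $ 2 = t * x $ 2"
  by (simp_all add: contract_v_def)

lemma bounded_linear_contract_v: "bounded_linear (contract_v t)"
  unfolding linear_conv_bounded_linear[symmetric]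
  by (rule linearI) (simp_all add: vec_eq_iff forall_2 algebra_simps)

lemma norm_contract_v:
  assumes "0 \<le> t" "t \<le> 1"
  shows "norm (contract_v t x) \<le> norm x"
proof (rule norm_le_componentwise_cart)
  have "\<bar>t * x $ 2\<bar> \<le> \<bar>x $ 2\<bar>" using assms by (simp add: abs_mult mult_left_le_one_le)
  then show "norm (contract_v t x $ i) \<le> norm (x $ i)" for i
    using exhaust_2[of i] by auto
qed

lemma contract_v_in_ball: "x \<in> ball 0 r \<Longrightarrow> 0 \<le> t \<Longrightarrow> t \<le> 1 \<Longrightarrow> contract_v t x \<in> ball 0 r"
  using norm_contract_v[of t x] by simp

lemma continuous_on_contract_v:
  assumes "continuous_on (ball 0 r) g"
  shows "continuous_on (ball 0 r \<times> {0..1}) (\<lambda>(x, t). g (contract_v t x))"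
proof -
  have "continuous_on A (\<lambda>z. contract_v (snd z) (fst z))" for A
  proof -
    have "contract_v t x = x $ 1 *\<^sub>R axis 1 1 + (t * x $ 2) *\<^sub>R axis 2 1" for t x
      by (simp add: vec_eq_iff forall_2 axis_def)
    then show ?thesis by (simp only:) (intro continuous_intros)
  qed
  then show ?thesis
    unfolding split_beta
    by (rule continuous_on_compose2[OF assms]) (use contract_v_in_ball[of _ r] in auto)
qed

text \<open>The weight \<open>w\<close> is what makes the induction on the order of differentiability work: a derivative in
  the contracted direction produces a factor \<open>t\<close>.\<close>

lemma Ck_on_contraction_integral:
  fixes B :: "real^2 \<Rightarrow> real"
  assumes "Ck_on n (ball 0 r) B" "continuous_on {0..1} w"
  shows "Ck_on n (ball 0 r) (\<lambda>x. integral {0..1} (\<lambda>t. w t * B (contract_v t x)))"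
  using assms
proof (induction n arbitrary: B w)
  case 0
  have "continuous_on (ball 0 r \<times> {0..1}) (\<lambda>(x, t). w t * B (contract_v t x))"
    using continuous_on_mult[OF continuous_on_compose2[OF 0(2) continuous_on_snd[OF continuous_on_id]]
        continuous_on_contract_v[of r B]] 0 by (fastforce simp: split_beta)
  then have "continuous_on (ball 0 r) (\<lambda>x. integral (cbox 0 1) (\<lambda>t. w t * B (contract_v t x)))"
    by (intro integral_continuous_on_param) simp
  then show ?case by simp
next
  case (Suc n)
  let ?S = "ball (0 :: real^2) r"
  have B: "B differentiable (at y)" if "y \<in> ?S" for y
    using Suc.prems(1) that by simp
  have Bu: "Ck_on n ?S (D\<^sub>u B)" and Bv: "Ck_on n ?S (D\<^sub>v B)"
    using Suc.prems(1) by (simp_all add: partials_eq)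
  have cont: "continuous_on ?S g" if "Ck_on n ?S g" for g :: "real^2 \<Rightarrow> real"
    using that by (induction n arbitrary: g) (auto dest: Ck_on_SucD simp del: Ck_on.simps(2))
  have cont0: "continuous_on ?S B"
    using Suc.prems(1) Ck_on_SucD cont by blast
  have wt: "continuous_on {0..1} (\<lambda>t. w t * t)"
    by (intro continuous_on_mult Suc.prems(2) continuous_on_id)
  have slice: "continuous_on {0..1} (\<lambda>t. v t * g (contract_v t x))"
    if "continuous_on {0..1} v" "continuous_on ?S g" "x \<in> ?S" for v and g :: "real^2 \<Rightarrow> real" and x
  proof (rule continuous_on_mult[OF that(1)])
    have "continuous_on {0..1} (\<lambda>t. (\<lambda>(x, t). g (contract_v t x)) (x, t))"
      by (rule continuous_on_compose2[OF continuous_on_contract_v[OF that(2)]])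
         (use that(3) in \<open>auto intro!: continuous_intros\<close>)
    then show "continuous_on {0..1} (\<lambda>t. g (contract_v t x))" by simp
  qed
  let ?e1 = "Blinfun (\<lambda>h :: real^2. h $ 1)" and ?e2 = "Blinfun (\<lambda>h :: real^2. h $ 2)"
  have e: "blinfun_apply ?e1 h = h $ 1" "blinfun_apply ?e2 h = h $ 2" for h
    by (simp_all add: bounded_linear_Blinfun_apply bounded_linear_vec_nth)
  let ?fx = "\<lambda>x t. (w t * D\<^sub>u B (contract_v t x)) *\<^sub>R ?e1 + (w t * t * D\<^sub>v B (contract_v t x)) *\<^sub>R ?e2"
  have fx: "((\<lambda>x. w t * B (contract_v t x)) has_derivative blinfun_apply (?fx x t)) (at x within ?S)"
    if "x \<in> ?S" "t \<in> cbox 0 1" for x t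
  proof -
    have c: "contract_v t x \<in> ?S" using contract_v_in_ball[OF that(1)] that(2) by simp
    have "((\<lambda>x. B (contract_v t x)) has_derivative
        (\<lambda>h. \<D> B (contract_v t x) (contract_v t h))) (at x)"
      by (rule has_derivative_compose[OF bounded_linear_imp_has_derivative[OF bounded_linear_contract_v]
            B[OF c, unfolded frechet_derivative_works]])
    from has_derivative_mult_right[OF this, of "w t"] show ?thesis
      by (rule has_derivative_at_withinI[OF has_derivative_eq_rhs])
         (simp add: fun_eq_iff frechet_derivative_partials[OF B[OF c]] blinfun.add_left
           blinfun.scaleR_left e algebra_simps)
  qed
  have fxc: "continuous_on (?S \<times> cbox 0 1) (\<lambda>(x, t). ?fx x t)"
  proof -
    have 1: "continuous_on (?S \<times> cbox 0 1) (\<lambda>z. w (snd z))"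
      by (rule continuous_on_compose2[OF Suc.prems(2)]) (auto intro!: continuous_intros)
    have 2: "continuous_on (?S \<times> cbox 0 1) (\<lambda>z. D\<^sub>u B (contract_v (snd z) (fst z)))"
      "continuous_on (?S \<times> cbox 0 1) (\<lambda>z. D\<^sub>v B (contract_v (snd z) (fst z)))"
      using continuous_on_contract_v[OF cont[OF Bu]] continuous_on_contract_v[OF cont[OF Bv]]
      by (simp_all add: split_beta)
    show ?thesis unfolding split_beta
      by (intro continuous_on_add continuous_on_scaleR continuous_on_mult 1 2 continuous_on_const
          continuous_on_snd continuous_on_id)
  qed
  show ?case
  proof (rule Ck_on_SucI)
    fix x assume x: "x \<in> ?S"
    have i: "(\<lambda>t. w t * B (contract_v t y)) integrable_on cbox 0 1" if "y \<in> ?S" for y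
      using slice[OF Suc.prems(2) cont0 that] by (simp add: integrable_continuous_real)
    have d: "((\<lambda>x. integral (cbox 0 1) (\<lambda>t. w t * B (contract_v t x))) has_derivative
        blinfun_apply (integral (cbox 0 1) (?fx x))) (at x within ?S)"
      by (rule leibniz_rule[OF fx i fxc x]) simp_all
    have e': "blinfun_apply (integral (cbox 0 1) (?fx x)) h
        = h $ 1 * integral {0..1} (\<lambda>t. w t * D\<^sub>u B (contract_v t x))
          + h $ 2 * integral {0..1} (\<lambda>t. w t * t * D\<^sub>v B (contract_v t x))" for h
    proof -
      have I: "(\<lambda>t. w t * D\<^sub>u B (contract_v t x)) integrable_on {0..1}"
        "(\<lambda>t. w t * t * D\<^sub>v B (contract_v t x)) integrable_on {0..1}"
        using slice[OF Suc.prems(2) cont[OF Bu] x] slice[OF wt cont[OF Bv] x]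
        by (simp_all add: integrable_continuous_real)
      have "(\<lambda>t. (\<lambda>(x, t). ?fx x t) (x, t)) integrable_on cbox 0 1"
        by (rule integrable_continuous, rule continuous_on_compose2[OF fxc])
           (use x in \<open>auto intro!: continuous_intros\<close>)
      then have "?fx x integrable_on cbox 0 1" by simp
      from integral_linear[OF this blinfun.bounded_linear_left[of h]]
      have "blinfun_apply (integral (cbox 0 1) (?fx x)) h
          = integral {0..1} (\<lambda>t. h $ 1 * (w t * D\<^sub>u B (contract_v t x))
              + h $ 2 * (w t * t * D\<^sub>v B (contract_v t x)))"
        by (simp add: o_def blinfun.add_left blinfun.scaleR_left e mult.commute)
      also have "\<dots> = h $ 1 * integral {0..1} (\<lambda>t. w t * D\<^sub>u B (contract_v t x))
          + h $ 2 * integral {0..1} (\<lambda>t. w t * t * D\<^sub>v B (contract_v t x))"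
        using I by (simp add: integral_add integrable_on_mult_right)
      finally show ?thesis .
    qed
    show "((\<lambda>x. integral {0..1} (\<lambda>t. w t * B (contract_v t x))) has_derivative
        (\<lambda>h. h $ 1 * integral {0..1} (\<lambda>t. w t * D\<^sub>u B (contract_v t x))
          + h $ 2 * integral {0..1} (\<lambda>t. w t * t * D\<^sub>v B (contract_v t x)))) (at x)"
      using has_derivative_eq_rhs[OF d ext[OF e']] at_within_open[OF x open_ball] by simp
  next
    fix h :: "real^2"
    show "Ck_on n ?S (\<lambda>x. h $ 1 * integral {0..1} (\<lambda>t. w t * D\<^sub>u B (contract_v t x))
          + h $ 2 * integral {0..1} (\<lambda>t. w t * t * D\<^sub>v B (contract_v t x)))"
      by (rule Ck_on_add[OF open_ball Ck_on_bounded_linear[OF open_ball bounded_linear_mult_right Suc.IH[OF Bu Suc.prems(2)]]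
            Ck_on_bounded_linear[OF open_ball bounded_linear_mult_right Suc.IH[OF Bv wt]]])
  qed simp
qed

text \<open>Hadamard's lemma: \<open>q x\<close> is the mean of \<open>D\<^sub>v g\<close> over the segment from the axis to \<open>x\<close>.\<close>

lemma smooth_division_by_v:
  fixes g :: "real^2 \<Rightarrow> real"
  assumes g: "smooth_on (ball 0 r) g" and zero: "\<And>x. x \<in> ball 0 r \<Longrightarrow> x $ 2 = 0 \<Longrightarrow> g x = 0"
  shows "\<exists>q. smooth_on (ball 0 r) q \<and> (\<forall>x\<in>ball 0 r. g x = x $ 2 * q x)"
proof (intro exI conjI ballI)
  let ?q = "\<lambda>x. integral {0..1} (\<lambda>t. 1 * D\<^sub>v g (contract_v t x))"
  have gv: "smooth_on (ball 0 r) (D\<^sub>v g)" by (rule smooth_on_partials[OF open_ball g])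
  show "smooth_on (ball 0 r) ?q"
    by (rule smooth_on_openI[OF open_ball Ck_on_contraction_integral[OF smooth_on_openD[OF open_ball gv]
            continuous_on_const]])
  fix x :: "real^2" assume x: "x \<in> ball 0 r"
  have "((\<lambda>t. g (contract_v t x)) has_vector_derivative x $ 2 * D\<^sub>v g (contract_v t x)) (at t within {0..1})"
    if "t \<in> {0..1}" for t
  proof -
    have c: "contract_v t x \<in> ball 0 r" using contract_v_in_ball[OF x] that by simp
    have d: "g differentiable (at (contract_v t x))" by (rule smooth_on_differentiable[OF open_ball g c])
    have e: "contract_v s x = x $ 1 *\<^sub>R axis 1 1 + s *\<^sub>R x $ 2 *\<^sub>R axis 2 1" for s
      by (simp add: vec_eq_iff forall_2 axis_def)
    have "((\<lambda>s. contract_v s x) has_derivative (\<lambda>s. s *\<^sub>R x $ 2 *\<^sub>R axis 2 1)) (at t)"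
      unfolding e by (auto intro!: derivative_eq_intros)
    from has_derivative_compose[OF this d[unfolded frechet_derivative_works]]
    have "((\<lambda>s. g (contract_v s x)) has_derivative (\<lambda>s. s *\<^sub>R (x $ 2 * D\<^sub>v g (contract_v t x)))) (at t)"
      by (simp add: linear_scale[OF linear_frechet_derivative[OF d]] D\<^sub>v_def mult.assoc)
    then show ?thesis
      by (simp add: has_vector_derivative_def has_derivative_at_withinI)
  qed
  from fundamental_theorem_of_calculus[OF _ this]
  have "((\<lambda>t. x $ 2 * D\<^sub>v g (contract_v t x)) has_integral g (contract_v 1 x) - g (contract_v 0 x)) {0..1}"
    by simp
  moreover have "g (contract_v 0 x) = 0"
    using contract_v_in_ball[OF x, of 0] by (intro zero) simp_all
  moreover have "contract_v 1 x = x" by (simp add: vec_eq_iff forall_2)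
  ultimately have "((\<lambda>t. x $ 2 * D\<^sub>v g (contract_v t x)) has_integral g x) {0..1}" by simp
  from integral_unique[OF this] show "g x = x $ 2 * ?q x" by simp
qed

lemma D\<^sub>v_division_by_v:
  assumes "open S" "x \<in> S" "q differentiable (at x)" "\<And>y. y \<in> S \<Longrightarrow> g y = y $ 2 * q y"
  shows "D\<^sub>v g x = x $ 2 * D\<^sub>v q x + q x"
proof -
  have "D\<^sub>v g x = D\<^sub>v (\<lambda>y. y $ 2 * q y) x"
    using assms by (intro partials_cong) auto
  also have "\<dots> = x $ 2 * D\<^sub>v q x + D\<^sub>v (\<lambda>y. y $ 2) x * q x"
    by (rule partials_mult[OF _ assms(3)])
       (rule bounded_linear_imp_differentiable[OF bounded_linear_vec_nth])
  finally show ?thesis by (simp add: partials_coordinates)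
qed


section \<open>The inverse function theorem in the plane\<close>

definition jacobian_det :: "(real^2 \<Rightarrow> real^2) \<Rightarrow> real^2 \<Rightarrow> real" where
  "jacobian_det f x = D\<^sub>u f x $ 1 * D\<^sub>v f x $ 2 - D\<^sub>u f x $ 2 * D\<^sub>v f x $ 1"

lemma jacobian_det_eq: "jacobian_det f x = det (matrix (\<D> f x))"
  by (simp add: jacobian_det_def det_2 matrix_def D\<^sub>u_def D\<^sub>v_def)

text \<open>Cramer's rule, for the matrix with columns \<open>a\<close> and \<open>b\<close>.\<close>

definition cramer :: "real^2 \<Rightarrow> real^2 \<Rightarrow> real^2 \<Rightarrow> real^2" where
  "cramer a b h = vector [(h $ 1 * b $ 2 - h $ 2 * b $ 1) / (a $ 1 * b $ 2 - a $ 2 * b $ 1),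
    (a $ 1 * h $ 2 - a $ 2 * h $ 1) / (a $ 1 * b $ 2 - a $ 2 * b $ 1)]"

lemma cramer_solves:
  assumes "a $ 1 * b $ 2 - a $ 2 * b $ 1 \<noteq> 0"
  shows "cramer a b h $ 1 *\<^sub>R a + cramer a b h $ 2 *\<^sub>R b = h"
    "cramer a b (h $ 1 *\<^sub>R a + h $ 2 *\<^sub>R b) = h"
  using assms by (simp_all add: cramer_def vec_eq_iff forall_2 divide_simps) (simp_all add: algebra_simps)

lemma bounded_linear_cramer: "bounded_linear (cramer a b)"
  unfolding linear_conv_bounded_linear[symmetric]
  by (rule linearI) (simp_all add: cramer_def vec_eq_iff forall_2 diff_divide_distrib add_divide_distrib algebra_simps)

lemma smooth_on_jacobian_det:
  assumes "open S" "smooth_on S f"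
  shows "smooth_on S (jacobian_det f)"
proof -
  note s = smooth_on_nth[OF smooth_on_partials(1)[OF assms]]
    smooth_on_nth[OF smooth_on_partials(2)[OF assms]]
  have "jacobian_det f = (\<lambda>x. D\<^sub>u f x $ 1 * D\<^sub>v f x $ 2 - D\<^sub>u f x $ 2 * D\<^sub>v f x $ 1)"
    by (simp add: jacobian_det_def fun_eq_iff)
  then show ?thesis using smooth_on_diff[OF smooth_on_mult[OF s] smooth_on_mult[OF s]] by simp
qed

lemma open_nonzero:
  assumes "open S" "continuous_on S g"
  shows "open {x \<in> S. g x \<noteq> (0::real)}"
proof -
  have "open (S \<inter> g -` (- {0}))"
    by (rule continuous_open_preimage[OF assms(2,1)]) (simp add: open_Compl)
  moreover have "S \<inter> g -` (- {0}) = {x \<in> S. g x \<noteq> 0}" by auto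
  ultimately show ?thesis by simp
qed

text \<open>The continuously differentiable inverse comes from the inverse function theorem; by Cramer's rule
  its derivative is a smooth function composed with the inverse itself, so each order of
  differentiability of the inverse gives the next.\<close>

lemma smooth_inverse_function_theorem:
  fixes f :: "real^2 \<Rightarrow> real^2"
  assumes S: "open S" "x \<in> S" and f: "smooth_on S f" and J: "jacobian_det f x \<noteq> 0"
  obtains U V g where "open U" "x \<in> U" "U \<subseteq> S" "open V" "diffeomorphism U V f g"
    "\<And>y. y \<in> U \<Longrightarrow> jacobian_det f y \<noteq> 0"
proof -
  let ?S = "{y \<in> S. jacobian_det f y \<noteq> 0}"
  have oS: "open ?S"
    by (rule open_nonzero[OF S(1) smooth_on_continuous_on[OF smooth_on_jacobian_det[OF S(1) f]]])
  have xS: "x \<in> ?S" using S J by simp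
  have fS: "smooth_on ?S f" by (rule smooth_on_subset[OF f]) auto
  have df: "f differentiable (at y)" if "y \<in> ?S" for y
    by (rule smooth_on_differentiable[OF oS fS that])
  have bl: "bounded_linear (\<D> f y)" if "y \<in> ?S" for y
    using linear_frechet_derivative[OF df[OF that]] by (simp add: linear_conv_bounded_linear)
  let ?f' = "\<lambda>y. Blinfun (\<D> f y)"
  have f': "blinfun_apply (?f' y) h = h $ 1 *\<^sub>R D\<^sub>u f y + h $ 2 *\<^sub>R D\<^sub>v f y" if "y \<in> ?S" for y h
    by (simp add: bounded_linear_Blinfun_apply[OF bl[OF that]] frechet_derivative_partials[OF df[OF that]])
  have 1: "(f has_derivative blinfun_apply (?f' y)) (at y)" if "y \<in> ?S" for y
    using df[OF that] by (simp add: bounded_linear_Blinfun_apply[OF bl[OF that]] frechet_derivative_works)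
  have 2: "continuous_on ?S ?f'"
  proof (rule continuous_on_blinfun_componentwise)
    fix i :: "real^2"
    have "continuous_on ?S (\<lambda>y. \<D> f y i)"
      by (rule smooth_on_continuous_on[OF smooth_on_frechet_derivative[OF oS fS]])
    then show "continuous_on ?S (\<lambda>y. blinfun_apply (?f' y) i)"
      by (rule continuous_on_eq) (simp add: bounded_linear_Blinfun_apply[OF bl])
  qed
  have 3: "Blinfun (cramer (D\<^sub>u f x) (D\<^sub>v f x)) o\<^sub>L ?f' x = id_blinfun"
    using J by (intro blinfun_eqI)
      (simp add: f'[OF xS] bounded_linear_Blinfun_apply[OF bounded_linear_cramer] cramer_solves jacobian_det_def)
  obtain U V g g' where U: "open U" "U \<subseteq> ?S" "x \<in> U" "open V" "homeomorphism U V f g"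
    and g: "\<And>y. y \<in> V \<Longrightarrow> (g has_derivative (g' y)) (at y)"
    and g': "\<And>y. y \<in> V \<Longrightarrow> g' y = inv (blinfun_apply (?f'(g y)))"
    and bij: "\<And>y. y \<in> V \<Longrightarrow> bij (blinfun_apply (?f'(g y)))"
    by (rule inverse_function_theorem[OF oS _ 2 xS 3], erule 1, rule that)
  have gU: "g y \<in> U" if "y \<in> V" for y
    using homeomorphism_image2[OF U(5)] that by blast
  let ?c = "\<lambda>h z. cramer (D\<^sub>u f z) (D\<^sub>v f z) h"
  have g'c: "g' y h = ?c h (g y)" if "y \<in> V" for y h
  proof -
    have gS: "g y \<in> ?S" using gU[OF that] U(2) by blast
    have "blinfun_apply (?f' (g y)) (?c h (g y)) = h"
      using gS by (simp add: f'[OF gS] cramer_solves jacobian_det_def)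
    from inv_f_eq[OF bij_is_inj[OF bij[OF that]] this] show ?thesis using g'[OF that] by simp
  qed
  have c: "smooth_on U (?c h)" for h
  proof -
    have d: "smooth_on U (\<lambda>z. D\<^sub>u f z $ i)" "smooth_on U (\<lambda>z. D\<^sub>v f z $ i)" for i
      by (rule smooth_on_subset[OF smooth_on_nth[OF smooth_on_partials(1)[OF oS fS]] U(2)],
          rule smooth_on_subset[OF smooth_on_nth[OF smooth_on_partials(2)[OF oS fS]] U(2)])
    have "smooth_on U (\<lambda>z. (h $ 1 * D\<^sub>v f z $ 2 - h $ 2 * D\<^sub>v f z $ 1)
        / (D\<^sub>u f z $ 1 * D\<^sub>v f z $ 2 - D\<^sub>u f z $ 2 * D\<^sub>v f z $ 1))"
      by (rule smooth_on_divide[OF smooth_on_diff[OF smooth_on_mult[OF smooth_on_const d(2)]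
              smooth_on_mult[OF smooth_on_const d(2)]]
            smooth_on_diff[OF smooth_on_mult[OF d] smooth_on_mult[OF d]]])
         (use U(2) in \<open>auto simp: jacobian_det_def\<close>)
    moreover have "smooth_on U (\<lambda>z. (D\<^sub>u f z $ 1 * h $ 2 - D\<^sub>u f z $ 2 * h $ 1)
        / (D\<^sub>u f z $ 1 * D\<^sub>v f z $ 2 - D\<^sub>u f z $ 2 * D\<^sub>v f z $ 1))"
      by (rule smooth_on_divide[OF smooth_on_diff[OF smooth_on_mult[OF d(1) smooth_on_const]
              smooth_on_mult[OF d(1) smooth_on_const]]
            smooth_on_diff[OF smooth_on_mult[OF d] smooth_on_mult[OF d]]])
         (use U(2) in \<open>auto simp: jacobian_det_def\<close>)
    ultimately show ?thesis unfolding cramer_def by (rule smooth_on_vector_2)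
  qed
  have "Ck_on n V g" for n
  proof (induction n)
    case 0
    then show ?case using U(5) by (simp add: homeomorphism_def)
  next
    case (Suc n)
    show ?case
    proof (rule Ck_on_SucI[OF U(4) g])
      fix h
      have "Ck_on n V (\<lambda>y. ?c h (g y))"
        by (rule Ck_on_compose[OF U(4) U(1) Suc smooth_on_openD[OF U(1) c]]) (use gU in auto)
      then show "Ck_on n V (\<lambda>y. g' y h)"
        by (rule Ck_on_cong[OF U(4), rotated]) (simp add: g'c)
    qed
  qed
  then have "smooth_on V g" by (rule smooth_on_openI[OF U(4)])
  then have "diffeomorphism U V f g"
    using U(5) smooth_on_subset[OF fS U(2)] by (simp add: diffeomorphism_def)
  then show thesis using U by (intro that[of U V g]) auto
qed


section \<open>The fold criterion\<close>

lemma jacobian_det_chain: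
  assumes "g differentiable (at x)" "f differentiable (at (g x))"
  shows "jacobian_det (\<lambda>x. f (g x)) x = jacobian_det f (g x) * jacobian_det g x"
  by (simp add: jacobian_det_def partials_chain[OF assms] algebra_simps)

lemma partials_nth:
  fixes f :: "real^2 \<Rightarrow> real ^ 'n"
  assumes "f differentiable (at x)"
  shows "D\<^sub>u (\<lambda>x. f x $ i) x = D\<^sub>u f x $ i" "D\<^sub>v (\<lambda>x. f x $ i) x = D\<^sub>v f x $ i"
  using partials_linear[OF bounded_linear_vec_nth assms] by simp_all

lemma jacobian_det_nth:
  fixes f :: "real^2 \<Rightarrow> real^2"
  assumes "f differentiable (at x)"
  shows "jacobian_det f x = D\<^sub>u (\<lambda>x. f x $ 1) x * D\<^sub>v (\<lambda>x. f x $ 2) x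
    - D\<^sub>u (\<lambda>x. f x $ 2) x * D\<^sub>v (\<lambda>x. f x $ 1) x"
  by (simp add: jacobian_det_def partials_nth[OF assms])

lemma ball_in_open:
  assumes "open S" "(0 :: 'a::real_normed_vector) \<in> S"
  obtains r where "r > 0" "ball 0 r \<subseteq> S"
  using assms openE by blast

lemma ball_in_preimage:
  fixes f :: "'a::{real_normed_vector} \<Rightarrow> 'b::topological_space"
  assumes "r > 0" "continuous_on (ball 0 r) f" "open S" "f 0 \<in> S"
  obtains r' where "r' > 0" "r' \<le> r" "\<And>x. x \<in> ball 0 r' \<Longrightarrow> f x \<in> S"
proof -
  have "open (ball 0 r \<inter> f -` S)"
    by (rule continuous_open_preimage[OF assms(2) open_ball assms(3)])
  moreover have "0 \<in> ball 0 r \<inter> f -` S" using assms by simp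
  ultimately obtain d where "d > 0" "ball 0 d \<subseteq> ball 0 r \<inter> f -` S" by (rule openE)
  then show thesis using assms(1) by (intro that[of "min d r"]) auto
qed

text \<open>The image of the axis is straightened in the target by the inverse of \<open>\<Theta>\<close>. The second component
  \<open>b\<close> of the resulting map \<open>M\<close> vanishes on the axis together with its \<open>v\<close>-derivative, hence
  \<open>b = v\<^sup>2 q\<close>, and \<open>q\<close> is nonzero at the origin because the Jacobian vanishes there to first order
  only. The square root of \<open>\<bar>q\<bar>\<close> times \<open>v\<close> is the new coordinate in the source; a reflection \<open>L\<close> of the
  target removes the sign of \<open>q\<close>.\<close>

lemma fold_normal_form:
  fixes G :: "real^2 \<Rightarrow> real^2"
  assumes r: "r > 0" and G: "smooth_on (ball 0 r) G"
    and J: "\<And>x. x \<in> ball 0 r \<Longrightarrow> x $ 2 = 0 \<Longrightarrow> jacobian_det G x = 0"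
    and Jv: "D\<^sub>v (jacobian_det G) 0 \<noteq> 0" and Gu: "D\<^sub>u G 0 $ 1 \<noteq> 0"
  shows "A_equivalent UNIV G 0 UNIV (\<lambda>x. vector [x$1, (x$2)^2] :: real^2) (0 :: real^2)"
proof -
  define \<Theta> where "\<Theta> = (\<lambda>x :: real^2. G (contract_v 0 x) + x $ 2 *\<^sub>R axis 2 1)"
  have cb: "contract_v 0 x \<in> ball 0 r" if "x \<in> ball 0 r" for x
    using contract_v_in_ball[OF that, of 0] by simp
  have smc: "smooth_on (ball 0 r) (\<lambda>x. G (contract_v 0 x))"
    by (rule smooth_on_compose[OF smooth_on_bounded_linear[OF bounded_linear_contract_v smooth_on_id] G])
       (use cb in auto)
  have smv: "smooth_on S (\<lambda>x :: real^2. x $ 2)" for S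
    by (rule smooth_on_nth[OF smooth_on_id])
  have sm2: "smooth_on S (\<lambda>x :: real^2. x $ 2 *\<^sub>R (axis 2 1 :: real^2))" for S
    by (rule smooth_on_scaleR[OF smv smooth_on_const])
  have sm\<Theta>: "smooth_on (ball 0 r) \<Theta>"
    unfolding \<Theta>_def by (rule smooth_on_add[OF smc sm2])
  have b0: "(0 :: real^2) \<in> ball 0 r" using r by simp
  have diff2: "(\<lambda>x :: real^2. x $ 2) differentiable (at x)" for x
    by (rule bounded_linear_imp_differentiable[OF bounded_linear_vec_nth])
  have j\<Theta>0: "jacobian_det \<Theta> 0 = D\<^sub>u G 0 $ 1"
  proof -
    have dG: "G differentiable (at 0)" by (rule smooth_on_differentiable[OF open_ball G b0])
    have c0: "contract_v 0 0 = 0" by (simp add: vec_eq_iff forall_2)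
    have dc: "contract_v 0 differentiable (at 0)"
      by (rule bounded_linear_imp_differentiable[OF bounded_linear_contract_v])
    have fc: "\<D> (contract_v 0) 0 h = contract_v 0 h" for h
      by (rule frechet_derivative_eq[OF bounded_linear_imp_has_derivative[OF bounded_linear_contract_v]])
    have e: "contract_v 0 (axis 1 1) = axis 1 1" "contract_v 0 (axis 2 1) = 0"
      by (simp_all add: vec_eq_iff forall_2 axis_def)
    have l: "linear (\<D> G 0)" by (rule linear_frechet_derivative[OF dG])
    have "D\<^sub>u (\<lambda>x. G (contract_v 0 x)) 0 = D\<^sub>u G 0" "D\<^sub>v (\<lambda>x. G (contract_v 0 x)) 0 = 0"
      using frechet_derivative_chain[OF dc, of G] dG
      by (simp_all add: D\<^sub>u_def D\<^sub>v_def c0 fc e linear_0[OF l])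
    moreover have "D\<^sub>u (\<lambda>x :: real^2. x $ 2 *\<^sub>R (axis 2 1 :: real^2)) 0 = 0"
      "D\<^sub>v (\<lambda>x :: real^2. x $ 2 *\<^sub>R (axis 2 1 :: real^2)) 0 = axis 2 1"
      using partials_linear[OF bounded_linear_scaleR_left[of "axis 2 1 :: real^2"] diff2]
      by (simp_all add: partials_coordinates)
    ultimately have "D\<^sub>u \<Theta> 0 = D\<^sub>u G 0" "D\<^sub>v \<Theta> 0 = axis 2 1"
      unfolding \<Theta>_def
      using partials_add[OF smooth_on_differentiable[OF open_ball smc b0]
          smooth_on_differentiable[OF open_ball sm2 b0]] by simp_all
    then show ?thesis by (simp add: jacobian_det_def axis_def)
  qed
  have j\<Theta>1: "jacobian_det \<Theta> 0 \<noteq> 0" using Gu j\<Theta>0 by simp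
  obtain T V \<Psi> where T: "open T" "0 \<in> T" "T \<subseteq> ball 0 r" "open V" "diffeomorphism T V \<Theta> \<Psi>"
    and j\<Theta>: "\<And>y. y \<in> T \<Longrightarrow> jacobian_det \<Theta> y \<noteq> 0"
    by (rule smooth_inverse_function_theorem[OF open_ball b0 sm\<Theta> j\<Theta>1]) (rule that)
  have \<Theta>_axis: "\<Theta> x = G x" if "x $ 2 = 0" for x
  proof -
    have "contract_v 0 x = x" using that by (simp add: vec_eq_iff forall_2)
    then show ?thesis using that by (simp add: \<Theta>_def)
  qed
  have V0: "G 0 \<in> V" using diffeomorphism_apply(1)[OF T(5,2)] \<Theta>_axis[of 0] by simp
  obtain r0 where r0: "r0 > 0" "ball 0 r0 \<subseteq> T" using ball_in_open[OF T(1,2)] .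
  have cG: "continuous_on (ball 0 r0) G"
    by (rule continuous_on_subset[OF smooth_on_continuous_on[OF G]]) (use r0(2) T(3) in auto)
  obtain r1 where r1: "r1 > 0" "r1 \<le> r0" "\<And>x. x \<in> ball 0 r1 \<Longrightarrow> G x \<in> V"
    by (rule ball_in_preimage[where f = G, OF r0(1) cG T(4) V0]) (rule that)
  let ?B = "ball (0 :: real^2) r1"
  have BT: "?B \<subseteq> T" using r1(2) r0(2) by auto
  have Br: "?B \<subseteq> ball 0 r" using BT T(3) by auto
  have z: "(0 :: real^2) \<in> ?B" using r1(1) by simp
  define M where "M = (\<lambda>x. \<Psi> (G x))"
  have M: "smooth_on ?B M"
    unfolding M_def
    by (rule smooth_on_compose[OF smooth_on_subset[OF G Br] diffeomorphism_smooth(2)[OF T(5)]])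
       (use r1(3) in auto)
  have MT: "M x \<in> T" and \<Theta>M: "\<Theta> (M x) = G x" if "x \<in> ?B" for x
    using diffeomorphism_apply(3,4)[OF T(5) r1(3)[OF that]] by (simp_all add: M_def)
  have M_axis: "M x = x" if "x \<in> ?B" "x $ 2 = 0" for x
  proof -
    have "x \<in> T" using BT that(1) by blast
    from diffeomorphism_apply(2)[OF T(5) this] show ?thesis by (simp add: M_def \<Theta>_axis[OF that(2)])
  qed
  have dM: "M differentiable (at x)" if "x \<in> ?B" for x
    by (rule smooth_on_differentiable[OF open_ball M that])
  define a b where "a = (\<lambda>x. M x $ 1)" and "b = (\<lambda>x. M x $ 2)"
  have a: "smooth_on ?B a" and b: "smooth_on ?B b"
    unfolding a_def b_def by (rule smooth_on_nth[OF M])+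
  note B = smooth_on_differentiable[OF open_ball _ z]
  have jM: "jacobian_det M x = D\<^sub>u a x * D\<^sub>v b x - D\<^sub>u b x * D\<^sub>v a x" if "x \<in> ?B" for x
    unfolding a_def b_def by (rule jacobian_det_nth[OF dM[OF that]])
  have ub: "D\<^sub>u b x = 0" if "x \<in> ?B" "x $ 2 = 0" for x
    by (rule D\<^sub>u_zero_on_axis[OF open_ball that smooth_on_differentiable[OF open_ball b that(1)]])
       (simp add: b_def M_axis)
  have ua: "D\<^sub>u a x = 1" if "x \<in> ?B" "x $ 2 = 0" for x
  proof -
    have d: "a differentiable (at x)" "(\<lambda>x. x $ 1) differentiable (at x)"
      by (rule smooth_on_differentiable[OF open_ball a that(1)],
          rule bounded_linear_imp_differentiable[OF bounded_linear_vec_nth])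
    have "D\<^sub>u (\<lambda>x. a x - x $ 1) x = 0"
      by (rule D\<^sub>u_zero_on_axis[OF open_ball that differentiable_diff[OF d]]) (simp add: a_def M_axis)
    then show ?thesis
      using partials_diff(1)[OF d] by (simp add: partials_coordinates)
  qed
  have JM: "jacobian_det G x = jacobian_det \<Theta> (M x) * jacobian_det M x" if "x \<in> ?B" for x
  proof -
    have "\<Theta> differentiable (at (M x))"
      using smooth_on_differentiable[OF open_ball sm\<Theta>] MT[OF that] T(3) by blast
    from jacobian_det_chain[OF dM[OF that] this]
    show ?thesis
      using partials_cong[OF open_ball that, of "\<lambda>x. \<Theta> (M x)" G] \<Theta>M
      by (simp add: jacobian_det_def)
  qed
  (* On the axis DM is triangular with first diagonal entry 1, so its determinant is the derivative of b. *)
  have vb: "D\<^sub>v b x = 0" if "x \<in> ?B" "x $ 2 = 0" for x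
  proof -
    have "jacobian_det M x = 0"
      using JM[OF that(1)] J[of x] j\<Theta>[OF MT[OF that(1)]] that Br by auto
    then show ?thesis using jM[OF that(1)] ua[OF that] ub[OF that] by simp
  qed
  obtain q1 where q1: "smooth_on ?B q1" "\<And>x. x \<in> ?B \<Longrightarrow> b x = x $ 2 * q1 x"
    using smooth_division_by_v[OF b] by (auto simp: b_def M_axis)
  have vb_q1: "D\<^sub>v b x = x $ 2 * D\<^sub>v q1 x + q1 x" if "x \<in> ?B" for x
    by (rule D\<^sub>v_division_by_v[OF open_ball that smooth_on_differentiable[OF open_ball q1(1) that] q1(2)])
  have "q1 x = 0" if "x \<in> ?B" "x $ 2 = 0" for x
    using vb_q1[OF that(1)] vb[OF that] that(2) by simp
  then obtain q where q: "smooth_on ?B q" "\<And>x. x \<in> ?B \<Longrightarrow> q1 x = x $ 2 * q x"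
    using smooth_division_by_v[OF q1(1)] by auto
  have q0: "q 0 \<noteq> 0"
  proof -
    note sv = smooth_on_partials(2)[OF open_ball]
    note su = smooth_on_partials(1)[OF open_ball]
    have q1v: "D\<^sub>v q1 0 = q 0"
      using D\<^sub>v_division_by_v[OF open_ball z B[OF q(1)] q(2)] by simp
    (* Both the second derivative of b and the derivative of the Jacobian of M equal 2 q at the origin. *)
    have "D\<^sub>v (D\<^sub>v b) 0 = D\<^sub>v (\<lambda>x. x $ 2 * D\<^sub>v q1 x + q1 x) 0"
      by (rule partials_cong(2)[OF open_ball z vb_q1])
    also have "\<dots> = D\<^sub>v (\<lambda>x. x $ 2 * D\<^sub>v q1 x) 0 + D\<^sub>v q1 0"
      by (rule partials_add[OF B[OF smooth_on_mult[OF smv sv[OF q1(1)]]] B[OF q1(1)]])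
    also have "D\<^sub>v (\<lambda>x. x $ 2 * D\<^sub>v q1 x) 0 = D\<^sub>v q1 0"
      by (simp add: partials_mult(2)[OF diff2 B[OF sv[OF q1(1)]]] partials_coordinates)
    finally have bvv: "D\<^sub>v (D\<^sub>v b) 0 = 2 * q 0" by (simp add: q1v)
    have buv: "D\<^sub>v (D\<^sub>u b) 0 = 0"
      unfolding partials_commute[OF open_ball b z]
      by (rule D\<^sub>u_zero_on_axis[OF open_ball z _ B[OF sv[OF b]]]) (simp_all add: vb)
    note d = B[OF su[OF a]] B[OF sv[OF a]] B[OF su[OF b]] B[OF sv[OF b]]
    have z2: "(0 :: real^2) $ 2 = 0" by simp
    have "D\<^sub>v (jacobian_det M) 0 = D\<^sub>v (\<lambda>x. D\<^sub>u a x * D\<^sub>v b x - D\<^sub>u b x * D\<^sub>v a x) 0"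
      by (rule partials_cong(2)[OF open_ball z jM])
    also have "\<dots> = 2 * q 0"
      using ua[OF z z2] ub[OF z z2] vb[OF z z2] bvv buv d
      by (simp add: partials_diff(2)[OF differentiable_mult[OF d(1,4)] differentiable_mult[OF d(3,2)]]
          partials_mult(2)[OF d(1,4)] partials_mult(2)[OF d(3,2)])
    finally have jMv: "D\<^sub>v (jacobian_det M) 0 = 2 * q 0" .
    have jM0: "jacobian_det M 0 = 0" using jM[OF z] ub[OF z z2] vb[OF z z2] by simp
    have s\<Theta>M: "smooth_on ?B (\<lambda>x. jacobian_det \<Theta> (M x))"
      by (rule smooth_on_compose[OF M smooth_on_jacobian_det[OF open_ball sm\<Theta>]])
         (use MT T(3) in blast)
    have "D\<^sub>v (jacobian_det G) 0 = D\<^sub>v (\<lambda>x. jacobian_det \<Theta> (M x) * jacobian_det M x) 0"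
      by (rule partials_cong(2)[OF open_ball z JM])
    also have "\<dots> = jacobian_det \<Theta> (M 0) * (2 * q 0)"
      by (simp add: partials_mult(2)[OF B[OF s\<Theta>M] B[OF smooth_on_jacobian_det[OF open_ball M]]]
          jM0 jMv)
    finally show ?thesis using Jv by auto
  qed
  define s where "s = sgn (q 0)"
  have s: "s * q 0 > 0" "s * s = 1"
    using q0 by (auto simp: s_def sgn_if)
  have sq: "smooth_on ?B (\<lambda>x. s * q x)"
    by (rule smooth_on_mult[OF smooth_on_const q(1)])
  have s0: "s * q 0 \<in> {0<..}" using s by simp
  obtain r2 where r2: "r2 > 0" "r2 \<le> r1" "\<And>x. x \<in> ball 0 r2 \<Longrightarrow> s * q x \<in> {0<..}"
    by (rule ball_in_preimage[where f = "\<lambda>x. s * q x", OF r1(1) smooth_on_continuous_on[OF sq]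
          open_greaterThan s0]) (rule that)
  let ?C = "ball (0 :: real^2) r2"
  have CB: "?C \<subseteq> ?B" using r2(2) by auto
  have zC: "0 \<in> ?C" using r2(1) by simp
  have c: "smooth_on ?C (\<lambda>x. x $ 2 * sqrt (s * q x))"
    by (rule smooth_on_mult[OF smv smooth_on_sqrt[OF smooth_on_subset[OF sq CB]]]) (use r2(3) in auto)
  have rt: "smooth_on ?C (\<lambda>x. sqrt (s * q x))"
    by (rule smooth_on_sqrt[OF smooth_on_subset[OF sq CB]]) (use r2(3) in auto)
  define \<psi> where "\<psi> = (\<lambda>x. vector [a x, x $ 2 * sqrt (s * q x)] :: real^2)"
  have \<psi>: "smooth_on ?C \<psi>"
    unfolding \<psi>_def by (rule smooth_on_vector_2[OF smooth_on_subset[OF a CB] c])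
  have "jacobian_det \<psi> 0 = D\<^sub>u a 0 * D\<^sub>v (\<lambda>x. x $ 2 * sqrt (s * q x)) 0
      - D\<^sub>u (\<lambda>x. x $ 2 * sqrt (s * q x)) 0 * D\<^sub>v a 0"
    using jacobian_det_nth[OF smooth_on_differentiable[OF open_ball \<psi> zC]] by (simp add: \<psi>_def)
  moreover have "D\<^sub>u (\<lambda>x. x $ 2 * sqrt (s * q x)) 0 = 0" "D\<^sub>v (\<lambda>x. x $ 2 * sqrt (s * q x)) 0 = sqrt (s * q 0)"
    by (simp_all add: partials_mult[OF diff2 smooth_on_differentiable[OF open_ball rt zC]]
        partials_coordinates)
  ultimately have j\<psi>: "jacobian_det \<psi> 0 \<noteq> 0" using ua[OF z] s(1) by fastforce
  obtain U U' \<psi>' where U: "open U" "0 \<in> U" "U \<subseteq> ?C" "open U'" "diffeomorphism U U' \<psi> \<psi>'"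
    by (rule smooth_inverse_function_theorem[OF open_ball zC \<psi> j\<psi>]) (rule that)
  define L where "L = (\<lambda>y :: real^2. vector [y $ 1, s * y $ 2] :: real^2)"
  have L: "smooth_on S L" for S
    unfolding L_def
    by (rule smooth_on_vector_2[OF smooth_on_nth[OF smooth_on_id]
          smooth_on_mult[OF smooth_on_const smooth_on_nth[OF smooth_on_id]]])
  have LL: "L (L y) = y" for y
    using s(2) by (simp add: L_def vec_eq_iff forall_2 mult.assoc[symmetric])
  have dL: "diffeomorphism T (L ` T) L L"
    using smooth_on_continuous_on[OF L] L LL
    by (auto simp: diffeomorphism_def homeomorphism_def image_image)
  have oL: "open (L ` T)"
  proof -
    have "L ` T = L -` T" using LL by (auto simp: image_iff) (metis LL)
    then show ?thesis using open_vimage[OF T(1) smooth_on_continuous_on[OF L]] by simp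
  qed
  have \<psi>0: "\<psi> 0 = 0" using M_axis[OF z] by (simp add: \<psi>_def a_def vec_eq_iff forall_2)
  show ?thesis
    unfolding A_equivalent_def
  proof (intro exI conjI ballI)
    show "open U" "0 \<in> U" "open U'" "diffeomorphism U U' \<psi> \<psi>'" "\<psi> 0 = 0" by fact+
    show "0 \<in> U'" using diffeomorphism_apply(1)[OF U(5,2)] \<psi>0 by simp
    show "openin (top_of_set UNIV) V" "openin (top_of_set UNIV) (L ` T)" using T(4) oL by simp_all
    show "G 0 \<in> V" by fact
    show "(vector [(0::real^2)$1, ((0::real^2)$2)^2] :: real^2) \<in> L ` T"
      by (rule image_eqI[OF _ T(2)]) (simp add: L_def)
    show "diffeomorphism V (L ` T) (L \<circ> \<Psi>) (\<Theta> \<circ> L)"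
      by (rule diffeomorphism_compose[OF diffeomorphism_sym[OF T(5)] dL])
    show "G ` U \<subseteq> V" using U(3) CB r1(3) by blast
    fix x assume "x \<in> U"
    then have x: "x \<in> ?C" "x \<in> ?B" using U(3) CB by auto
    have "(x $ 2 * sqrt (s * q x))\<^sup>2 = s * b x"
      using r2(3)[OF x(1)] q1(2)[OF x(2)] q(2)[OF x(2)]
      by (simp add: power_mult_distrib power2_eq_square)
    then show "vector [\<psi> x $ 1, (\<psi> x $ 2)^2] = (L \<circ> \<Psi>) (G x)"
      by (simp add: \<psi>_def L_def a_def b_def M_def)
  qed
qed

text \<open>Equivalence of germs may be tested in a chart \<open>\<phi>\<close> of the source and a chart \<open>\<pi>\<close> of the target; the
  given diffeomorphisms are composed with the charts after shrinking all domains.\<close>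

lemma A_equivalent_in_charts:
  assumes e: "A_equivalent UNIV (\<lambda>x. \<pi> (f (\<phi> x))) x0 N g q"
    and S: "open S" "x0 \<in> S" "open S'" "diffeomorphism S S' \<phi> \<phi>'"
    and W: "openin (top_of_set M) W0" "open D" "diffeomorphism W0 D \<pi> \<sigma>"
    and f: "\<And>x. x \<in> S \<Longrightarrow> f (\<phi> x) \<in> W0"
  shows "A_equivalent M f (\<phi> x0) N g q"
proof -
  obtain U U' \<theta> \<theta>' W W' \<Phi> \<Phi>' where
    U: "open U" "x0 \<in> U" "open U'" "q \<in> U'" "diffeomorphism U U' \<theta> \<theta>'" "\<theta> x0 = q"
    and V: "openin (top_of_set UNIV) W" "\<pi> (f (\<phi> x0)) \<in> W" "openin (top_of_set N) W'" "g q \<in> W'"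
      "diffeomorphism W W' \<Phi> \<Phi>'" "(\<lambda>x. \<pi> (f (\<phi> x))) ` U \<subseteq> W"
      "\<forall>x\<in>U. g (\<theta> x) = \<Phi> (\<pi> (f (\<phi> x)))"
    using e unfolding A_equivalent_def by (elim exE conjE) (rule that)
  let ?U = "S \<inter> U"
  have oU: "open ?U" using S U by blast
  have d1: "diffeomorphism (\<phi> ` ?U) (\<theta> ` ?U) (\<theta> \<circ> \<phi>') (\<phi> \<circ> \<theta>')"
    by (rule diffeomorphism_compose[OF diffeomorphism_sym[OF diffeomorphism_restrict[OF S(4) _ refl]]
          diffeomorphism_restrict[OF U(5) _ refl]]) auto
  have o1: "open (\<phi> ` ?U)" "open (\<theta> ` ?U)"
    by (rule diffeomorphism_open_image[OF S(4) S(3) oU]; simp)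
       (rule diffeomorphism_open_image[OF U(5) U(3) oU]; simp)
  let ?W = "{y \<in> W0. \<pi> y \<in> W}"
  have W': "\<pi> ` ?W = D \<inter> W"
    using diffeomorphism_apply[OF W(3)] by force
  have d2: "diffeomorphism ?W (\<Phi> ` (D \<inter> W)) (\<Phi> \<circ> \<pi>) (\<sigma> \<circ> \<Phi>')"
    by (rule diffeomorphism_compose[OF diffeomorphism_restrict[OF W(3) _ W'[symmetric]]
          diffeomorphism_restrict[OF V(5) _ refl]]) auto
  have o2: "openin (top_of_set M) ?W"
  proof -
    have "openin (top_of_set W0) (W0 \<inter> \<pi> -` W)"
      using V(1) by (intro continuous_openin_preimage_gen[OF smooth_on_continuous_on[OF diffeomorphism_smooth(1)[OF W(3)]]]) simp
    moreover have "W0 \<inter> \<pi> -` W = ?W" by auto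
    ultimately show ?thesis using openin_trans W(1) by metis
  qed
  have o3: "openin (top_of_set N) (\<Phi> ` (D \<inter> W))"
  proof -
    have "openin (top_of_set W') (W' \<inter> \<Phi>' -` D)"
      by (rule continuous_openin_preimage_gen[OF smooth_on_continuous_on[OF diffeomorphism_smooth(2)[OF V(5)]] W(2)])
    moreover have "\<Phi> ` (D \<inter> W) = W' \<inter> \<Phi>' -` D"
      using diffeomorphism_image_eq[OF V(5), of "D \<inter> W"] diffeomorphism_apply[OF V(5)] by auto
    ultimately show ?thesis using openin_trans V(3) by metis
  qed
  have x0: "x0 \<in> ?U" using S U by simp
  have D: "\<pi> (f (\<phi> x)) \<in> D \<inter> W" if "x \<in> ?U" for x
    using that f diffeomorphism_apply(1)[OF W(3)] V(6) by auto
  have inv_\<phi>: "\<phi>' (\<phi> x) = x" if "x \<in> ?U" for x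
    using that diffeomorphism_apply(2)[OF S(4)] by simp
  show ?thesis
    unfolding A_equivalent_def
  proof (intro exI conjI ballI)
    show "open (\<phi> ` ?U)" "open (\<theta> ` ?U)" by fact+
    show "\<phi> x0 \<in> \<phi> ` ?U" using x0 by blast
    show "q \<in> \<theta> ` ?U" using imageI[OF x0, of \<theta>] by (simp only: U(6))
    show "diffeomorphism (\<phi> ` ?U) (\<theta> ` ?U) (\<theta> \<circ> \<phi>') (\<phi> \<circ> \<theta>')" by fact
    show "(\<theta> \<circ> \<phi>') (\<phi> x0) = q" using inv_\<phi>[OF x0] U(6) by simp
    show "openin (top_of_set M) ?W" "openin (top_of_set N) (\<Phi> ` (D \<inter> W))" by fact+
    show "f (\<phi> x0) \<in> ?W" using f[OF S(2)] V(2) by simp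
    have "g q = \<Phi> (\<pi> (f (\<phi> x0)))" using V(7) U(2,6) by auto
    then show "g q \<in> \<Phi> ` (D \<inter> W)" using D[OF x0] by blast
    show "diffeomorphism ?W (\<Phi> ` (D \<inter> W)) (\<Phi> \<circ> \<pi>) (\<sigma> \<circ> \<Phi>')" by fact
    show "f ` \<phi> ` ?U \<subseteq> ?W" using f D by auto
    fix y assume "y \<in> \<phi> ` ?U"
    then obtain x where x: "x \<in> ?U" "y = \<phi> x" by blast
    show "g ((\<theta> \<circ> \<phi>') y) = (\<Phi> \<circ> \<pi>) (f y)"
      using x inv_\<phi>[OF x(1)] V(7) by simp
  qed
qed


section \<open>Folds of maps into the sphere\<close>

lemma det3_eq_dot_cross: "det3 a b c = a \<bullet> cross3 b c"
  by (simp add: det3_def dot_cross_det)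

text \<open>This turns products of determinants with last entry \<open>n\<close> into inner products of cross products, to
  which the identity \<open>dot_cross\<close> applies.\<close>

lemma cross3_eq_det3_scale:
  assumes "a \<bullet> n = 0" "b \<bullet> n = 0" "n \<bullet> n = 1"
  shows "cross3 a b = det3 a b n *\<^sub>R n"
proof -
  have "cross3 n (cross3 a b) = 0"
    using assms by (simp add: Lagrange inner_commute)
  then have "(n \<bullet> cross3 a b) *\<^sub>R n - (n \<bullet> n) *\<^sub>R cross3 a b = 0"
    using Lagrange[of n n "cross3 a b"] by simp
  moreover have "n \<bullet> cross3 a b = det3 a b n"
    using cross_triple[of a b n] by (simp add: det3_eq_dot_cross inner_commute)
  ultimately show ?thesis using assms(3) by simp
qed

text \<open>The vectors \<open>e1\<close>, \<open>e2\<close>, \<open>n\<close> form an orthonormal basis, in which the open hemisphere around \<open>n\<close> is the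
  graph of a smooth function on the unit disk.\<close>

lemma hemisphere_chart:
  fixes n e1 e2 :: "real^3"
  assumes o: "n \<bullet> n = 1" "e1 \<bullet> e1 = 1" "e1 \<bullet> n = 0" and e2: "e2 = cross3 n e1"
  shows "diffeomorphism (sphere 0 1 \<inter> {y. y \<bullet> n > 0}) {p :: real^2. (p $ 1)\<^sup>2 + (p $ 2)\<^sup>2 < 1}
    (\<lambda>y. vector [y \<bullet> e1, y \<bullet> e2])
    (\<lambda>p. p $ 1 *\<^sub>R e1 + p $ 2 *\<^sub>R e2 + sqrt (1 - (p $ 1)\<^sup>2 - (p $ 2)\<^sup>2) *\<^sub>R n)"
    (is "diffeomorphism ?H ?D ?\<pi> ?\<sigma>")
proof -
  have o2: "e2 \<bullet> e2 = 1" "e2 \<bullet> n = 0" "e2 \<bullet> e1 = 0" "n \<bullet> e1 = 0" "n \<bullet> e2 = 0" "e1 \<bullet> e2 = 0"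
    using o by (simp_all add: e2 dot_cross dot_cross_self inner_commute)
  have expand: "y = (y \<bullet> e1) *\<^sub>R e1 + (y \<bullet> e2) *\<^sub>R e2 + (y \<bullet> n) *\<^sub>R n" for y
  proof -
    have c: "cross3 e1 e2 = n"
      using o by (simp add: e2 Lagrange)
    have "cross3 (cross3 e1 e2) y = (e1 \<bullet> y) *\<^sub>R e2 - (e2 \<bullet> y) *\<^sub>R e1"
      using cross_skew[of "cross3 e1 e2" y] by (simp add: Lagrange inner_commute)
    then have ny: "cross3 n y = (e1 \<bullet> y) *\<^sub>R e2 - (e2 \<bullet> y) *\<^sub>R e1" by (simp add: c)
    have ne2: "cross3 n e2 = - e1"
      using o by (simp add: e2 Lagrange inner_commute)
    have "cross3 n (cross3 n y) = (n \<bullet> y) *\<^sub>R n - y"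
      using o by (simp add: Lagrange)
    moreover have "cross3 n (cross3 n y) = - ((e1 \<bullet> y) *\<^sub>R e1) - (e2 \<bullet> y) *\<^sub>R e2"
      by (simp add: ny Cross3.right_diff_distrib cross_mult_right ne2 e2[symmetric])
    ultimately have "y = (e1 \<bullet> y) *\<^sub>R e1 + (e2 \<bullet> y) *\<^sub>R e2 + (n \<bullet> y) *\<^sub>R n"
      by (simp add: algebra_simps)
    then show ?thesis by (simp only: inner_commute)
  qed
  have pyth: "y \<bullet> y = (y \<bullet> e1)\<^sup>2 + (y \<bullet> e2)\<^sup>2 + (y \<bullet> n)\<^sup>2" for y
    by (subst expand[of y]) (simp add: inner_add_left inner_add_right o o2 power2_eq_square)
  have sphere: "y \<in> sphere 0 1 \<longleftrightarrow> y \<bullet> y = 1" for y :: "real^3"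
    by (simp add: norm_eq_1)
  have \<sigma>: "?\<sigma> p \<bullet> e1 = p $ 1" "?\<sigma> p \<bullet> e2 = p $ 2" "?\<sigma> p \<bullet> n = sqrt (1 - (p $ 1)\<^sup>2 - (p $ 2)\<^sup>2)" for p
    by (simp_all add: inner_add_left o o2)
  have sm\<pi>: "smooth_on ?H ?\<pi>"
    by (rule smooth_on_vector_2[OF smooth_on_inner[OF smooth_on_id smooth_on_const]
          smooth_on_inner[OF smooth_on_id smooth_on_const]])
  have n1: "smooth_on ?D (\<lambda>p. p $ 1)" and n2: "smooth_on ?D (\<lambda>p. p $ 2)"
    by (rule smooth_on_nth[OF smooth_on_id])+
  have sm\<sigma>: "smooth_on ?D ?\<sigma>"
    by (rule smooth_on_add[OF smooth_on_add[OF smooth_on_scaleR[OF n1 smooth_on_const]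
            smooth_on_scaleR[OF n2 smooth_on_const]] smooth_on_scaleR[OF smooth_on_sqrt[OF
            smooth_on_diff[OF smooth_on_diff[OF smooth_on_const smooth_on_power[OF n1]]
              smooth_on_power[OF n2]]] smooth_on_const]]) auto
  have \<sigma>H: "?\<sigma> p \<in> ?H" if "p \<in> ?D" for p
  proof -
    have "1 - (p $ 1)\<^sup>2 - (p $ 2)\<^sup>2 > 0" using that by simp
    then have "?\<sigma> p \<bullet> ?\<sigma> p = 1" "?\<sigma> p \<bullet> n > 0"
      unfolding pyth[of "?\<sigma> p"] \<sigma> by simp_all
    then show ?thesis unfolding Int_iff sphere by simp
  qed
  have \<pi>D: "?\<pi> y \<in> ?D" and \<sigma>\<pi>: "?\<sigma> (?\<pi> y) = y" if "y \<in> ?H" for y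
  proof -
    have y: "(y \<bullet> e1)\<^sup>2 + (y \<bullet> e2)\<^sup>2 + (y \<bullet> n)\<^sup>2 = 1" "y \<bullet> n > 0"
      using that pyth[of y] unfolding Int_iff sphere by simp_all
    have "(y \<bullet> e1)\<^sup>2 + (y \<bullet> e2)\<^sup>2 < 1" using y(1) zero_less_power[OF y(2), of 2] by linarith
    then show "?\<pi> y \<in> ?D" by simp
    have "sqrt (1 - (y \<bullet> e1)\<^sup>2 - (y \<bullet> e2)\<^sup>2) = y \<bullet> n"
      by (rule real_sqrt_unique) (use y in auto)
    then show "?\<sigma> (?\<pi> y) = y" using expand[of y] by simp
  qed
  have \<pi>\<sigma>: "?\<pi> (?\<sigma> p) = p" for p
    unfolding \<sigma> by (simp add: vec_eq_iff forall_2)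
  have "homeomorphism ?H ?D ?\<pi> ?\<sigma>"
    by (rule homeomorphismI[OF smooth_on_continuous_on[OF sm\<pi>] smooth_on_continuous_on[OF sm\<sigma>]])
       (use \<sigma>H \<pi>D \<sigma>\<pi> \<pi>\<sigma> in \<open>auto simp del: vector_2\<close>)
  then show ?thesis using sm\<pi> sm\<sigma> by (simp add: diffeomorphism_def)
qed

lemma partials_orthogonal_unit:
  fixes N :: "real^2 \<Rightarrow> real^3"
  assumes "open S" "x \<in> S" "N differentiable (at x)" "\<And>y. y \<in> S \<Longrightarrow> N y \<bullet> N y = 1"
  shows "D\<^sub>u N x \<bullet> N x = 0" "D\<^sub>v N x \<bullet> N x = 0"
proof -
  have "D\<^sub>u (\<lambda>y. N y \<bullet> N y) x = 0" "D\<^sub>v (\<lambda>y. N y \<bullet> N y) x = 0"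
    using partials_cong[OF assms(1,2,4)] by (simp_all add: partials_const)
  then show "D\<^sub>u N x \<bullet> N x = 0" "D\<^sub>v N x \<bullet> N x = 0"
    by (simp_all add: partials_inner[OF assms(3,3)] inner_commute)
qed

text \<open>The function \<open>\<Lambda>\<close> whose zeros are the singular points of the Gauss map.\<close>

definition gauss_density :: "(real^2 \<Rightarrow> real^3) \<Rightarrow> real^2 \<Rightarrow> real" where
  "gauss_density N x = det3 (D\<^sub>u N x) (D\<^sub>v N x) (N x)"

lemma smooth_on_cross3: "smooth_on S f \<Longrightarrow> smooth_on S g \<Longrightarrow> smooth_on S (\<lambda>x. cross3 (f x) (g x))"
  using smooth_on_bounded_bilinear[OF bilinear_cross[unfolded bilinear_conv_bounded_bilinear]] .

lemma smooth_on_det3: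
  assumes "smooth_on S f" "smooth_on S g" "smooth_on S h"
  shows "smooth_on S (\<lambda>x. det3 (f x) (g x) (h x))"
  unfolding det3_eq_dot_cross by (rule smooth_on_inner[OF assms(1) smooth_on_cross3[OF assms(2,3)]])

lemma smooth_on_gauss_density:
  assumes "open S" "smooth_on S N"
  shows "smooth_on S (gauss_density N)"
proof -
  have "gauss_density N = (\<lambda>x. det3 (D\<^sub>u N x) (D\<^sub>v N x) (N x))"
    by (simp add: gauss_density_def fun_eq_iff)
  then show ?thesis
    using smooth_on_det3[OF smooth_on_partials[OF assms] assms(2)] by simp
qed

text \<open>The kernel of \<open>dN\<close> at the origin is transversal to the axis because \<open>N\<^sub>u\<close> is nonzero. In the chart of
  the hemisphere around \<open>N 0\<close> whose first axis points along \<open>N\<^sub>u\<close>, the Jacobian is the Gauss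
  density times the factor \<open>N \<bullet> n\<close>, which equals 1 at the origin; so the normal form applies.\<close>

lemma fold_if_kernel_transversal:
  fixes N :: "real^2 \<Rightarrow> real^3"
  assumes r: "r > 0" and N: "smooth_on (ball 0 r) N" and unit: "\<And>x. x \<in> ball 0 r \<Longrightarrow> N x \<bullet> N x = 1"
    and \<Lambda>: "\<And>x. x \<in> ball 0 r \<Longrightarrow> x $ 2 = 0 \<Longrightarrow> gauss_density N x = 0"
    and \<Lambda>v: "D\<^sub>v (gauss_density N) 0 \<noteq> 0" and Nu: "D\<^sub>u N 0 \<noteq> 0"
    and S: "open S" "0 \<in> S" "open S'" "diffeomorphism S S' \<phi> \<phi>'" and N\<nu>: "N = (\<lambda>x. \<nu> (\<phi> x))"
  shows "gauss_map_fold \<nu> (\<phi> 0)"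
proof -
  have z: "(0 :: real^2) \<in> ball 0 r" using r by simp
  have dN: "N differentiable (at x)" if "x \<in> ball 0 r" for x
    by (rule smooth_on_differentiable[OF open_ball N that])
  define n e1 e2 where "n = N 0" and "e1 = D\<^sub>u N 0 /\<^sub>R norm (D\<^sub>u N 0)" and "e2 = cross3 n e1"
  have o: "n \<bullet> n = 1" "e1 \<bullet> e1 = 1" "e1 \<bullet> n = 0"
    using unit[OF z] Nu partials_orthogonal_unit(1)[OF open_ball z dN[OF z] unit]
    by (simp_all add: n_def e1_def power2_norm_eq_inner[symmetric] power2_eq_square)
  have c: "cross3 e1 e2 = n" using o by (simp add: e2_def Lagrange)
  define \<pi> where "\<pi> = (\<lambda>y :: real^3. vector [y \<bullet> e1, y \<bullet> e2] :: real^2)"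
  obtain \<sigma> where ch: "diffeomorphism (sphere 0 1 \<inter> {y. y \<bullet> n > 0}) {p. (p $ 1)\<^sup>2 + (p $ 2)\<^sup>2 < 1} \<pi> \<sigma>"
    using hemisphere_chart[OF o e2_def] by (auto simp: \<pi>_def)
  have l\<pi>: "bounded_linear \<pi>"
    unfolding linear_conv_bounded_linear[symmetric] \<pi>_def
    by (rule linearI) (simp_all add: vec_eq_iff forall_2 inner_add_left)
  have oH: "open {y. y \<bullet> n > 0}"
    by (intro open_Collect_less continuous_intros)
  have n0: "N 0 \<in> {y. y \<bullet> n > 0}" using o by (simp add: n_def)
  obtain r1 where r1: "r1 > 0" "r1 \<le> r" "\<And>x. x \<in> ball 0 r1 \<Longrightarrow> N x \<in> {y. y \<bullet> n > 0}"
    by (rule ball_in_preimage[where f = N, OF r smooth_on_continuous_on[OF N] oH n0]) (rule that)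
  obtain r2 where r2: "r2 > 0" "ball 0 r2 \<subseteq> S" using ball_in_open[OF S(1,2)] .
  define d where "d = min r1 r2"
  let ?B = "ball (0 :: real^2) d"
  have d: "d > 0" "?B \<subseteq> ball 0 r" "?B \<subseteq> ball 0 r1" "?B \<subseteq> S"
    using r1 r2 by (auto simp: d_def)
  have zB: "0 \<in> ?B" using d by simp
  define G where "G = (\<lambda>x. \<pi> (N x))"
  have G: "smooth_on ?B G"
    unfolding G_def by (rule smooth_on_bounded_linear[OF l\<pi> smooth_on_subset[OF N d(2)]])
  have DG: "D\<^sub>u G x = \<pi> (D\<^sub>u N x)" "D\<^sub>v G x = \<pi> (D\<^sub>v N x)" if "x \<in> ?B" for x
    unfolding G_def using partials_linear[OF l\<pi> dN] that d(2) by auto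
  have jG: "jacobian_det G x = gauss_density N x * (N x \<bullet> n)" if "x \<in> ?B" for x
  proof -
    have xr: "x \<in> ball 0 r" using that d(2) by blast
    have "jacobian_det G x = cross3 (D\<^sub>u N x) (D\<^sub>v N x) \<bullet> cross3 e1 e2"
      by (simp add: jacobian_det_def DG[OF that] \<pi>_def dot_cross)
    also have "cross3 (D\<^sub>u N x) (D\<^sub>v N x) = gauss_density N x *\<^sub>R N x"
      unfolding gauss_density_def
      by (rule cross3_eq_det3_scale[OF partials_orthogonal_unit[OF open_ball xr dN[OF xr] unit] unit[OF xr]])
    finally show ?thesis by (simp add: c)
  qed
  have "A_equivalent UNIV G 0 UNIV (\<lambda>x. vector [x$1, (x$2)^2] :: real^2) (0 :: real^2)"
  proof (rule fold_normal_form[OF d(1) G])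
    show "jacobian_det G x = 0" if "x \<in> ?B" "x $ 2 = 0" for x
      using jG[OF that(1)] \<Lambda>[OF _ that(2)] that d(2) by auto
    have "D\<^sub>v (jacobian_det G) 0 = D\<^sub>v (\<lambda>x. gauss_density N x * (N x \<bullet> n)) 0"
      by (rule partials_cong(2)[OF open_ball zB jG])
    also have "\<dots> = D\<^sub>v (gauss_density N) 0"
      using \<Lambda>[OF z] o(1)
      by (simp add: n_def partials_mult(2)[OF smooth_on_differentiable[OF open_ball smooth_on_gauss_density[OF open_ball N] z]
            smooth_on_differentiable[OF open_ball smooth_on_inner[OF N smooth_on_const] z]])
    finally show "D\<^sub>v (jacobian_det G) 0 \<noteq> 0" using \<Lambda>v by simp
    show "D\<^sub>u G 0 $ 1 \<noteq> 0"
      using Nu by (simp add: DG(1)[OF zB] \<pi>_def e1_def)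
  qed
  then have e: "A_equivalent UNIV (\<lambda>x. \<pi> (N x)) 0 UNIV (\<lambda>x. vector [x$1, (x$2)^2] :: real^2) (0 :: real^2)"
    by (simp only: G_def)
  have dB: "diffeomorphism ?B (\<phi> ` ?B) \<phi> \<phi>'"
    by (rule diffeomorphism_restrict[OF S(4) d(4) refl])
  have oB: "open (\<phi> ` ?B)"
    by (rule diffeomorphism_open_image[OF S(4,3) open_ball d(4)])
  have W: "openin (top_of_set (sphere 0 1)) (sphere 0 1 \<inter> {y. y \<bullet> n > 0})"
    using oH by (rule openin_open_Int)
  have D: "open {p :: real^2. (p $ 1)\<^sup>2 + (p $ 2)\<^sup>2 < 1}"
    by (intro open_Collect_less continuous_intros)
  have H: "\<nu> (\<phi> x) \<in> sphere 0 1 \<inter> {y. y \<bullet> n > 0}" if "x \<in> ?B" for x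
    using r1(3)[of x] unit[of x] d(2,3) that unfolding N\<nu> by (auto simp: norm_eq_1)
  show ?thesis
    unfolding gauss_map_fold_def
    by (rule A_equivalent_in_charts[OF e[unfolded N\<nu>] open_ball zB oB dB W D ch H])
qed


section \<open>A front in adapted coordinates\<close>

lemma partials_det3:
  assumes "f differentiable (at x)" "g differentiable (at x)" "h differentiable (at x)"
  shows "D\<^sub>u (\<lambda>x. det3 (f x) (g x) (h x)) x
      = det3 (D\<^sub>u f x) (g x) (h x) + det3 (f x) (D\<^sub>u g x) (h x) + det3 (f x) (g x) (D\<^sub>u h x)"
    "D\<^sub>v (\<lambda>x. det3 (f x) (g x) (h x)) x
      = det3 (D\<^sub>v f x) (g x) (h x) + det3 (f x) (D\<^sub>v g x) (h x) + det3 (f x) (g x) (D\<^sub>v h x)"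
proof -
  have bb: "bounded_bilinear cross3"
    using bilinear_cross by (simp add: bilinear_conv_bounded_bilinear)
  have d: "(\<lambda>x. cross3 (g x) (h x)) differentiable (at x)"
    using bounded_bilinear.FDERIV[OF bb assms(2,3)[unfolded frechet_derivative_works]]
    by (rule differentiableI)
  show "D\<^sub>u (\<lambda>x. det3 (f x) (g x) (h x)) x
      = det3 (D\<^sub>u f x) (g x) (h x) + det3 (f x) (D\<^sub>u g x) (h x) + det3 (f x) (g x) (D\<^sub>u h x)"
    "D\<^sub>v (\<lambda>x. det3 (f x) (g x) (h x)) x
      = det3 (D\<^sub>v f x) (g x) (h x) + det3 (f x) (D\<^sub>v g x) (h x) + det3 (f x) (g x) (D\<^sub>v h x)"
    unfolding det3_eq_dot_cross
    by (simp_all only: partials_inner[OF assms(1) d]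
        partials_bilinear[OF bb assms(2,3)] inner_add_right add_ac)
qed

lemma det3_add_scale:
  "det3 (a + k *\<^sub>R a') (b + k *\<^sub>R b') c
    = det3 a b c + k * (det3 a' b c + det3 a b' c) + k\<^sup>2 * det3 a' b' c"
  unfolding det3_eq_dot_cross
  by (simp add: cross_add_left cross_mult_left inner_add_left inner_add_right power2_eq_square algebra_simps)

lemma det3_zero [simp]: "det3 0 b c = 0" "det3 a 0 c = 0" "det3 a b 0 = 0"
  unfolding det3_eq_dot_cross by simp_all

text \<open>The complement of the axis is dense.\<close>

lemma zero_on_axis_if_zero_off_axis:
  fixes g :: "real^2 \<Rightarrow> real"
  assumes S: "open S" and g: "continuous_on S g" "\<And>y. y \<in> S \<Longrightarrow> y $ 2 \<noteq> 0 \<Longrightarrow> g y = 0" and x: "x \<in> S"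
  shows "g x = 0"
proof (rule ccontr)
  assume n: "g x \<noteq> 0"
  then have x2: "x $ 2 = 0" using g(2)[OF x] by blast
  have "open {y \<in> S. g y \<noteq> 0}" "x \<in> {y \<in> S. g y \<noteq> 0}"
    using open_nonzero[OF S g(1)] x n by simp_all
  then obtain e where e: "e > 0" "ball x e \<subseteq> {y \<in> S. g y \<noteq> 0}" by (rule openE)
  let ?y = "x + (e / 2) *\<^sub>R axis 2 1"
  have "?y \<in> ball x e" using e(1) by (simp add: dist_norm norm_axis_1)
  then have "?y \<in> S" "g ?y \<noteq> 0" using e(2) by auto
  moreover have "?y $ 2 \<noteq> 0" using x2 e(1) by (simp add: axis_def)
  ultimately show False using g(2) by blast
qed

text \<open>What the local analysis uses of a front near a cuspidal edge: the \<open>u\<close>-axis is singular with null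
  direction \<open>v\<close>, and by the last condition the signed area density vanishes on it to first order
  only (see \<open>area_density_derivative\<close>).\<close>

locale adapted_front =
  fixes r :: real and F N :: "real^2 \<Rightarrow> real^3"
  assumes r: "r > 0"
    and F: "smooth_on (ball 0 r) F" and N: "smooth_on (ball 0 r) N"
    and unit: "\<And>x. x \<in> ball 0 r \<Longrightarrow> N x \<bullet> N x = 1"
    and orth: "\<And>x. x \<in> ball 0 r \<Longrightarrow> D\<^sub>u F x \<bullet> N x = 0" "\<And>x. x \<in> ball 0 r \<Longrightarrow> D\<^sub>v F x \<bullet> N x = 0"
    and null: "\<And>x. x \<in> ball 0 r \<Longrightarrow> x $ 2 = 0 \<Longrightarrow> D\<^sub>v F x = 0"
    and Nv: "D\<^sub>v N 0 \<noteq> 0"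
    and nondegenerate: "det3 (D\<^sub>u F 0) (D\<^sub>v (D\<^sub>v F) 0) (N 0) \<noteq> 0"
begin

lemma origin: "0 \<in> ball (0 :: real^2) r" "(0 :: real^2) $ 2 = 0"
  using r by simp_all

lemmas diff = smooth_on_differentiable[OF open_ball]
lemmas diff0 = smooth_on_differentiable[OF open_ball _ origin(1)]
lemmas smooth_u = smooth_on_partials(1)[OF open_ball]
lemmas smooth_v = smooth_on_partials(2)[OF open_ball]

lemma smooth_area_density: "smooth_on (ball 0 r) (area_density F N)"
proof -
  have "area_density F N = (\<lambda>x. det3 (D\<^sub>u F x) (D\<^sub>v F x) (N x))"
    by (simp add: area_density_def fun_eq_iff)
  then show ?thesis using smooth_on_det3[OF smooth_u[OF F] smooth_v[OF F] N] by simp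
qed

lemma area_density_axis: "x \<in> ball 0 r \<Longrightarrow> x $ 2 = 0 \<Longrightarrow> area_density F N x = 0"
  by (simp add: area_density_def null)

lemma area_density_derivative: "D\<^sub>v (area_density F N) 0 = det3 (D\<^sub>u F 0) (D\<^sub>v (D\<^sub>v F) 0) (N 0)"
proof -
  have "area_density F N = (\<lambda>x. det3 (D\<^sub>u F x) (D\<^sub>v F x) (N x))"
    by (simp add: area_density_def fun_eq_iff)
  then show ?thesis
    by (simp add: partials_det3(2)[OF diff0[OF smooth_u[OF F]] diff0[OF smooth_v[OF F]] diff0[OF N]]
        null[OF origin])
qed

lemma Fu_nonzero: "D\<^sub>u F 0 \<noteq> 0"
  using nondegenerate by auto

text \<open>Differentiate \<open>F\<^sub>u \<bullet> N = 0\<close> in the direction \<open>v\<close>: the mixed derivative of \<open>F\<close> is the derivative of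
  \<open>F\<^sub>v\<close> along the axis, where \<open>F\<^sub>v\<close> vanishes. The next lemma differentiates the result once more,
  along the axis.\<close>

lemma Fu_dot_Nv:
  assumes x: "x \<in> ball 0 r" "x $ 2 = 0"
  shows "D\<^sub>u F x \<bullet> D\<^sub>v N x = 0"
proof -
  have "D\<^sub>v (D\<^sub>u F) x = 0"
    unfolding partials_commute[OF open_ball F x(1)]
    by (rule D\<^sub>u_zero_on_axis[OF open_ball x diff[OF smooth_v[OF F] x(1)] null])
  moreover have "D\<^sub>v (\<lambda>y. D\<^sub>u F y \<bullet> N y) x = 0"
    using partials_cong(2)[OF open_ball x(1) orth(1)] by (simp add: partials_const)
  ultimately show ?thesis
    by (simp add: partials_inner(2)[OF diff[OF smooth_u[OF F] x(1)] diff[OF N x(1)]])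
qed

lemma Fu_dot_Nuv: "D\<^sub>u F 0 \<bullet> D\<^sub>v (D\<^sub>u N) 0 = - (D\<^sub>u (D\<^sub>u F) 0 \<bullet> D\<^sub>v N 0)"
proof -
  have "D\<^sub>u (\<lambda>x. D\<^sub>u F x \<bullet> D\<^sub>v N x) 0 = 0"
    by (rule D\<^sub>u_zero_on_axis[OF open_ball origin diff0[OF smooth_on_inner[OF smooth_u[OF F] smooth_v[OF N]]]])
       (rule Fu_dot_Nv)
  then show ?thesis
    by (simp add: partials_inner(1)[OF diff0[OF smooth_u[OF F]] diff0[OF smooth_v[OF N]]]
        partials_commute[OF open_ball N origin(1)] eq_neg_iff_add_eq_0)
qed

lemma Fu_cross_Nv: "cross3 (D\<^sub>u F 0) (D\<^sub>v N 0) = det3 (D\<^sub>u F 0) (D\<^sub>v N 0) (N 0) *\<^sub>R N 0"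
  by (rule cross3_eq_det3_scale[OF orth(1)[OF origin(1)]
        partials_orthogonal_unit(2)[OF open_ball origin(1) diff0[OF N] unit] unit[OF origin(1)]])

lemma det3_Fu_Nv_nonzero: "det3 (D\<^sub>u F 0) (D\<^sub>v N 0) (N 0) \<noteq> 0"
  using Fu_cross_Nv Fu_dot_Nv[OF origin] norm_and_cross_eq_0[of "D\<^sub>u F 0" "D\<^sub>v N 0"] Fu_nonzero Nv
  by auto

text \<open>The key sign. Since \<open>N\<^sub>v\<close> spans the line orthogonal to \<open>F\<^sub>u\<close> and \<open>N\<close>, both factors are multiples of
  the inner product \<open>b\<close> of \<open>F\<^sub>u\<^sub>u\<close> and \<open>N\<^sub>v\<close>: with \<open>c = det(F\<^sub>u, N\<^sub>v, N)\<close>, the first one times \<open>c\<close>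
  is \<open>- \<bar>N\<^sub>v\<bar>\<^sup>2 b\<close> by \<open>Fu_dot_Nuv\<close>, the second one times \<open>c\<close> is \<open>\<bar>F\<^sub>u\<bar>\<^sup>2 b\<close>.\<close>

lemma gauss_density_derivative_sign:
  assumes Nu: "D\<^sub>u N 0 = 0" and nz: "D\<^sub>v (gauss_density N) 0 \<noteq> 0"
  shows "D\<^sub>v (gauss_density N) 0 * det3 (D\<^sub>u F 0) (D\<^sub>u (D\<^sub>u F) 0) (N 0) < 0"
proof -
  define a t c where "a = D\<^sub>u F 0" and "t = D\<^sub>v N 0" and "c = det3 a t (N 0)"
  define b where "b = D\<^sub>u (D\<^sub>u F) 0 \<bullet> t"
  have at: "a \<bullet> t = 0" using Fu_dot_Nv[OF origin] by (simp add: a_def t_def)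
  have c0: "c \<noteq> 0" using det3_Fu_Nv_nonzero by (simp add: a_def t_def c_def)
  have cr: "c *\<^sub>R N 0 = cross3 a t" using Fu_cross_Nv by (simp add: a_def t_def c_def)
  have g: "gauss_density N = (\<lambda>x. det3 (D\<^sub>u N x) (D\<^sub>v N x) (N x))"
    by (simp add: gauss_density_def fun_eq_iff)
  have "D\<^sub>v (gauss_density N) 0 = det3 (D\<^sub>v (D\<^sub>u N) 0) t (N 0)"
    unfolding g
    by (simp add: partials_det3(2)[OF diff0[OF smooth_u[OF N]] diff0[OF smooth_v[OF N]] diff0[OF N]]
        Nu t_def)
  then have "D\<^sub>v (gauss_density N) 0 = D\<^sub>v (D\<^sub>u N) 0 \<bullet> cross3 t (N 0)"
    by (simp only: det3_eq_dot_cross)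
  moreover have "c *\<^sub>R cross3 t (N 0) = (t \<bullet> t) *\<^sub>R a"
    using at by (simp add: cross_mult_right[symmetric] cr Lagrange inner_commute)
  ultimately have 1: "c * D\<^sub>v (gauss_density N) 0 = - ((t \<bullet> t) * b)"
    using Fu_dot_Nuv inner_scaleR_right[of "D\<^sub>v (D\<^sub>u N) 0" c "cross3 t (N 0)"]
    by (simp add: a_def b_def t_def inner_commute)
  have "c *\<^sub>R cross3 (N 0) a = (a \<bullet> a) *\<^sub>R t"
    using at cross_skew[of "cross3 a t" a] by (simp add: cross_mult_left[symmetric] cr Lagrange)
  moreover have "det3 a (D\<^sub>u (D\<^sub>u F) 0) (N 0) = D\<^sub>u (D\<^sub>u F) 0 \<bullet> cross3 (N 0) a"
    unfolding det3_eq_dot_cross using cross_triple[of "D\<^sub>u (D\<^sub>u F) 0" "N 0" a]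
    by (simp add: inner_commute)
  ultimately have 2: "c * det3 a (D\<^sub>u (D\<^sub>u F) 0) (N 0) = (a \<bullet> a) * b"
    using inner_scaleR_right[of "D\<^sub>u (D\<^sub>u F) 0" c "cross3 (N 0) a"] by (simp add: b_def)
  have b0: "b \<noteq> 0" using 1 c0 nz by auto
  have "c\<^sup>2 * (D\<^sub>v (gauss_density N) 0 * det3 a (D\<^sub>u (D\<^sub>u F) 0) (N 0)) = - ((t \<bullet> t) * (a \<bullet> a) * b\<^sup>2)"
  proof -
    have "c\<^sup>2 * (D\<^sub>v (gauss_density N) 0 * det3 a (D\<^sub>u (D\<^sub>u F) 0) (N 0))
        = (c * D\<^sub>v (gauss_density N) 0) * (c * det3 a (D\<^sub>u (D\<^sub>u F) 0) (N 0))"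
      by (simp add: power2_eq_square mult_ac)
    then show ?thesis unfolding 1 2 by (simp add: power2_eq_square)
  qed
  moreover have "(t \<bullet> t) * (a \<bullet> a) * b\<^sup>2 > 0"
    using b0 Nv Fu_nonzero by (simp add: a_def t_def)
  ultimately have "c\<^sup>2 * (D\<^sub>v (gauss_density N) 0 * det3 a (D\<^sub>u (D\<^sub>u F) 0) (N 0)) < 0" by linarith
  then show ?thesis unfolding a_def by (simp add: mult_less_0_iff not_less[symmetric] zero_less_mult_iff)
qed

text \<open>The hypothesis on \<open>k\<close> says that off the axis it is a root of the characteristic equation of
  \<open>dN + k dF\<close>, that is, a principal curvature. By continuity it is one on the axis too, where the
  equation reads \<open>k A = 0\<close> with \<open>A\<close> nonzero; so \<open>k\<close> vanishes on the axis, and the \<open>v\<close>-derivative of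
  the equation at the origin is \<open>\<Lambda>\<^sub>v + k\<^sub>v A = 0\<close>.\<close>

lemma principal_curvature_nondegenerate:
  assumes d: "0 < d" "d \<le> r" and k: "smooth_on (ball 0 d) k"
    and root: "\<And>x. x \<in> ball 0 d \<Longrightarrow> x $ 2 \<noteq> 0 \<Longrightarrow>
      det3 (D\<^sub>u N x + k x *\<^sub>R D\<^sub>u F x) (D\<^sub>v N x + k x *\<^sub>R D\<^sub>v F x) (N x) = 0"
    and \<Lambda>: "\<And>x. x \<in> ball 0 d \<Longrightarrow> x $ 2 = 0 \<Longrightarrow> gauss_density N x = 0"
    and nz: "D\<^sub>u k 0 \<noteq> 0 \<or> D\<^sub>v k 0 \<noteq> 0"
  shows "D\<^sub>v (gauss_density N) 0 \<noteq> 0"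
proof
  assume \<Lambda>v: "D\<^sub>v (gauss_density N) 0 = 0"
  let ?B = "ball (0 :: real^2) d"
  have sub: "?B \<subseteq> ball 0 r" using d by auto
  have z: "0 \<in> ?B" using d by simp
  define A where "A = (\<lambda>x. det3 (D\<^sub>u F x) (D\<^sub>v N x) (N x) + det3 (D\<^sub>u N x) (D\<^sub>v F x) (N x))"
  have A: "smooth_on ?B A"
    unfolding A_def
    by (rule smooth_on_subset[OF smooth_on_add[OF smooth_on_det3[OF smooth_u[OF F] smooth_v[OF N] N]
            smooth_on_det3[OF smooth_u[OF N] smooth_v[OF F] N]] sub])
  have G: "smooth_on ?B (gauss_density N)"
    by (rule smooth_on_subset[OF smooth_on_gauss_density[OF open_ball N] sub])
  have L: "smooth_on ?B (area_density F N)"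
    by (rule smooth_on_subset[OF smooth_area_density sub])
  define P where "P = (\<lambda>x. gauss_density N x + k x * A x + k x * (k x * area_density F N x))"
  have kL: "smooth_on ?B (\<lambda>x. k x * (k x * area_density F N x))"
    by (rule smooth_on_mult[OF k smooth_on_mult[OF k L]])
  have P: "smooth_on ?B P"
    unfolding P_def by (rule smooth_on_add[OF smooth_on_add[OF G smooth_on_mult[OF k A]] kL])
  have P0: "P x = 0" if "x \<in> ?B" for x
  proof (rule zero_on_axis_if_zero_off_axis[OF open_ball smooth_on_continuous_on[OF P] _ that])
    fix y assume y: "y \<in> ?B" "y $ 2 \<noteq> 0"
    have "P y = det3 (D\<^sub>u N y + k y *\<^sub>R D\<^sub>u F y) (D\<^sub>v N y + k y *\<^sub>R D\<^sub>v F y) (N y)"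
      unfolding det3_add_scale P_def A_def gauss_density_def area_density_def
      by (simp add: power2_eq_square mult_ac)
    then show "P y = 0" using root[OF y] by simp
  qed
  have A0: "A 0 \<noteq> 0" using det3_Fu_Nv_nonzero by (simp add: A_def null[OF origin])
  have "open {x \<in> ?B. A x \<noteq> 0}" by (rule open_nonzero[OF open_ball smooth_on_continuous_on[OF A]])
  moreover have "0 \<in> {x \<in> ?B. A x \<noteq> 0}" using A0 z by simp
  ultimately obtain e where e: "e > 0" "ball 0 e \<subseteq> {x \<in> ?B. A x \<noteq> 0}" by (rule ball_in_open)
  have k_axis: "k x = 0" if "x \<in> ball 0 e" "x $ 2 = 0" for x
  proof -
    have x: "x \<in> ?B" "A x \<noteq> 0" using that(1) e(2) by auto
    have "area_density F N x = 0" using area_density_axis sub x that(2) by blast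
    then have "k x * A x = 0" using P0[OF x(1)] \<Lambda>[OF x(1) that(2)] by (simp add: P_def)
    then show ?thesis using x(2) by simp
  qed
  have ze: "0 \<in> ball (0 :: real^2) e" using e by simp
  note D0 = smooth_on_differentiable[OF open_ball _ z]
  have ku: "D\<^sub>u k 0 = 0"
    by (rule D\<^sub>u_zero_on_axis[OF open_ball ze _ D0[OF k] k_axis]) simp_all
  have k0: "k 0 = 0" using k_axis[OF ze] by simp
  have "D\<^sub>v P 0 = 0"
    using partials_cong(2)[OF open_ball z P0] by (simp add: partials_const)
  moreover have "D\<^sub>v P 0 = D\<^sub>v k 0 * A 0"
    unfolding P_def
    by (simp add: partials_add(2)[OF D0[OF smooth_on_add[OF G smooth_on_mult[OF k A]]] D0[OF kL]]
        partials_add(2)[OF D0[OF G] D0[OF smooth_on_mult[OF k A]]]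
        partials_mult(2)[OF D0[OF k] D0[OF A]]
        partials_mult(2)[OF D0[OF k] D0[OF smooth_on_mult[OF k L]]] k0 \<Lambda>v)
  ultimately show False using A0 ku nz by simp
qed

text \<open>The inequality extends to the axis by continuity, and there its right-hand side is zero.\<close>

lemma gauss_density_axis_if_quotient_bounded:
  assumes d: "0 < d" "d \<le> r"
    and bd: "\<And>x. x \<in> ball 0 d \<Longrightarrow> x $ 2 \<noteq> 0 \<Longrightarrow> \<bar>gauss_density N x\<bar> \<le> C * \<bar>area_density F N x\<bar>"
    and x: "x \<in> ball 0 d" "x $ 2 = 0"
  shows "gauss_density N x = 0"
proof -
  have sub: "ball 0 d \<subseteq> ball (0 :: real^2) r" using d by auto
  let ?g = "\<lambda>x. max 0 (\<bar>gauss_density N x\<bar> - C * \<bar>area_density F N x\<bar>)"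
  have c: "continuous_on (ball 0 d) (gauss_density N)" "continuous_on (ball 0 d) (area_density F N)"
    by (rule continuous_on_subset[OF smooth_on_continuous_on[OF smooth_on_gauss_density[OF open_ball N]] sub],
        rule continuous_on_subset[OF smooth_on_continuous_on[OF smooth_area_density] sub])
  have "?g x = 0"
    by (rule zero_on_axis_if_zero_off_axis[OF open_ball _ _ x(1)])
       (use bd in \<open>auto intro!: continuous_intros c\<close>)
  moreover have "area_density F N x = 0" using area_density_axis sub x by blast
  ultimately show ?thesis by simp
qed

text \<open>Both densities are divisible by \<open>v\<close>, so their quotient extends continuously over the axis.\<close>

lemma density_quotient_extends:
  assumes d: "0 < d" "d \<le> r"
    and \<Lambda>: "\<And>x. x \<in> ball 0 d \<Longrightarrow> x $ 2 = 0 \<Longrightarrow> gauss_density N x = 0"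
    and nz: "D\<^sub>v (gauss_density N) 0 \<noteq> 0"
  obtains e \<kappa> where "0 < e" "e \<le> d" "continuous_on (ball 0 e) \<kappa>"
    "\<And>x. x \<in> ball 0 e \<Longrightarrow> x $ 2 \<noteq> 0 \<Longrightarrow> area_density F N x \<noteq> 0"
    "\<And>x. x \<in> ball 0 e \<Longrightarrow> x $ 2 \<noteq> 0 \<Longrightarrow> gauss_density N x / area_density F N x = \<kappa> x"
    "\<And>x. x \<in> ball 0 e \<Longrightarrow> sgn (\<kappa> x) = sgn (D\<^sub>v (gauss_density N) 0 * D\<^sub>v (area_density F N) 0)"
proof -
  let ?B = "ball (0 :: real^2) d"
  have sub: "?B \<subseteq> ball 0 r" using d by auto
  have z: "0 \<in> ?B" using d by simp
  have G: "smooth_on ?B (gauss_density N)"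
    by (rule smooth_on_subset[OF smooth_on_gauss_density[OF open_ball N] sub])
  have L: "smooth_on ?B (area_density F N)"
    by (rule smooth_on_subset[OF smooth_area_density sub])
  obtain m where m: "smooth_on ?B m" "\<And>x. x \<in> ?B \<Longrightarrow> gauss_density N x = x $ 2 * m x"
    using smooth_division_by_v[OF G \<Lambda>] by blast
  obtain l where l: "smooth_on ?B l" "\<And>x. x \<in> ?B \<Longrightarrow> area_density F N x = x $ 2 * l x"
    using smooth_division_by_v[OF L] area_density_axis sub by blast
  note D0 = smooth_on_differentiable[OF open_ball _ z]
  have m0: "D\<^sub>v (gauss_density N) 0 = m 0"
    using D\<^sub>v_division_by_v[OF open_ball z D0[OF m(1)] m(2)] by simp
  have l0: "D\<^sub>v (area_density F N) 0 = l 0"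
    using D\<^sub>v_division_by_v[OF open_ball z D0[OF l(1)] l(2)] by simp
  have l0': "l 0 \<noteq> 0" using nondegenerate area_density_derivative l0 by simp
  define s where "s = sgn (m 0 * l 0)"
  have s0: "s * (m 0 * l 0) \<in> {0<..}" using nz l0' m0 by (simp add: s_def sgn_mult_self_eq mult.commute[of "sgn _"] abs_sgn[symmetric])
  have sm: "smooth_on ?B (\<lambda>x. s * (m x * l x))"
    by (rule smooth_on_mult[OF smooth_on_const smooth_on_mult[OF m(1) l(1)]])
  obtain e where e: "e > 0" "e \<le> d" "\<And>x. x \<in> ball 0 e \<Longrightarrow> s * (m x * l x) \<in> {0<..}"
    by (rule ball_in_preimage[where f = "\<lambda>x. s * (m x * l x)", OF d(1) smooth_on_continuous_on[OF sm]
          open_greaterThan s0]) (rule that)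
  have eB: "ball 0 e \<subseteq> ?B" using e(2) by auto
  have nl: "l x \<noteq> 0" if "x \<in> ball 0 e" for x using e(3)[OF that] by auto
  have sg: "sgn (m x / l x) = s" if "x \<in> ball 0 e" for x
  proof -
    have p: "s * (m x * l x) > 0" using e(3)[OF that] by simp
    then have "s \<noteq> 0" by auto
    then have "s = 1 \<or> s = - 1" by (simp add: s_def sgn_if split: if_splits)
    then show ?thesis using p by (auto simp: sgn_if zero_less_mult_iff mult_less_0_iff divide_simps)
  qed
  show thesis
  proof (rule that[of e "\<lambda>x. m x / l x"])
    show "0 < e" "e \<le> d" by fact+
    show "continuous_on (ball 0 e) (\<lambda>x. m x / l x)"
      using continuous_on_subset[OF smooth_on_continuous_on[OF m(1)] eB]
        continuous_on_subset[OF smooth_on_continuous_on[OF l(1)] eB] nl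
      by (intro continuous_on_divide) auto
    show "area_density F N x \<noteq> 0" if "x \<in> ball 0 e" "x $ 2 \<noteq> 0" for x
      using l(2)[of x] nl[OF that(1)] that eB by auto
    show "gauss_density N x / area_density F N x = m x / l x" if "x \<in> ball 0 e" "x $ 2 \<noteq> 0" for x
      using l(2)[of x] m(2)[of x] that eB by auto
    show "sgn (m x / l x) = sgn (D\<^sub>v (gauss_density N) 0 * D\<^sub>v (area_density F N) 0)" if "x \<in> ball 0 e" for x
      using sg[OF that] by (simp add: s_def m0 l0)
  qed
qed

lemma area_density_nonzero_off_axis:
  obtains e where "0 < e" "e \<le> r" "\<And>x. x \<in> ball 0 e \<Longrightarrow> x $ 2 \<noteq> 0 \<Longrightarrow> area_density F N x \<noteq> 0"
proof -
  obtain l where l: "smooth_on (ball 0 r) l" "\<And>x. x \<in> ball 0 r \<Longrightarrow> area_density F N x = x $ 2 * l x"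
    using smooth_division_by_v[OF smooth_area_density] area_density_axis by blast
  have "l 0 \<noteq> 0"
    using D\<^sub>v_division_by_v[OF open_ball origin(1) diff0[OF l(1)] l(2)] nondegenerate area_density_derivative
    by simp
  then have "l 0 \<in> - {0}" by simp
  moreover have "open (- {0 :: real})" by (simp add: open_Compl)
  ultimately obtain e where "e > 0" "e \<le> r" "\<And>x. x \<in> ball 0 e \<Longrightarrow> l x \<in> - {0}"
    by - (rule ball_in_preimage[where f = l, OF r smooth_on_continuous_on[OF l(1)]], assumption, assumption, rule that)
  then show thesis using l(2) by (intro that[of e]) auto
qed

end


section \<open>Adapted coordinates at a cuspidal edge\<close>

definition cusp_map :: "real^2 \<Rightarrow> real^3" where
  "cusp_map y = vector [y $ 1, (y $ 2)^2, (y $ 2)^3]"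

lemma smooth_on_cusp_map: "smooth_on S cusp_map"
proof -
  have "smooth_on S (\<lambda>y :: real^2. vector [y $ 1, (y $ 2)^2, (y $ 2)^3] :: real^3)"
    by (rule smooth_on_vector_3[OF smooth_on_nth[OF smooth_on_id]
          smooth_on_power[OF smooth_on_nth[OF smooth_on_id]] smooth_on_power[OF smooth_on_nth[OF smooth_on_id]]])
  then show ?thesis by (simp add: cusp_map_def[abs_def])
qed

lemma cusp_map_differentiable: "cusp_map differentiable (at y)"
  by (rule smooth_on_differentiable[OF open_UNIV smooth_on_cusp_map UNIV_I])

lemma frechet_derivative_cusp_map:
  "\<D> cusp_map y h = vector [h $ 1, 2 * y $ 2 * h $ 2, 3 * (y $ 2)\<^sup>2 * h $ 2]"
proof -
  have nth: "\<D> cusp_map y h $ i = \<D> (\<lambda>y. cusp_map y $ i) y h" for i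
    using frechet_derivative_linear[OF bounded_linear_vec_nth cusp_map_differentiable] by simp
  have l: "((\<lambda>y :: real^2. y $ j) has_derivative (\<lambda>h. h $ j)) (at y)" for j
    by (rule bounded_linear_imp_has_derivative[OF bounded_linear_vec_nth])
  have "\<D> (\<lambda>y :: real^2. y $ 1) y h = h $ 1"
    by (rule frechet_derivative_eq[OF l])
  moreover have "\<D> (\<lambda>y :: real^2. (y $ 2)^2) y h = 2 * y $ 2 * h $ 2"
    using frechet_derivative_eq[OF has_derivative_power[OF l, of 2 2]] by simp
  moreover have "\<D> (\<lambda>y :: real^2. (y $ 2)^3) y h = 3 * (y $ 2)\<^sup>2 * h $ 2"
    using frechet_derivative_eq[OF has_derivative_power[OF l, of 2 3]] by simp
  ultimately show ?thesis
    unfolding vec_eq_iff forall_3 nth by (simp add: cusp_map_def)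
qed

lemma singular_set_iff:
  fixes f :: "real^2 \<Rightarrow> real^3"
  assumes "q \<in> \<Sigma>" "f differentiable (at q)"
  shows "q \<in> singular_set \<Sigma> f \<longleftrightarrow> (\<exists>h. h \<noteq> 0 \<and> \<D> f q h = 0)"
proof -
  have l: "linear (\<D> f q)" by (rule linear_frechet_derivative[OF assms(2)])
  have m: "(*v) (matrix (\<D> f q)) = \<D> f q"
  proof -
    have "((*s) :: real \<Rightarrow> real^2 \<Rightarrow> real^2) = (*\<^sub>R)" "((*s) :: real \<Rightarrow> real^3 \<Rightarrow> real^3) = (*\<^sub>R)"
      by (intro ext; simp add: scalar_mult_eq_scaleR)+
    then show ?thesis using matrix_works[of "\<D> f q"] l by (intro ext) simp
  qed
  let ?A = "matrix (\<D> f q)"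
  have "rank ?A \<le> CARD(2)"
    using rank_bound[of ?A] by simp
  then have "rank ?A < 2 \<longleftrightarrow> rank ?A \<noteq> CARD(2)" by auto
  also have "\<dots> \<longleftrightarrow> \<not> inj (\<D> f q)"
    unfolding full_rank_injective m ..
  also have "\<dots> \<longleftrightarrow> (\<exists>h. h \<noteq> 0 \<and> \<D> f q h = 0)"
    using linear_injective_0[OF l] by auto
  finally show ?thesis using assms(1) by (simp add: singular_set_def)
qed

text \<open>At a point where the first derivative of \<open>g\<close> vanishes, the second derivative transforms under \<open>\<Phi>\<close>
  like a tangent vector.\<close>

lemma second_derivative_compose:
  fixes g :: "real^2 \<Rightarrow> 'b::euclidean_space" and \<Phi> :: "'b \<Rightarrow> 'c::euclidean_space"
  assumes S: "open S" "x \<in> S" and T: "open T" "g ` S \<subseteq> T"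
    and g: "smooth_on S g" and \<Phi>: "smooth_on T \<Phi>" and null: "D\<^sub>v g x = 0"
  shows "D\<^sub>v (D\<^sub>v (\<lambda>y. \<Phi> (g y))) x = \<D> \<Phi> (g x) (D\<^sub>v (D\<^sub>v g) x)"
proof -
  have d\<Phi>: "\<Phi> differentiable (at (g y))" if "y \<in> S" for y
    using smooth_on_differentiable[OF T(1) \<Phi>] T(2) that by blast
  note expand = linear_eq_sum_Basis[OF linear_frechet_derivative[OF d\<Phi>]]
  let ?t = "\<lambda>i y. (D\<^sub>v g y \<bullet> i) *\<^sub>R \<D> \<Phi> (g y) i"
  have first: "D\<^sub>v (\<lambda>y. \<Phi> (g y)) y = (\<Sum>i\<in>Basis. ?t i y)" if "y \<in> S" for y
    unfolding expand[OF that, symmetric] unfolding D\<^sub>v_def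
    by (rule frechet_derivative_chain[OF smooth_on_differentiable[OF S(1) g that] d\<Phi>[OF that]])
  have gv: "smooth_on S (D\<^sub>v g)" by (rule smooth_on_partials(2)[OF S(1) g])
  have si: "smooth_on S (\<lambda>y. D\<^sub>v g y \<bullet> i)" for i by (rule smooth_on_inner[OF gv smooth_on_const])
  have s\<Phi>: "smooth_on S (\<lambda>y. \<D> \<Phi> (g y) i)" for i
    by (rule smooth_on_compose[OF g smooth_on_frechet_derivative[OF T(1) \<Phi>] T(2)])
  note d = smooth_on_differentiable[OF S(1) _ S(2)]
  have t: "(?t i has_derivative \<D> (?t i) x) (at x)" for i
    using d[OF smooth_on_scaleR[OF si s\<Phi>]] by (simp add: frechet_derivative_works)
  have tv: "\<D> (?t i) x (axis 2 1)
      = (D\<^sub>v (D\<^sub>v g) x \<bullet> i) *\<^sub>R \<D> \<Phi> (g x) i" for i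
  proof -
    have "\<D> (?t i) x (axis 2 1)
        = D\<^sub>v (\<lambda>y. D\<^sub>v g y \<bullet> i) x *\<^sub>R \<D> \<Phi> (g x) i"
      using frechet_derivative_bilinear[OF bounded_bilinear_scaleR d[OF si] d[OF s\<Phi>]]
      by (simp add: null D\<^sub>v_def[of "\<lambda>y. D\<^sub>v g y \<bullet> i"])
    also have "D\<^sub>v (\<lambda>y. D\<^sub>v g y \<bullet> i) x = D\<^sub>v (D\<^sub>v g) x \<bullet> i"
      by (rule partials_linear(2)[OF bounded_linear_inner_left d[OF gv]])
    finally show ?thesis .
  qed
  have "D\<^sub>v (D\<^sub>v (\<lambda>y. \<Phi> (g y))) x = D\<^sub>v (\<lambda>y. \<Sum>i\<in>Basis. ?t i y) x"
    by (rule partials_cong(2)[OF S first])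
  also have "\<dots> = (\<Sum>i\<in>Basis. \<D> (?t i) x (axis 2 1))"
    unfolding D\<^sub>v_def[of "\<lambda>y. \<Sum>i\<in>Basis. ?t i y"] by (rule frechet_derivative_eq[OF has_derivative_sum[OF t]])
  also have "\<dots> = \<D> \<Phi> (g x) (D\<^sub>v (D\<^sub>v g) x)"
    unfolding tv expand[OF S(2), symmetric] ..
  finally show ?thesis .
qed

lemma diffeomorphism_derivative_inj:
  assumes "diffeomorphism S T f g" "open S" "open T" "x \<in> S" "\<D> f x h = 0"
  shows "h = 0"
proof -
  have "g differentiable (at (f x))"
    by (rule smooth_on_differentiable[OF assms(3) diffeomorphism_smooth(2)[OF assms(1)]
          diffeomorphism_apply(1)[OF assms(1,4)]])
  then have "linear (\<D> g (f x))" by (rule linear_frechet_derivative)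
  then show ?thesis
    using diffeomorphism_derivative[OF assms(1-4), of h] assms(5) by (simp add: linear_0)
qed

lemma diffeomorphism_jacobian_det_nonzero:
  fixes f :: "real^2 \<Rightarrow> real^2"
  assumes "diffeomorphism S T f g" "open S" "open T" "x \<in> S"
  shows "jacobian_det f x \<noteq> 0"
proof
  assume j: "jacobian_det f x = 0"
  have df: "f differentiable (at x)"
    by (rule smooth_on_differentiable[OF assms(2) diffeomorphism_smooth(1)[OF assms(1)] assms(4)])
  let ?a = "D\<^sub>u f x" and ?b = "D\<^sub>v f x"
  have inj: "h = 0" if "h $ 1 *\<^sub>R ?a + h $ 2 *\<^sub>R ?b = 0" for h :: "real^2"
    using diffeomorphism_derivative_inj[OF assms(1-4), of h] that
    by (simp only: frechet_derivative_partials[OF df])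
  have j': "?a $ 1 * ?b $ 2 = ?a $ 2 * ?b $ 1" using j by (simp add: jacobian_det_def)
  have "vector [?b $ 1, - ?a $ 1] = (0 :: real^2)"
    by (rule inj) (simp add: vec_eq_iff forall_2 j' mult.commute)
  moreover have "vector [?b $ 2, - ?a $ 2] = (0 :: real^2)"
    by (rule inj) (simp add: vec_eq_iff forall_2 j' mult.commute)
  ultimately have a0: "?a = 0" by (simp add: vec_eq_iff forall_2)
  have "axis 1 1 = (0 :: real^2)" by (rule inj) (simp add: a0 axis_def)
  then show False by (simp add: axis_eq_0_iff)
qed

text \<open>The witnesses of the equivalence between the germ of \<open>f\<close> at \<open>p\<close> and the standard cuspidal edge.\<close>

locale cuspidal_edge_data =
  fixes \<Sigma> :: "(real^2) set" and f :: "real^2 \<Rightarrow> real^3" and p :: "real^2"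
    and U U' \<theta> \<theta>' W W' \<Phi> \<Phi>'
  assumes \<Sigma>: "open \<Sigma>" "p \<in> \<Sigma>" and f: "smooth_on \<Sigma> f"
    and U: "open U" "p \<in> U" "open U'" "diffeomorphism U U' \<theta> \<theta>'" "\<theta> p = 0"
    and W: "open W" "open W'" "diffeomorphism W W' \<Phi> \<Phi>'"
    and fW: "\<And>x. x \<in> U \<Longrightarrow> f x \<in> W" and f\<Phi>: "\<And>x. x \<in> U \<Longrightarrow> \<Phi> (f x) = cusp_map (\<theta> x)"
begin

lemma U'0: "0 \<in> U'" "\<theta>' 0 = p"
  using diffeomorphism_apply[OF U(4)] U(2,5) by metis+

text \<open>The derivative of \<open>\<Phi>\<close> is injective, so this formula reduces questions about the kernel of the
  derivative of \<open>f \<circ> g\<close> to the explicit derivative of \<open>cusp_map\<close>. It is used for the identity and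
  for charts \<open>g\<close>.\<close>

lemma composite_derivative:
  fixes g :: "real^2 \<Rightarrow> real^2"
  assumes S: "open S" "x \<in> S" and g: "smooth_on S g" "\<And>y. y \<in> S \<Longrightarrow> g y \<in> U \<inter> \<Sigma>"
  shows "\<D> \<Phi> (f (g x)) (\<D> (\<lambda>y. f (g y)) x h)
    = \<D> cusp_map (\<theta> (g x)) (\<D> (\<lambda>y. \<theta> (g y)) x h)"
proof -
  have gx: "g x \<in> U" "g x \<in> \<Sigma>" using g(2)[OF S(2)] by auto
  have df: "(\<lambda>y. f (g y)) differentiable (at x)"
    by (rule smooth_on_differentiable[OF S(1) smooth_on_compose[OF g(1) f] S(2)]) (use g(2) in auto)
  have d\<theta>: "(\<lambda>y. \<theta> (g y)) differentiable (at x)"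
    by (rule smooth_on_differentiable[OF S(1) smooth_on_compose[OF g(1) diffeomorphism_smooth(1)[OF U(4)]] S(2)])
       (use g(2) in auto)
  have d\<Phi>: "\<Phi> differentiable (at (f (g x)))"
    by (rule smooth_on_differentiable[OF W(1) diffeomorphism_smooth(1)[OF W(3)] fW[OF gx(1)]])
  have "\<D> (\<lambda>y. \<Phi> (f (g y))) x = \<D> (\<lambda>y. cusp_map (\<theta> (g y))) x"
    by (rule frechet_derivative_cong_on_open[OF S f\<Phi>]) (use g(2) in auto)
  then show ?thesis
    using frechet_derivative_chain[OF df d\<Phi>] frechet_derivative_chain[OF d\<theta> cusp_map_differentiable]
    by simp
qed

lemma target_derivative_inj:
  assumes "x \<in> U" "\<D> \<Phi> (f x) h = 0"
  shows "h = 0"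
  by (rule diffeomorphism_derivative_inj[OF W(3,1,2) fW[OF assms(1)] assms(2)])

lemma linear_target_derivative: "x \<in> U \<Longrightarrow> linear (\<D> \<Phi> (f x))"
  by (rule linear_frechet_derivative[OF
        smooth_on_differentiable[OF W(1) diffeomorphism_smooth(1)[OF W(3)] fW]])

text \<open>The derivative of \<open>cusp_map\<close> has a kernel exactly on the axis, where it is spanned by the second
  unit vector.\<close>

lemma singular_iff:
  assumes x: "x \<in> U" "x \<in> \<Sigma>"
  shows "x \<in> singular_set \<Sigma> f \<longleftrightarrow> \<theta> x $ 2 = 0"
proof -
  have o: "open (U \<inter> \<Sigma>)" using U \<Sigma> by blast
  have e: "\<D> \<Phi> (f x) (\<D> f x h)
    = \<D> cusp_map (\<theta> x) (\<D> \<theta> x h)" for h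
    using composite_derivative[OF o _ smooth_on_id, of x h] x by simp
  have s: "x \<in> singular_set \<Sigma> f \<longleftrightarrow> (\<exists>h. h \<noteq> 0 \<and> \<D> f x h = 0)"
    by (rule singular_set_iff[OF x(2) smooth_on_differentiable[OF \<Sigma>(1) f x(2)]])
  show ?thesis
  proof
    assume "x \<in> singular_set \<Sigma> f"
    then obtain h where h: "h \<noteq> 0" "\<D> f x h = 0" using s by blast
    have "\<D> \<theta> x h \<noteq> 0"
      using diffeomorphism_derivative_inj[OF U(4,1,3) x(1)] h(1) by blast
    moreover have "\<D> cusp_map (\<theta> x) (\<D> \<theta> x h) = 0"
      using e[of h] h(2) linear_0[OF linear_target_derivative[OF x(1)]] by simp
    ultimately show "\<theta> x $ 2 = 0"
      by (auto simp: frechet_derivative_cusp_map vec_eq_iff forall_2 forall_3)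
  next
    assume z: "\<theta> x $ 2 = 0"
    define h where "h = \<D> \<theta>' (\<theta> x) (axis 2 1)"
    have \<theta>x: "\<theta> x \<in> U'" "\<theta>' (\<theta> x) = x" using diffeomorphism_apply[OF U(4)] x(1) by blast+
    have h: "\<D> \<theta> x h = axis 2 1"
      using diffeomorphism_derivative[OF diffeomorphism_sym[OF U(4)] U(3,1) \<theta>x(1)] by (simp add: h_def \<theta>x(2))
    have "\<D> \<Phi> (f x) (\<D> f x h) = 0"
      unfolding e h by (simp add: frechet_derivative_cusp_map z axis_def vec_eq_iff forall_3)
    then have "\<D> f x h = 0" by (rule target_derivative_inj[OF x(1)])
    moreover have "h \<noteq> 0"
    proof
      assume "h = 0"
      moreover have "linear (\<D> \<theta> x)"
        by (rule linear_frechet_derivative[OF smooth_on_differentiable[OF U(1) diffeomorphism_smooth(1)[OF U(4)] x(1)]])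
      ultimately show False using h by (simp add: linear_0 axis_eq_0_iff)
    qed
    ultimately show "x \<in> singular_set \<Sigma> f" using s by blast
  qed
qed

text \<open>The inverse of the source chart \<open>\<theta>\<close> parametrizes a neighbourhood of \<open>p\<close> by adapted coordinates up
  to orientation.\<close>

lemma adapted_coordinates_exist: "\<exists>\<phi> S. adapted_coordinates \<Sigma> f p S \<phi>"
proof -
  define s where "s = sgn (jacobian_det \<theta>' 0)"
  have dsym: "diffeomorphism U' U \<theta>' \<theta>" by (rule diffeomorphism_sym[OF U(4)])
  have j0: "jacobian_det \<theta>' 0 \<noteq> 0"
    by (rule diffeomorphism_jacobian_det_nonzero[OF dsym U(3,1) U'0(1)])
  have s: "s * s = 1" "s * jacobian_det \<theta>' 0 \<in> {0<..}"
    using j0 by (auto simp: s_def sgn_if)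
  obtain r0 where r0: "r0 > 0" "ball 0 r0 \<subseteq> U'" using ball_in_open[OF U(3) U'0(1)] .
  have c: "continuous_on (ball 0 r0) \<theta>'" "continuous_on (ball 0 r0) (\<lambda>x. s * jacobian_det \<theta>' x)"
    by (rule continuous_on_subset[OF smooth_on_continuous_on[OF diffeomorphism_smooth(1)[OF dsym]] r0(2)],
        rule continuous_on_subset[OF smooth_on_continuous_on[OF smooth_on_mult[OF smooth_on_const
              smooth_on_jacobian_det[OF U(3) diffeomorphism_smooth(1)[OF dsym]]]] r0(2)])
  have p\<Sigma>: "\<theta>' 0 \<in> \<Sigma>" using \<Sigma>(2) U'0(2) by simp
  obtain r1 where r1: "r1 > 0" "r1 \<le> r0" "\<And>x. x \<in> ball 0 r1 \<Longrightarrow> \<theta>' x \<in> \<Sigma>"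
    by (rule ball_in_preimage[where f = \<theta>', OF r0(1) c(1) \<Sigma>(1) p\<Sigma>]) (rule that)
  obtain r2 where r2: "r2 > 0" "r2 \<le> r0" "\<And>x. x \<in> ball 0 r2 \<Longrightarrow> s * jacobian_det \<theta>' x \<in> {0<..}"
    by (rule ball_in_preimage[where f = "\<lambda>x. s * jacobian_det \<theta>' x", OF r0(1) c(2) open_greaterThan s(2)]) (rule that)
  define r where "r = min r1 r2"
  let ?B = "ball (0 :: real^2) r"
  have r: "r > 0" "?B \<subseteq> U'" using r0 r1 r2 by (auto simp: r_def)
  (* If the inverse chart reverses the orientation, it is preceded by the reflection of the first
     coordinate, which keeps the axis and the null direction. *)
  define \<rho> where "\<rho> = (\<lambda>y :: real^2. vector [s * y $ 1, y $ 2] :: real^2)"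
  have \<rho>: "smooth_on T \<rho>" for T
    unfolding \<rho>_def
    by (rule smooth_on_vector_2[OF smooth_on_mult[OF smooth_on_const smooth_on_nth[OF smooth_on_id]]
          smooth_on_nth[OF smooth_on_id]])
  have \<rho>\<rho>: "\<rho> (\<rho> y) = y" for y
    using s(1) by (simp add: \<rho>_def vec_eq_iff forall_2 mult.assoc[symmetric])
  have "norm (\<rho> y) = norm y" for y
  proof -
    have "(s * y $ 1)\<^sup>2 = (y $ 1)\<^sup>2" using s(1) by (simp add: power_mult_distrib power2_eq_square)
    then show ?thesis by (simp add: norm_vec_def L2_set_def sum_2 \<rho>_def)
  qed
  then have \<rho>B: "\<rho> y \<in> ?B" if "y \<in> ?B" for y using that by simp
  have d\<rho>: "diffeomorphism ?B ?B \<rho> \<rho>"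
    using \<rho>B \<rho>\<rho> smooth_on_continuous_on[OF \<rho>] \<rho>
    unfolding diffeomorphism_def by (intro conjI homeomorphismI) auto
  have im\<rho>: "\<rho> ` ?B = ?B" by (rule diffeomorphism_image[OF d\<rho>])
  define \<phi> where "\<phi> = \<theta>' \<circ> \<rho>"
  have im: "\<phi> ` ?B = \<theta>' ` ?B" unfolding \<phi>_def image_comp[symmetric] im\<rho> ..
  have d\<phi>: "diffeomorphism ?B (\<phi> ` ?B) \<phi> (\<rho> \<circ> \<theta>)"
    unfolding im unfolding \<phi>_def
    by (rule diffeomorphism_compose[OF d\<rho> diffeomorphism_restrict[OF dsym r(2) refl]])
  have o: "open (\<phi> ` ?B)"
    unfolding im by (rule diffeomorphism_open_image[OF dsym U(1) open_ball r(2)])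
  have \<phi>U: "\<phi> x \<in> U" "\<phi> x \<in> \<Sigma>" "\<theta> (\<phi> x) = \<rho> x" if "x \<in> ?B" for x
    using \<rho>B[OF that] r(2) diffeomorphism_apply[OF dsym, of "\<rho> x"] r1(3)[of "\<rho> x"]
    by (auto simp: \<phi>_def r_def)
  have sing: "\<phi> x \<in> singular_set \<Sigma> f \<longleftrightarrow> x $ 2 = 0" if "x \<in> ?B" for x
    using singular_iff[OF \<phi>U(1,2)[OF that]] \<phi>U(3)[OF that] by (simp add: \<rho>_def)
  have D\<rho>: "\<D> \<rho> x h = \<rho> h" for x h
  proof -
    have "linear \<rho>" by (rule linearI) (simp_all add: \<rho>_def vec_eq_iff forall_2 algebra_simps)
    then show ?thesis
      by (intro frechet_derivative_eq bounded_linear_imp_has_derivative) (simp add: linear_conv_bounded_linear)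
  qed
  have d\<rho>': "\<rho> differentiable (at x)" for x
    by (rule smooth_on_differentiable[OF open_UNIV \<rho> UNIV_I])
  have det: "det (matrix (\<D> \<phi> x)) > 0" if "x \<in> ?B" for x
  proof -
    have \<rho>x: "\<rho> x \<in> ?B" "\<rho> x \<in> U'" using \<rho>B[OF that] r(2) by auto
    have "jacobian_det \<phi> x = jacobian_det \<theta>' (\<rho> x) * jacobian_det \<rho> x"
      unfolding \<phi>_def o_def
      by (rule jacobian_det_chain[OF d\<rho>' smooth_on_differentiable[OF U(3) diffeomorphism_smooth(1)[OF dsym] \<rho>x(2)]])
    also have "jacobian_det \<rho> x = s"
      by (simp add: jacobian_det_def D\<^sub>u_def D\<^sub>v_def D\<rho>) (simp add: \<rho>_def axis_def)
    finally show ?thesis using r2(3)[of "\<rho> x"] \<rho>x(1) by (simp add: jacobian_det_eq r_def mult.commute)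
  qed
  have null: "D\<^sub>v (f \<circ> \<phi>) x = 0" if x: "x \<in> ?B" "x $ 2 = 0" for x
  proof (rule target_derivative_inj[OF \<phi>U(1)[OF x(1)]])
    have "\<D> (\<lambda>y. \<theta> (\<phi> y)) x = \<D> \<rho> x"
      by (rule frechet_derivative_cong_on_open[OF open_ball x(1) \<phi>U(3)])
    then have "\<D> \<Phi> (f (\<phi> x)) (\<D> (\<lambda>y. f (\<phi> y)) x h)
        = \<D> cusp_map (\<theta> (\<phi> x)) (\<rho> h)" for h
      using composite_derivative[OF open_ball x(1) diffeomorphism_smooth(1)[OF d\<phi>], of h] \<phi>U D\<rho> by simp
    then show "\<D> \<Phi> (f (\<phi> x)) (D\<^sub>v (f \<circ> \<phi>) x) = 0"
      by (simp add: D\<^sub>v_def o_def \<phi>U(3)[OF x(1)] frechet_derivative_cusp_map)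
         (simp add: \<rho>_def x(2) axis_def vec_eq_iff forall_3)
  qed
  have \<rho>0: "\<rho> 0 = 0" by (simp add: \<rho>_def vec_eq_iff forall_2)
  have "adapted_coordinates \<Sigma> f p ?B \<phi>"
    unfolding adapted_coordinates_def
    using r(1) U'0(2) \<rho>0 o \<phi>U(2) d\<phi> det sing null by (auto simp: \<phi>_def[THEN fun_cong])
  then show ?thesis by blast
qed

text \<open>In arbitrary adapted coordinates \<open>\<phi>\<close> the transition map \<open>\<tau>\<close> preserves the axis, and \<open>F\<close> is the
  standard cuspidal edge composed with \<open>\<tau>\<close>; this determines its derivatives at the origin.\<close>

lemma adapted_coordinates_independent:
  assumes ad: "adapted_coordinates \<Sigma> f p S \<phi>"
  shows "D\<^sub>u (\<lambda>x. f (\<phi> x)) 0 \<noteq> 0"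
    "c *\<^sub>R D\<^sub>u (\<lambda>x. f (\<phi> x)) 0 \<noteq> D\<^sub>v (D\<^sub>v (\<lambda>x. f (\<phi> x))) 0"
proof -
  have S: "open S" "0 \<in> S" "\<phi> 0 = p" "open (\<phi> ` S)" "\<phi> ` S \<subseteq> \<Sigma>"
    and sing: "\<And>x. x \<in> S \<Longrightarrow> \<phi> x \<in> singular_set \<Sigma> f \<longleftrightarrow> x $ 2 = 0"
    and null: "\<And>x. x \<in> S \<Longrightarrow> x $ 2 = 0 \<Longrightarrow> D\<^sub>v (f \<circ> \<phi>) x = 0"
    using ad by (auto simp: adapted_coordinates_def)
  obtain \<phi>' where d\<phi>: "diffeomorphism S (\<phi> ` S) \<phi> \<phi>'"
    using ad by (auto simp: adapted_coordinates_def)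
  obtain r0 where r0: "r0 > 0" "ball 0 r0 \<subseteq> S" using ball_in_open[OF S(1,2)] .
  have c: "continuous_on (ball 0 r0) \<phi>"
    by (rule continuous_on_subset[OF smooth_on_continuous_on[OF diffeomorphism_smooth(1)[OF d\<phi>]] r0(2)])
  have pU: "\<phi> 0 \<in> U" using U(2) S(3) by simp
  obtain r where r: "r > 0" "r \<le> r0" "\<And>x. x \<in> ball 0 r \<Longrightarrow> \<phi> x \<in> U"
    by (rule ball_in_preimage[where f = \<phi>, OF r0(1) c U(1) pU]) (rule that)
  let ?B = "ball (0 :: real^2) r"
  have BS: "?B \<subseteq> S" using r(2) r0(2) by auto
  have z: "0 \<in> ?B" "(0 :: real^2) $ 2 = 0" using r(1) by simp_all
  have \<phi>: "smooth_on ?B \<phi>" "\<And>x. x \<in> ?B \<Longrightarrow> \<phi> x \<in> U \<inter> \<Sigma>"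
    using smooth_on_subset[OF diffeomorphism_smooth(1)[OF d\<phi>] BS] r(3) BS S(5) by blast+
  define \<tau> where "\<tau> = (\<lambda>x. \<theta> (\<phi> x))"
  define F where "F = (\<lambda>x. f (\<phi> x))"
  have \<tau>: "smooth_on ?B \<tau>"
    unfolding \<tau>_def
    by (rule smooth_on_compose[OF \<phi>(1) diffeomorphism_smooth(1)[OF U(4)]]) (use \<phi>(2) in auto)
  have F: "smooth_on ?B F"
    unfolding F_def by (rule smooth_on_compose[OF \<phi>(1) f]) (use \<phi>(2) in auto)
  note D0 = smooth_on_differentiable[OF open_ball _ z(1)]
  have d\<tau>: "\<tau> differentiable (at x)" if "x \<in> ?B" for x
    by (rule smooth_on_differentiable[OF open_ball \<tau> that])
  have \<tau>2: "\<tau> x $ 2 = 0" if "x \<in> ?B" "x $ 2 = 0" for x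
    using sing[of x] singular_iff[of "\<phi> x"] \<phi>(2)[OF that(1)] that BS by (auto simp: \<tau>_def)
  have Fv: "D\<^sub>v F x = 0" if "x \<in> ?B" "x $ 2 = 0" for x
    using null[of x] that BS by (auto simp: F_def o_def)
  have comp: "\<D> \<Phi> (F x) (\<D> F x h)
      = \<D> cusp_map (\<tau> x) (\<D> \<tau> x h)" if "x \<in> ?B" for x h
    using composite_derivative[OF open_ball that \<phi>] by (simp add: F_def \<tau>_def)
  have l\<Phi>: "linear (\<D> \<Phi> (F 0))"
    using linear_target_derivative[of "\<phi> 0"] \<phi>(2)[OF z(1)] by (simp add: F_def)
  have j: "jacobian_det \<tau> 0 \<noteq> 0"
  proof -
    have p: "\<phi> 0 \<in> U" using \<phi>(2)[OF z(1)] by blast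
    have "jacobian_det \<tau> 0 = jacobian_det \<theta> (\<phi> 0) * jacobian_det \<phi> 0"
      unfolding \<tau>_def
      by (rule jacobian_det_chain[OF D0[OF \<phi>(1)]
            smooth_on_differentiable[OF U(1) diffeomorphism_smooth(1)[OF U(4)] p]])
    then show ?thesis
      using diffeomorphism_jacobian_det_nonzero[OF U(4,1,3) p]
        diffeomorphism_jacobian_det_nonzero[OF d\<phi> S(1,4,2)] by simp
  qed
  have t2: "smooth_on ?B (\<lambda>x. \<tau> x $ 2)" by (rule smooth_on_nth[OF \<tau>])
  have nth: "D\<^sub>u (\<lambda>x. \<tau> x $ i) x = D\<^sub>u \<tau> x $ i" "D\<^sub>v (\<lambda>x. \<tau> x $ i) x = D\<^sub>v \<tau> x $ i" if "x \<in> ?B" for i x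
    by (rule partials_nth[OF d\<tau>[OF that]])+
  have u2: "D\<^sub>u \<tau> 0 $ 2 = 0"
    using D\<^sub>u_zero_on_axis[OF open_ball z D0[OF t2] \<tau>2] nth(1)[OF z(1), of 2] by simp
  have ne: "D\<^sub>u \<tau> 0 $ 1 \<noteq> 0" "D\<^sub>v \<tau> 0 $ 2 \<noteq> 0"
    using j u2 by (auto simp: jacobian_det_def)
  have mv: "\<D> cusp_map (\<tau> x) (\<D> \<tau> x h)
      = \<D> (\<lambda>x. cusp_map (\<tau> x)) x h" if "x \<in> ?B" for x h
    using frechet_derivative_chain[OF d\<tau>[OF that] cusp_map_differentiable] by simp
  have Fu: "\<D> \<Phi> (F 0) (D\<^sub>u F 0) = vector [D\<^sub>u \<tau> 0 $ 1, 0, 0]"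
    using comp[OF z(1), of "axis 1 1"] \<tau>2[OF z]
    by (simp add: D\<^sub>u_def[symmetric] frechet_derivative_cusp_map)
  have Fvv: "\<D> \<Phi> (F 0) (D\<^sub>v (D\<^sub>v F) 0) $ 2 = 2 * (D\<^sub>v \<tau> 0 $ 2)\<^sup>2"
  proof -
    have FW: "F ` ?B \<subseteq> W" using fW \<phi>(2) by (auto simp: F_def)
    have m: "cusp_map (\<tau> x) = \<Phi> (F x)" if "x \<in> ?B" for x
      using f\<Phi>[of "\<phi> x"] \<phi>(2)[OF that] by (simp add: \<tau>_def F_def)
    have s\<Phi>: "smooth_on ?B (\<lambda>x. \<Phi> (F x))"
      by (rule smooth_on_compose[OF F diffeomorphism_smooth(1)[OF W(3)] FW])
    have "\<D> \<Phi> (F 0) (D\<^sub>v (D\<^sub>v F) 0) = D\<^sub>v (D\<^sub>v (\<lambda>x. \<Phi> (F x))) 0"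
      by (rule second_derivative_compose[OF open_ball z(1) W(1) FW F diffeomorphism_smooth(1)[OF W(3)]
            Fv[OF z], symmetric])
    also have "\<dots> $ 2 = D\<^sub>v (\<lambda>x. D\<^sub>v (\<lambda>x. \<Phi> (F x)) x $ 2) 0"
      by (rule partials_nth(2)[OF D0[OF smooth_on_partials(2)[OF open_ball s\<Phi>]], symmetric])
    also have "\<dots> = D\<^sub>v (\<lambda>x. 2 * (\<tau> x $ 2 * D\<^sub>v \<tau> x $ 2)) 0"
    proof (rule partials_cong(2)[OF open_ball z(1)])
      fix x assume x: "x \<in> ?B"
      have "D\<^sub>v (\<lambda>x. \<Phi> (F x)) x = D\<^sub>v (\<lambda>x. cusp_map (\<tau> x)) x"
        by (rule partials_cong(2)[OF open_ball x m[symmetric]])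
      also have "\<dots> $ 2 = 2 * (\<tau> x $ 2 * D\<^sub>v \<tau> x $ 2)"
        unfolding D\<^sub>v_def[of "\<lambda>x. cusp_map (\<tau> x)"] mv[OF x, symmetric]
        by (simp add: D\<^sub>v_def frechet_derivative_cusp_map)
      finally show "D\<^sub>v (\<lambda>x. \<Phi> (F x)) x $ 2 = 2 * (\<tau> x $ 2 * D\<^sub>v \<tau> x $ 2)" .
    qed
    also have "\<dots> = 2 * (D\<^sub>v \<tau> 0 $ 2)\<^sup>2"
    proof -
      have tv: "smooth_on ?B (\<lambda>x. D\<^sub>v \<tau> x $ 2)"
        by (rule smooth_on_nth[OF smooth_on_partials(2)[OF open_ball \<tau>]])
      show ?thesis
        using partials_linear(2)[OF bounded_linear_mult_right D0[OF smooth_on_mult[OF t2 tv]], of 2]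
          partials_mult(2)[OF D0[OF t2] D0[OF tv]] \<tau>2[OF z] nth(2)[OF z(1), of 2]
        by (simp add: power2_eq_square)
    qed
    finally show ?thesis .
  qed
  have "D\<^sub>u F 0 \<noteq> 0"
  proof
    assume "D\<^sub>u F 0 = 0"
    then have "vector [D\<^sub>u \<tau> 0 $ 1, 0, 0] = (0 :: real^3)" using Fu linear_0[OF l\<Phi>] by simp
    then show False using ne(1) by (simp add: vec_eq_iff forall_3)
  qed
  then show "D\<^sub>u (\<lambda>x. f (\<phi> x)) 0 \<noteq> 0" by (simp add: F_def)
  have "c *\<^sub>R D\<^sub>u F 0 \<noteq> D\<^sub>v (D\<^sub>v F) 0"
  proof
    assume e: "c *\<^sub>R D\<^sub>u F 0 = D\<^sub>v (D\<^sub>v F) 0"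
    have "\<D> \<Phi> (F 0) (D\<^sub>v (D\<^sub>v F) 0) = c *\<^sub>R vector [D\<^sub>u \<tau> 0 $ 1, 0, 0]"
      unfolding e[symmetric] Fu[symmetric] by (rule linear_scale[OF l\<Phi>])
    then show False using Fvv ne(2) by simp
  qed
  then show "c *\<^sub>R D\<^sub>u (\<lambda>x. f (\<phi> x)) 0 \<noteq> D\<^sub>v (D\<^sub>v (\<lambda>x. f (\<phi> x))) 0" by (simp add: F_def)
qed

end

lemma cuspidal_edge_dataE:
  assumes "open \<Sigma>" "p \<in> \<Sigma>" "smooth_on \<Sigma> f" "cuspidal_edge \<Sigma> f p"
  obtains U U' \<theta> \<theta>' W W' \<Phi> \<Phi>' where "cuspidal_edge_data \<Sigma> f p U U' \<theta> \<theta>' W W' \<Phi> \<Phi>'"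
proof -
  have "A_equivalent UNIV f p UNIV cusp_map (0 :: real^2)"
    using assms(4) by (simp add: cuspidal_edge_def cusp_map_def[abs_def])
  then obtain U U' \<theta> \<theta>' W W' \<Phi> \<Phi>' where
    "open U" "p \<in> U" "open U'" "(0 :: real^2) \<in> U'" "diffeomorphism U U' \<theta> \<theta>'" "\<theta> p = 0"
    "openin (top_of_set UNIV) W" "f p \<in> W" "openin (top_of_set UNIV) W'" "cusp_map 0 \<in> W'"
    "diffeomorphism W W' \<Phi> \<Phi>'" "f ` U \<subseteq> W" "\<forall>x\<in>U. cusp_map (\<theta> x) = \<Phi> (f x)"
    unfolding A_equivalent_def by (elim exE conjE) (rule that)
  then have "cuspidal_edge_data \<Sigma> f p U U' \<theta> \<theta>' W W' \<Phi> \<Phi>'"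
    using assms(1-3) by (intro cuspidal_edge_data.intro) auto
  then show thesis by (rule that)
qed

text \<open>At the origin \<open>F\<^sub>u\<close> and \<open>F\<^sub>v\<^sub>v\<close> are independent and both orthogonal to the normal vector, which gives
  the nondegeneracy; \<open>N\<^sub>v\<close> is nonzero because \<open>(f, \<nu>)\<close> is an immersion and \<open>F\<^sub>v\<close> vanishes.\<close>

lemma adapted_front_in_adapted_coordinates:
  assumes \<Sigma>: "open \<Sigma>" "p \<in> \<Sigma>" and fr: "front \<Sigma> f \<nu>" and ce: "cuspidal_edge \<Sigma> f p"
    and ad: "adapted_coordinates \<Sigma> f p S \<phi>"
  obtains r where "adapted_front r (\<lambda>x. f (\<phi> x)) (\<lambda>x. \<nu> (\<phi> x))" "ball 0 r \<subseteq> S"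
proof -
  have f: "smooth_on \<Sigma> f" and \<nu>: "smooth_on \<Sigma> \<nu>"
    and unit: "\<And>q. q \<in> \<Sigma> \<Longrightarrow> \<nu> q \<in> sphere 0 1"
    and orth: "\<And>q X. q \<in> \<Sigma> \<Longrightarrow> \<D> f q X \<bullet> \<nu> q = 0"
    and inj: "\<And>q. q \<in> \<Sigma> \<Longrightarrow> inj (\<D> (\<lambda>x. (f x, \<nu> x)) q)"
    using fr by (auto simp: front_def)
  obtain U U' \<theta> \<theta>' W W' \<Phi> \<Phi>' where "cuspidal_edge_data \<Sigma> f p U U' \<theta> \<theta>' W W' \<Phi> \<Phi>'"
    using cuspidal_edge_dataE[OF \<Sigma> f ce] .
  note indep = cuspidal_edge_data.adapted_coordinates_independent[OF this ad]
  have S: "open S" "0 \<in> S" "open (\<phi> ` S)" "\<phi> ` S \<subseteq> \<Sigma>"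
    and null: "\<And>x. x \<in> S \<Longrightarrow> x $ 2 = 0 \<Longrightarrow> D\<^sub>v (f \<circ> \<phi>) x = 0"
    using ad by (auto simp: adapted_coordinates_def)
  obtain \<phi>' where d\<phi>: "diffeomorphism S (\<phi> ` S) \<phi> \<phi>'"
    using ad by (auto simp: adapted_coordinates_def)
  obtain r where r: "r > 0" "ball 0 r \<subseteq> S" using ball_in_open[OF S(1,2)] .
  let ?B = "ball (0 :: real^2) r"
  let ?F = "\<lambda>x. f (\<phi> x)" and ?N = "\<lambda>x. \<nu> (\<phi> x)"
  have z: "0 \<in> ?B" "(0 :: real^2) $ 2 = 0" using r(1) by simp_all
  have \<phi>: "smooth_on ?B \<phi>" by (rule smooth_on_subset[OF diffeomorphism_smooth(1)[OF d\<phi>] r(2)])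
  have \<phi>\<Sigma>: "\<phi> x \<in> \<Sigma>" if "x \<in> ?B" for x using that r(2) S(4) by blast
  have F: "smooth_on ?B ?F" and N: "smooth_on ?B ?N"
    by (rule smooth_on_compose[OF \<phi> f], use \<phi>\<Sigma> in blast)
       (rule smooth_on_compose[OF \<phi> \<nu>], use \<phi>\<Sigma> in blast)
  have d: "\<phi> differentiable (at x)" "f differentiable (at (\<phi> x))" "\<nu> differentiable (at (\<phi> x))"
    if "x \<in> ?B" for x
    using smooth_on_differentiable[OF open_ball \<phi> that] smooth_on_differentiable[OF \<Sigma>(1) f \<phi>\<Sigma>[OF that]]
      smooth_on_differentiable[OF \<Sigma>(1) \<nu> \<phi>\<Sigma>[OF that]] .
  have DF: "\<D> ?F x h = \<D> f (\<phi> x) (\<D> \<phi> x h)"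
    and DN: "\<D> ?N x h = \<D> \<nu> (\<phi> x) (\<D> \<phi> x h)"
    if "x \<in> ?B" for x h
    by (rule frechet_derivative_chain[OF d(1,2)[OF that]], rule frechet_derivative_chain[OF d(1,3)[OF that]])
  have unitN: "?N x \<bullet> ?N x = 1" if "x \<in> ?B" for x
    using unit[OF \<phi>\<Sigma>[OF that]] by (simp add: norm_eq_1)
  have orthF: "\<D> ?F x h \<bullet> ?N x = 0" if "x \<in> ?B" for x h
    unfolding DF[OF that] by (rule orth[OF \<phi>\<Sigma>[OF that]])
  have Fv: "D\<^sub>v ?F x = 0" if "x \<in> ?B" "x $ 2 = 0" for x
    using null[of x] that r(2) by (auto simp: o_def)
  have Nv: "D\<^sub>v ?N 0 \<noteq> 0"
  proof
    assume n: "D\<^sub>v ?N 0 = 0"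
    let ?h = "\<D> \<phi> 0 (axis 2 1)"
    have "\<D> f (\<phi> 0) ?h = 0" "\<D> \<nu> (\<phi> 0) ?h = 0"
      using Fv[OF z] n DF[OF z(1)] DN[OF z(1)] by (simp_all add: D\<^sub>v_def)
    then have "\<D> (\<lambda>x. (f x, \<nu> x)) (\<phi> 0) ?h = 0"
      using frechet_derivative_eq[OF has_derivative_Pair[OF d(2,3)[OF z(1), unfolded frechet_derivative_works]]]
      by (simp add: zero_prod_def)
    moreover have "linear (\<D> (\<lambda>x. (f x, \<nu> x)) (\<phi> 0))"
      by (rule linear_frechet_derivative[OF smooth_on_differentiable[OF \<Sigma>(1) smooth_on_Pair[OF f \<nu>] \<phi>\<Sigma>[OF z(1)]]])
    ultimately have "?h = 0" using inj[OF \<phi>\<Sigma>[OF z(1)]] linear_injective_0 by blast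
    then have "axis 2 1 = (0 :: real^2)"
      by (rule diffeomorphism_derivative_inj[OF d\<phi> S(1,3,2)])
    then show False by (simp add: axis_eq_0_iff)
  qed
  have nondeg: "det3 (D\<^sub>u ?F 0) (D\<^sub>v (D\<^sub>v ?F) 0) (?N 0) \<noteq> 0"
  proof
    assume n: "det3 (D\<^sub>u ?F 0) (D\<^sub>v (D\<^sub>v ?F) 0) (?N 0) = 0"
    note D0 = smooth_on_differentiable[OF open_ball _ z(1)]
    have "D\<^sub>v (\<lambda>x. D\<^sub>v ?F x \<bullet> ?N x) 0 = 0"
      using partials_cong(2)[OF open_ball z(1), of "\<lambda>x. D\<^sub>v ?F x \<bullet> ?N x" "\<lambda>x. 0"] orthF
      by (simp add: partials_const D\<^sub>v_def)
    then have "D\<^sub>v (D\<^sub>v ?F) 0 \<bullet> ?N 0 = 0"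
      by (simp add: partials_inner(2)[OF D0[OF smooth_on_partials(2)[OF open_ball F]] D0[OF N]]
          Fv[OF z])
    moreover have "D\<^sub>u ?F 0 \<bullet> ?N 0 = 0" using orthF[OF z(1)] by (simp add: D\<^sub>u_def)
    ultimately have "cross3 (D\<^sub>u ?F 0) (D\<^sub>v (D\<^sub>v ?F) 0) = 0"
      using cross3_eq_det3_scale[OF _ _ unitN[OF z(1)]] n by simp
    then have "collinear {0, D\<^sub>u ?F 0, D\<^sub>v (D\<^sub>v ?F) 0}" by (simp add: cross_eq_0)
    then obtain c where "D\<^sub>v (D\<^sub>v ?F) 0 = c *\<^sub>R D\<^sub>u ?F 0"
      using indep(1) by (auto simp: collinear_lemma)
    then show False using indep(2)[of c] by simp
  qed
  have "adapted_front r ?F ?N"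
    by unfold_locales (use r(1) F N unitN orthF Fv Nv nondeg in \<open>auto simp: D\<^sub>u_def D\<^sub>v_def\<close>)
  then show thesis using r(2) by (rule that)
qed


section \<open>Curvatures as quotients of densities\<close>

text \<open>The difference of the two sides is the discriminant of the characteristic polynomial of the second
  fundamental form with respect to the first one; multiplied by \<open>E\<^sup>2\<close> it is a sum of squares with
  positive coefficients.\<close>

lemma Gauss_discriminant_nonneg:
  fixes E F G L M N :: real
  assumes "E > 0" "E * G - F\<^sup>2 > 0"
  shows "4 * (E * G - F\<^sup>2) * (L * N - M\<^sup>2) \<le> (E * N - 2 * F * M + G * L)\<^sup>2"
proof -
  let ?X = "E * M - F * L" and ?Y = "E * N - G * L"
  have "E\<^sup>2 * ((E * N - 2 * F * M + G * L)\<^sup>2 - 4 * (E * G - F\<^sup>2) * (L * N - M\<^sup>2))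
      = (E * ?Y - 2 * F * ?X)\<^sup>2 + 4 * (E * G - F\<^sup>2) * ?X\<^sup>2"
    by algebra
  also have "\<dots> \<ge> 0" using assms(2) by simp
  finally show ?thesis using assms(1) by (simp add: zero_le_mult_iff)
qed

locale front_germ =
  fixes \<Sigma> :: "(real^2) set" and f \<nu> :: "real^2 \<Rightarrow> real^3"
  assumes \<Sigma>: "open \<Sigma>" and front: "front \<Sigma> f \<nu>"
begin

lemma smooth: "smooth_on \<Sigma> f" "smooth_on \<Sigma> \<nu>"
  using front by (simp_all add: front_def)

lemma unit: "q \<in> \<Sigma> \<Longrightarrow> \<nu> q \<bullet> \<nu> q = 1"
  using front by (simp add: front_def norm_eq_1)

lemma orthogonal_partials: "q \<in> \<Sigma> \<Longrightarrow> D\<^sub>u f q \<bullet> \<nu> q = 0" "q \<in> \<Sigma> \<Longrightarrow> D\<^sub>v f q \<bullet> \<nu> q = 0"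
  using front by (simp_all add: front_def D\<^sub>u_def D\<^sub>v_def)

lemma second_fundamental_form:
  assumes q: "q \<in> \<Sigma>"
  shows "second_L f \<nu> q = - (D\<^sub>u f q \<bullet> D\<^sub>u \<nu> q)" "second_M f \<nu> q = - (D\<^sub>u f q \<bullet> D\<^sub>v \<nu> q)"
    "second_M f \<nu> q = - (D\<^sub>v f q \<bullet> D\<^sub>u \<nu> q)" "second_N f \<nu> q = - (D\<^sub>v f q \<bullet> D\<^sub>v \<nu> q)"
proof -
  note D = smooth_on_differentiable[OF \<Sigma> _ q]
  note du = D[OF smooth_on_partials(1)[OF \<Sigma> smooth(1)]]
    and dv = D[OF smooth_on_partials(2)[OF \<Sigma> smooth(1)]] and dn = D[OF smooth(2)]
  have "D\<^sub>u (\<lambda>x. D\<^sub>u f x \<bullet> \<nu> x) q = 0" "D\<^sub>v (\<lambda>x. D\<^sub>u f x \<bullet> \<nu> x) q = 0"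
    "D\<^sub>u (\<lambda>x. D\<^sub>v f x \<bullet> \<nu> x) q = 0" "D\<^sub>v (\<lambda>x. D\<^sub>v f x \<bullet> \<nu> x) q = 0"
    using partials_cong[OF \<Sigma> q orthogonal_partials(1)]
      partials_cong[OF \<Sigma> q orthogonal_partials(2)]
    by (simp_all add: partials_const)
  then show "second_L f \<nu> q = - (D\<^sub>u f q \<bullet> D\<^sub>u \<nu> q)" "second_M f \<nu> q = - (D\<^sub>u f q \<bullet> D\<^sub>v \<nu> q)"
    "second_M f \<nu> q = - (D\<^sub>v f q \<bullet> D\<^sub>u \<nu> q)" "second_N f \<nu> q = - (D\<^sub>v f q \<bullet> D\<^sub>v \<nu> q)"
    unfolding partials_inner[OF du dn] partials_inner[OF dv dn]
    by (simp_all add: second_L_def second_M_def second_N_def partials_commute[OF \<Sigma> smooth(1) q])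
qed

lemma cross_partials: "q \<in> \<Sigma> \<Longrightarrow> cross3 (D\<^sub>u f q) (D\<^sub>v f q) = area_density f \<nu> q *\<^sub>R \<nu> q"
  unfolding area_density_def by (rule cross3_eq_det3_scale[OF orthogonal_partials unit])

lemma cross_gauss_partials: "q \<in> \<Sigma> \<Longrightarrow> cross3 (D\<^sub>u \<nu> q) (D\<^sub>v \<nu> q) = gauss_density \<nu> q *\<^sub>R \<nu> q"
  unfolding gauss_density_def
  by (rule cross3_eq_det3_scale[OF partials_orthogonal_unit[OF \<Sigma> _
          smooth_on_differentiable[OF \<Sigma> smooth(2)] unit] unit])

lemma first_fundamental_form:
  assumes q: "q \<in> \<Sigma>"
  shows "first_E f q * first_G f q - (first_F f q)\<^sup>2 = (area_density f \<nu> q)\<^sup>2"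
proof -
  have "first_E f q * first_G f q - (first_F f q)\<^sup>2
      = cross3 (D\<^sub>u f q) (D\<^sub>v f q) \<bullet> cross3 (D\<^sub>u f q) (D\<^sub>v f q)"
    by (simp add: first_E_def first_F_def first_G_def dot_cross inner_commute power2_eq_square)
  then show ?thesis by (simp add: cross_partials[OF q] unit[OF q] power2_eq_square)
qed

lemma second_form_det:
  assumes q: "q \<in> \<Sigma>"
  shows "second_L f \<nu> q * second_N f \<nu> q - (second_M f \<nu> q)\<^sup>2 = gauss_density \<nu> q * area_density f \<nu> q"
proof -
  have "(second_M f \<nu> q)\<^sup>2 = (D\<^sub>u f q \<bullet> D\<^sub>v \<nu> q) * (D\<^sub>v f q \<bullet> D\<^sub>u \<nu> q)"
    unfolding power2_eq_square
    by (subst (1) second_fundamental_form(2)[OF q], subst second_fundamental_form(3)[OF q]) simp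
  then have "second_L f \<nu> q * second_N f \<nu> q - (second_M f \<nu> q)\<^sup>2
      = (D\<^sub>u f q \<bullet> D\<^sub>u \<nu> q) * (D\<^sub>v f q \<bullet> D\<^sub>v \<nu> q) - (D\<^sub>u f q \<bullet> D\<^sub>v \<nu> q) * (D\<^sub>v f q \<bullet> D\<^sub>u \<nu> q)"
    unfolding second_fundamental_form(1,4)[OF q] by simp
  also have "\<dots> = cross3 (D\<^sub>u f q) (D\<^sub>v f q) \<bullet> cross3 (D\<^sub>u \<nu> q) (D\<^sub>v \<nu> q)"
    by (simp add: dot_cross)
  finally show ?thesis by (simp add: cross_partials[OF q] cross_gauss_partials[OF q] unit[OF q])
qed

lemma gaussian_curvature_eq:
  assumes "q \<in> \<Sigma>" "area_density f \<nu> q \<noteq> 0"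
  shows "gaussian_curvature f \<nu> q = gauss_density \<nu> q / area_density f \<nu> q"
  unfolding gaussian_curvature_def first_fundamental_form[OF assms(1)] second_form_det[OF assms(1)]
  using assms(2) by (simp add: power2_eq_square)

text \<open>By Weingarten's equations a principal curvature \<open>\<kappa>\<close> is a number for which \<open>d\<nu> + \<kappa> df\<close> is
  singular: its determinant is the area density times the characteristic polynomial
  \<open>\<kappa>\<^sup>2 - 2 H \<kappa> + K\<close>.\<close>

lemma principal_curvature_singular:
  assumes q: "q \<in> \<Sigma>" and a: "area_density f \<nu> q \<noteq> 0"
    and k: "k = mean_curvature f \<nu> q + sqrt ((mean_curvature f \<nu> q)\<^sup>2 - gaussian_curvature f \<nu> q) \<or>
      k = mean_curvature f \<nu> q - sqrt ((mean_curvature f \<nu> q)\<^sup>2 - gaussian_curvature f \<nu> q)"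
  shows "det3 (D\<^sub>u \<nu> q + k *\<^sub>R D\<^sub>u f q) (D\<^sub>v \<nu> q + k *\<^sub>R D\<^sub>v f q) (\<nu> q) = 0"
proof -
  define E F G L M N where "E = first_E f q" and "F = first_F f q" and "G = first_G f q"
    and "L = second_L f \<nu> q" and "M = second_M f \<nu> q" and "N = second_N f \<nu> q"
  define H K where "H = mean_curvature f \<nu> q" and "K = gaussian_curvature f \<nu> q"
  define d where "d = area_density f \<nu> q"
  have d: "E * G - F\<^sup>2 = d\<^sup>2" "d \<noteq> 0"
    using first_fundamental_form[OF q] a by (simp_all add: E_def F_def G_def d_def)
  have d2: "d\<^sup>2 > 0" using d(2) by simp
  have H: "2 * d\<^sup>2 * H = E * N - 2 * F * M + G * L"
    using d by (simp add: H_def mean_curvature_def E_def F_def G_def L_def M_def N_def)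
  have K: "d\<^sup>2 * K = L * N - M\<^sup>2"
    using d by (simp add: K_def gaussian_curvature_def E_def F_def G_def L_def M_def N_def)
  have Epos: "E > 0"
  proof -
    have "D\<^sub>u f q \<noteq> 0" using a by (auto simp: area_density_def)
    then show ?thesis by (simp add: E_def first_E_def)
  qed
  (* The square root in the definition of k is that of a nonnegative number. *)
  have "4 * (E * G - F\<^sup>2) * (L * N - M\<^sup>2) \<le> (E * N - 2 * F * M + G * L)\<^sup>2"
    by (rule Gauss_discriminant_nonneg[OF Epos]) (use d d2 in simp)
  then have "4 * d\<^sup>2 * (d\<^sup>2 * K) \<le> (2 * d\<^sup>2 * H)\<^sup>2" unfolding d(1) K H .
  then have "(4 * d\<^sup>2 * d\<^sup>2) * K \<le> (4 * d\<^sup>2 * d\<^sup>2) * H\<^sup>2"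
    by (simp add: power_mult_distrib power2_eq_square mult_ac)
  then have "H\<^sup>2 - K \<ge> 0" using d2 by (simp add: mult_le_cancel_left)
  then have "(k - H)\<^sup>2 = H\<^sup>2 - K"
    using k by (auto simp: H_def[symmetric] K_def[symmetric])
  then have root: "k\<^sup>2 - 2 * H * k + K = 0"
    by (simp add: power2_eq_square algebra_simps)
  let ?P = "det3 (D\<^sub>u \<nu> q + k *\<^sub>R D\<^sub>u f q) (D\<^sub>v \<nu> q + k *\<^sub>R D\<^sub>v f q) (\<nu> q)"
  let ?A = "det3 (D\<^sub>u f q) (D\<^sub>v \<nu> q) (\<nu> q) + det3 (D\<^sub>u \<nu> q) (D\<^sub>v f q) (\<nu> q)"
  have det: "d * det3 x y (\<nu> q) = cross3 x y \<bullet> cross3 (D\<^sub>u f q) (D\<^sub>v f q)" for x y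
    unfolding cross_partials[OF q] d_def[symmetric]
    using cross_triple[of x y "\<nu> q"] by (simp add: det3_eq_dot_cross inner_commute)
  have A: "d * ?A = - (2 * d\<^sup>2 * H)"
  proof -
    have "d * ?A = first_E f q * (D\<^sub>v \<nu> q \<bullet> D\<^sub>v f q) - first_F f q * (D\<^sub>v \<nu> q \<bullet> D\<^sub>u f q)
        + ((D\<^sub>u \<nu> q \<bullet> D\<^sub>u f q) * first_G f q - (D\<^sub>u \<nu> q \<bullet> D\<^sub>v f q) * first_F f q)"
      unfolding distrib_left det dot_cross
      by (simp add: first_E_def first_F_def first_G_def inner_commute)
    also have "\<dots> = E * (- N) - F * (- M) + ((- L) * G - (- M) * F)"
    proof -
      have "D\<^sub>v \<nu> q \<bullet> D\<^sub>v f q = - N" "D\<^sub>v \<nu> q \<bullet> D\<^sub>u f q = - M"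
        "D\<^sub>u \<nu> q \<bullet> D\<^sub>u f q = - L" "D\<^sub>u \<nu> q \<bullet> D\<^sub>v f q = - M"
        using second_fundamental_form[OF q] by (simp_all add: L_def M_def N_def inner_commute)
      then show ?thesis by (simp add: E_def F_def G_def)
    qed
    finally show ?thesis unfolding H by (simp add: algebra_simps)
  qed
  have "d * ?P = gauss_density \<nu> q * d + k * (d * ?A) + k\<^sup>2 * (d * d)"
    unfolding det3_add_scale gauss_density_def[symmetric] area_density_def[symmetric] d_def[symmetric]
    by (simp add: algebra_simps)
  also have "gauss_density \<nu> q * d = d\<^sup>2 * K"
    unfolding K using second_form_det[OF q] by (simp add: L_def M_def N_def d_def)
  also have "d\<^sup>2 * K + k * (d * ?A) + k\<^sup>2 * (d * d) = d\<^sup>2 * (k\<^sup>2 - 2 * H * k + K)"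
    unfolding A by (simp add: power2_eq_square algebra_simps)
  finally show ?thesis using root d(2) by simp
qed

end

section \<open>The curvature near a cuspidal edge\<close>

lemma det3_linear_combination:
  "det3 (a1 *\<^sub>R x + a2 *\<^sub>R y) (b1 *\<^sub>R x + b2 *\<^sub>R y) n = (a1 * b2 - a2 * b1) * det3 x y n"
proof -
  have *: "det3 x y n = cross3 x y \<bullet> n" for x y n
    using cross_triple[of x y n] by (simp add: det3_eq_dot_cross inner_commute)
  have "cross3 (a1 *\<^sub>R x + a2 *\<^sub>R y) (b1 *\<^sub>R x + b2 *\<^sub>R y) = (a1 * b2 - a2 * b1) *\<^sub>R cross3 x y"
    using cross_skew[of y x]
    by (simp add: cross_add_left cross_add_right cross_mult_left cross_mult_right algebra_simps)
  then show ?thesis unfolding * by simp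
qed

locale front_chart = front_germ \<Sigma> f \<nu> + adapted_front r "\<lambda>x. f (\<phi> x)" "\<lambda>x. \<nu> (\<phi> x)"
  for \<Sigma> :: "(real^2) set" and f \<nu> :: "real^2 \<Rightarrow> real^3" and r :: real and \<phi> :: "real^2 \<Rightarrow> real^2" +
  fixes p :: "real^2" and S :: "(real^2) set" and \<phi>'
  assumes S: "open S" "ball 0 r \<subseteq> S" "open (\<phi> ` S)" "\<phi> ` S \<subseteq> \<Sigma>" and \<phi>0: "\<phi> 0 = p"
    and \<phi>: "diffeomorphism S (\<phi> ` S) \<phi> \<phi>'"
    and singular: "\<And>x. x \<in> S \<Longrightarrow> \<phi> x \<in> singular_set \<Sigma> f \<longleftrightarrow> x $ 2 = 0"
begin

abbreviation "\<delta>\<^sub>f \<equiv> area_density (\<lambda>x. f (\<phi> x)) (\<lambda>x. \<nu> (\<phi> x))"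
abbreviation "\<delta>\<^sub>\<nu> \<equiv> gauss_density (\<lambda>x. \<nu> (\<phi> x))"

lemma \<phi>_in: "x \<in> S \<Longrightarrow> \<phi> x \<in> \<Sigma>"
  using S(4) by blast

lemma smooth_chart: "smooth_on S \<phi>"
  by (rule diffeomorphism_smooth(1)[OF \<phi>])

lemma jacobian_nonzero: "x \<in> S \<Longrightarrow> jacobian_det \<phi> x \<noteq> 0"
  by (rule diffeomorphism_jacobian_det_nonzero[OF \<phi> S(1,3)])

lemma differentiable_chart:
  assumes "x \<in> S"
  shows "\<phi> differentiable (at x)" "f differentiable (at (\<phi> x))" "\<nu> differentiable (at (\<phi> x))"
  by (rule smooth_on_differentiable[OF S(1) smooth_chart assms],
      rule smooth_on_differentiable[OF \<Sigma> smooth(1) \<phi>_in[OF assms]],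
      rule smooth_on_differentiable[OF \<Sigma> smooth(2) \<phi>_in[OF assms]])

text \<open>All determinants of this kind are multiplied by the Jacobian under a change of coordinates; so
  quotients of them and their zeros are independent of the coordinates.\<close>

lemma pencil_chart:
  assumes x: "x \<in> S"
  shows "det3 (D\<^sub>u (\<lambda>x. \<nu> (\<phi> x)) x + k *\<^sub>R D\<^sub>u (\<lambda>x. f (\<phi> x)) x)
      (D\<^sub>v (\<lambda>x. \<nu> (\<phi> x)) x + k *\<^sub>R D\<^sub>v (\<lambda>x. f (\<phi> x)) x) (\<nu> (\<phi> x))
    = jacobian_det \<phi> x * det3 (D\<^sub>u \<nu> (\<phi> x) + k *\<^sub>R D\<^sub>u f (\<phi> x)) (D\<^sub>v \<nu> (\<phi> x) + k *\<^sub>R D\<^sub>v f (\<phi> x)) (\<nu> (\<phi> x))"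
proof -
  have "(a1 *\<^sub>R X + a2 *\<^sub>R Y) + k *\<^sub>R (a1 *\<^sub>R X' + a2 *\<^sub>R Y') = a1 *\<^sub>R (X + k *\<^sub>R X') + a2 *\<^sub>R (Y + k *\<^sub>R Y')"
    for a1 a2 and X Y X' Y' :: "real^3"
    by (simp add: algebra_simps)
  then show ?thesis
    unfolding partials_chain[OF differentiable_chart(1,2)[OF x]]
      partials_chain[OF differentiable_chart(1,3)[OF x]]
    by (simp only: det3_linear_combination jacobian_det_def)
qed

lemma densities_chart:
  assumes x: "x \<in> S"
  shows "\<delta>\<^sub>f x = jacobian_det \<phi> x * area_density f \<nu> (\<phi> x)" "\<delta>\<^sub>\<nu> x = jacobian_det \<phi> x * gauss_density \<nu> (\<phi> x)"
  unfolding area_density_def gauss_density_def jacobian_det_def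
    partials_chain[OF differentiable_chart(1,2)[OF x]]
    partials_chain[OF differentiable_chart(1,3)[OF x]]
  by (rule det3_linear_combination)+

lemma gaussian_curvature_chart:
  assumes x: "x \<in> S" and a: "\<delta>\<^sub>f x \<noteq> 0"
  shows "gaussian_curvature f \<nu> (\<phi> x) = \<delta>\<^sub>\<nu> x / \<delta>\<^sub>f x"
  using gaussian_curvature_eq[OF \<phi>_in[OF x]] densities_chart[OF x] a by auto

lemma gauss_density_axis_if_curvature_bounded:
  assumes U: "p \<in> interior U" and bd: "bounded (gaussian_curvature f \<nu> ` (U - singular_set \<Sigma> f))"
  obtains d where "0 < d" "d \<le> r" "\<And>x. x \<in> ball 0 d \<Longrightarrow> x $ 2 = 0 \<Longrightarrow> \<delta>\<^sub>\<nu> x = 0"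
proof -
  obtain C where C: "\<And>q. q \<in> U - singular_set \<Sigma> f \<Longrightarrow> \<bar>gaussian_curvature f \<nu> q\<bar> \<le> C"
    using bd by (auto simp: bounded_iff)
  obtain e where e: "0 < e" "e \<le> r" "\<And>x. x \<in> ball 0 e \<Longrightarrow> x $ 2 \<noteq> 0 \<Longrightarrow> \<delta>\<^sub>f x \<noteq> 0"
    by (rule area_density_nonzero_off_axis) (rule that)
  have eS: "ball 0 e \<subseteq> S" using e(2) S(2) by auto
  have p: "\<phi> 0 \<in> interior U" using U \<phi>0 by simp
  obtain d where d: "d > 0" "d \<le> e" "\<And>x. x \<in> ball 0 d \<Longrightarrow> \<phi> x \<in> interior U"
    by (rule ball_in_preimage[where f = \<phi>, OF e(1)
          continuous_on_subset[OF smooth_on_continuous_on[OF smooth_chart] eS] open_interior p]) (rule that)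
  have dr: "d \<le> r" using d(2) e(2) by simp
  have bound: "\<bar>\<delta>\<^sub>\<nu> x\<bar> \<le> C * \<bar>\<delta>\<^sub>f x\<bar>" if x: "x \<in> ball 0 d" "x $ 2 \<noteq> 0" for x
  proof -
    have xe: "x \<in> ball 0 e" using x(1) d(2) by auto
    then have xS: "x \<in> S" using eS by blast
    have "\<phi> x \<in> U - singular_set \<Sigma> f" using d(3)[OF x(1)] interior_subset singular[OF xS] x(2) by blast
    from C[OF this] have "\<bar>\<delta>\<^sub>\<nu> x / \<delta>\<^sub>f x\<bar> \<le> C"
      unfolding gaussian_curvature_chart[OF xS e(3)[OF xe x(2)]] .
    then show ?thesis using e(3)[OF xe x(2)] by (simp add: abs_divide divide_le_eq)
  qed
  show thesis
    by (rule that[OF d(1) dr gauss_density_axis_if_quotient_bounded[OF d(1) dr bound]])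
qed

lemma nondegenerate_singularity:
  assumes d: "0 < d" "d \<le> r" and \<Lambda>: "\<And>x. x \<in> ball 0 d \<Longrightarrow> x $ 2 = 0 \<Longrightarrow> \<delta>\<^sub>\<nu> x = 0"
    and nd: "gauss_map_nondegenerate_singular \<Sigma> f \<nu> p"
  shows "D\<^sub>v \<delta>\<^sub>\<nu> 0 \<noteq> 0"
proof -
  obtain W \<kappa> where \<kappa>: "bounded_principal_curvature \<Sigma> f \<nu> p W \<kappa>" "(D\<^sub>u \<kappa> p, D\<^sub>v \<kappa> p) \<noteq> (0, 0)"
    using nd by (auto simp: gauss_map_nondegenerate_singular_def)
  have W: "open W" "p \<in> W" "W \<subseteq> \<Sigma>" "smooth_on W \<kappa>"
    using \<kappa>(1) by (auto simp: bounded_principal_curvature_def)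
  obtain e where e: "0 < e" "e \<le> r" "\<And>x. x \<in> ball 0 e \<Longrightarrow> x $ 2 \<noteq> 0 \<Longrightarrow> \<delta>\<^sub>f x \<noteq> 0"
    by (rule area_density_nonzero_off_axis) (rule that)
  define m where "m = min d e"
  have m: "m > 0" using d e by (simp add: m_def)
  have mS: "ball 0 m \<subseteq> S" using d(2) S(2) by (auto simp: m_def)
  have p: "\<phi> 0 \<in> W" using W(2) \<phi>0 by simp
  obtain c where c: "c > 0" "c \<le> m" "\<And>x. x \<in> ball 0 c \<Longrightarrow> \<phi> x \<in> W"
    by (rule ball_in_preimage[where f = \<phi>, OF m
          continuous_on_subset[OF smooth_on_continuous_on[OF smooth_chart] mS] W(1) p]) (rule that)
  have cS: "ball 0 c \<subseteq> S" using mS c(2) by auto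
  have cr: "c \<le> r" using c(2) d(2) by (simp add: m_def)
  let ?k = "\<lambda>x. \<kappa> (\<phi> x)"
  have k: "smooth_on (ball 0 c) ?k"
    by (rule smooth_on_compose[OF smooth_on_subset[OF smooth_chart cS] W(4)]) (use c(3) in auto)
  show ?thesis
  proof (rule principal_curvature_nondegenerate[OF c(1) cr k])
    fix x :: "real^2" assume x: "x \<in> ball 0 c" "x $ 2 \<noteq> 0"
    have xS: "x \<in> S" using x(1) cS by blast
    have "x \<in> ball 0 e" using x(1) c(2) by (auto simp: m_def)
    then have a: "area_density f \<nu> (\<phi> x) \<noteq> 0" using e(3)[OF _ x(2)] densities_chart(1)[OF xS] by auto
    have "\<phi> x \<in> W - singular_set \<Sigma> f" using c(3)[OF x(1)] singular[OF xS] x(2) by blast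
    then have "\<kappa> (\<phi> x) = mean_curvature f \<nu> (\<phi> x) + sqrt ((mean_curvature f \<nu> (\<phi> x))\<^sup>2 - gaussian_curvature f \<nu> (\<phi> x)) \<or>
        \<kappa> (\<phi> x) = mean_curvature f \<nu> (\<phi> x) - sqrt ((mean_curvature f \<nu> (\<phi> x))\<^sup>2 - gaussian_curvature f \<nu> (\<phi> x))"
      using \<kappa>(1) unfolding bounded_principal_curvature_def Let_def by blast
    from principal_curvature_singular[OF \<phi>_in[OF xS] a this]
    show "det3 (D\<^sub>u (\<lambda>x. \<nu> (\<phi> x)) x + ?k x *\<^sub>R D\<^sub>u (\<lambda>x. f (\<phi> x)) x)
        (D\<^sub>v (\<lambda>x. \<nu> (\<phi> x)) x + ?k x *\<^sub>R D\<^sub>v (\<lambda>x. f (\<phi> x)) x) (\<nu> (\<phi> x)) = 0"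
      unfolding pencil_chart[OF xS] by simp
  next
    fix x :: "real^2" assume "x \<in> ball 0 c" "x $ 2 = 0"
    then show "\<delta>\<^sub>\<nu> x = 0" using c(2) by (intro \<Lambda>) (auto simp: m_def)
  next
    have S0: "0 \<in> S" using S(2) origin by blast
    have d\<kappa>: "\<kappa> differentiable (at (\<phi> 0))" by (rule smooth_on_differentiable[OF W(1,4) p])
    show "D\<^sub>u ?k 0 \<noteq> 0 \<or> D\<^sub>v ?k 0 \<noteq> 0"
    proof (rule ccontr)
      assume "\<not> ?thesis"
      then have z: "D\<^sub>u ?k 0 = 0" "D\<^sub>v ?k 0 = 0" by simp_all
      note ch = partials_chain[OF differentiable_chart(1)[OF S0] d\<kappa>]
      let ?a = "D\<^sub>u \<phi> 0" and ?b = "D\<^sub>v \<phi> 0"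
      have 1: "?a $ 1 * D\<^sub>u \<kappa> p + ?a $ 2 * D\<^sub>v \<kappa> p = 0" "?b $ 1 * D\<^sub>u \<kappa> p + ?b $ 2 * D\<^sub>v \<kappa> p = 0"
        using z unfolding ch \<phi>0 by simp_all
      have "jacobian_det \<phi> 0 * D\<^sub>u \<kappa> p
          = ?b $ 2 * (?a $ 1 * D\<^sub>u \<kappa> p + ?a $ 2 * D\<^sub>v \<kappa> p) - ?a $ 2 * (?b $ 1 * D\<^sub>u \<kappa> p + ?b $ 2 * D\<^sub>v \<kappa> p)"
        by (simp add: jacobian_det_def algebra_simps)
      moreover have "jacobian_det \<phi> 0 * D\<^sub>v \<kappa> p
          = ?a $ 1 * (?b $ 1 * D\<^sub>u \<kappa> p + ?b $ 2 * D\<^sub>v \<kappa> p) - ?b $ 1 * (?a $ 1 * D\<^sub>u \<kappa> p + ?a $ 2 * D\<^sub>v \<kappa> p)"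
        by (simp add: jacobian_det_def algebra_simps)
      ultimately show False using 1 jacobian_nonzero[OF S0] \<kappa>(2) by simp
    qed
  qed
qed

text \<open>Regular points accumulate at every singular point of the chart, so the limit that defines the
  extension is the value of the continuous function \<open>\<kappa>\<close>.\<close>

lemma extended_curvature_eq:
  assumes e: "0 < e" "e \<le> r" and \<kappa>: "continuous_on (ball 0 e) \<kappa>"
    and a: "\<And>x. x \<in> ball 0 e \<Longrightarrow> x $ 2 \<noteq> 0 \<Longrightarrow> \<delta>\<^sub>f x \<noteq> 0"
    and q: "\<And>x. x \<in> ball 0 e \<Longrightarrow> x $ 2 \<noteq> 0 \<Longrightarrow> \<delta>\<^sub>\<nu> x / \<delta>\<^sub>f x = \<kappa> x"
    and x: "x \<in> ball 0 e"
  shows "extended_gaussian_curvature \<Sigma> f \<nu> (\<phi> x) = \<kappa> x"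
proof -
  have eS: "ball 0 e \<subseteq> S" using e(2) S(2) by auto
  have xS: "x \<in> S" using x eS by blast
  have K: "gaussian_curvature f \<nu> (\<phi> y) = \<kappa> y" if "y \<in> ball 0 e" "y $ 2 \<noteq> 0" for y
    using gaussian_curvature_chart[OF _ a[OF that]] q[OF that] eS that(1) by auto
  show ?thesis
  proof (cases "x $ 2 = 0")
    case False
    then show ?thesis
      using singular[OF xS] K[OF x] by (simp add: extended_gaussian_curvature_def)
  next
    case True
    let ?R = "\<Sigma> - singular_set \<Sigma> f" and ?V = "\<phi> ` ball 0 e"
    have oV: "open ?V" by (rule diffeomorphism_open_image[OF \<phi> S(3) open_ball eS])
    have xV: "\<phi> x \<in> ?V" using x by blast
    have dV: "diffeomorphism (ball 0 e) ?V \<phi> \<phi>'" by (rule diffeomorphism_restrict[OF \<phi> eS refl])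
    have "continuous_on ?V (\<lambda>y. \<kappa> (\<phi>' y))"
      by (rule continuous_on_compose2[OF \<kappa> smooth_on_continuous_on[OF diffeomorphism_smooth(2)[OF dV]]])
         (use diffeomorphism_apply[OF dV] in auto)
    from bspec[OF this[unfolded continuous_on_eq_continuous_at[OF oV]] xV]
    have "isCont (\<lambda>y. \<kappa> (\<phi>' y)) (\<phi> x)" .
    then have "((\<lambda>y. \<kappa> (\<phi>' y)) \<longlongrightarrow> \<kappa> x) (at (\<phi> x))"
      using diffeomorphism_apply(2)[OF dV x] by (simp add: isCont_def)
    then have t: "((\<lambda>y. \<kappa> (\<phi>' y)) \<longlongrightarrow> \<kappa> x) (at (\<phi> x) within ?R)"
      by (rule tendsto_within_subset) simp
    have "(gaussian_curvature f \<nu> \<longlongrightarrow> \<kappa> x) (at (\<phi> x) within ?R)"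
    proof (rule Lim_transform_eventually[OF t])
      have "\<kappa> (\<phi>' y) = gaussian_curvature f \<nu> y" if y: "y \<in> ?V" "y \<in> ?R" for y
      proof -
        obtain w where w: "w \<in> ball 0 e" "y = \<phi> w" using y(1) by blast
        have "w \<in> S" using w(1) eS by blast
        then have "w $ 2 \<noteq> 0" using singular[of w] y(2) w(2) by blast
        then show ?thesis using K[OF w(1)] diffeomorphism_apply(2)[OF dV w(1)] w(2) by simp
      qed
      then show "\<forall>\<^sub>F y in at (\<phi> x) within ?R. \<kappa> (\<phi>' y) = gaussian_curvature f \<nu> y"
        unfolding eventually_at_topological using oV xV by blast
    qed
    moreover have "at (\<phi> x) within ?R \<noteq> bot"
    proof -
      have "\<phi> x islimpt ?R"
      proof (rule islimptI)
        fix T assume T: "\<phi> x \<in> T" "open T"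
        have "open (ball 0 e \<inter> \<phi> -` T)"
          by (rule continuous_open_preimage[OF continuous_on_subset[OF smooth_on_continuous_on[OF smooth_chart] eS] open_ball T(2)])
        moreover have "x \<in> ball 0 e \<inter> \<phi> -` T" using x T(1) by simp
        ultimately obtain c where c: "c > 0" "ball x c \<subseteq> ball 0 e \<inter> \<phi> -` T" by (rule openE)
        let ?y = "x + (c / 2) *\<^sub>R axis 2 1"
        have "?y \<in> ball x c" using c(1) by (simp add: dist_norm norm_axis_1)
        then have y: "?y \<in> ball 0 e" "\<phi> ?y \<in> T" using c(2) by auto
        have "?y $ 2 \<noteq> 0" using True c(1) by (simp add: axis_def)
        moreover have "?y \<in> S" using y(1) eS by blast
        ultimately have "\<phi> ?y \<in> ?R" using singular \<phi>_in by blast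
        moreover have "\<phi> ?y \<noteq> \<phi> x" using calculation singular[OF xS] True by auto
        ultimately show "\<exists>y\<in>?R. y \<in> T \<and> y \<noteq> \<phi> x" using y(2) by blast
      qed
      then show ?thesis by (simp add: trivial_limit_within)
    qed
    ultimately have "Lim (at (\<phi> x) within ?R) (gaussian_curvature f \<nu>) = \<kappa> x"
      by (intro tendsto_Lim)
    then show ?thesis
      using singular[OF xS] True by (simp add: extended_gaussian_curvature_def)
  qed
qed

text \<open>Since \<open>\<nu>\<close> has no fold at \<open>p\<close>, its derivative along the singular curve vanishes there, and
  \<open>gauss_density_derivative_sign\<close> applies: \<open>\<Lambda>\<^sub>v\<close> and \<open>D = det(F\<^sub>u, F\<^sub>u\<^sub>u, N)\<close> have opposite signs. The
  curvature has the sign of \<open>\<Lambda>\<^sub>v \<lambda>\<^sub>v\<close>, the singular curvature that of \<open>\<lambda>\<^sub>v D\<close>.\<close>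

lemma curvature_sign:
  assumes d: "0 < d" "d \<le> r" and \<Lambda>: "\<And>x. x \<in> ball 0 d \<Longrightarrow> x $ 2 = 0 \<Longrightarrow> \<delta>\<^sub>\<nu> x = 0"
    and nd: "gauss_map_nondegenerate_singular \<Sigma> f \<nu> p" and nf: "\<not> gauss_map_fold \<nu> p"
  obtains V where "open V" "p \<in> V" "V \<subseteq> \<Sigma>"
    "coord_singular_curvature (\<lambda>x. f (\<phi> x)) (\<lambda>x. \<nu> (\<phi> x)) 0 \<noteq> 0"
    "\<And>q. q \<in> V \<Longrightarrow> sgn (extended_gaussian_curvature \<Sigma> f \<nu> q)
      = - sgn (coord_singular_curvature (\<lambda>x. f (\<phi> x)) (\<lambda>x. \<nu> (\<phi> x)) 0)"
proof -
  have nz: "D\<^sub>v \<delta>\<^sub>\<nu> 0 \<noteq> 0" by (rule nondegenerate_singularity[OF d \<Lambda> nd])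
  have dr: "ball 0 d \<subseteq> ball (0 :: real^2) r" using d by auto
  have S0: "0 \<in> S" using S(2) origin by blast
  have Nu: "D\<^sub>u (\<lambda>x. \<nu> (\<phi> x)) 0 = 0"
  proof (rule ccontr)
    assume Nu: "D\<^sub>u (\<lambda>x. \<nu> (\<phi> x)) 0 \<noteq> 0"
    have "gauss_map_fold \<nu> (\<phi> 0)"
      by (rule fold_if_kernel_transversal[OF d(1) smooth_on_subset[OF N dr] _ \<Lambda> nz Nu S(1) S0 S(3) \<phi> refl])
         (use adapted_front.unit[OF adapted_front_axioms] dr in blast)
    then show False using nf \<phi>0 by simp
  qed
  obtain e \<kappa> where e: "0 < e" "e \<le> d" and \<kappa>: "continuous_on (ball 0 e) \<kappa>"
    and a: "\<And>x. x \<in> ball 0 e \<Longrightarrow> x $ 2 \<noteq> 0 \<Longrightarrow> \<delta>\<^sub>f x \<noteq> 0"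
    and q: "\<And>x. x \<in> ball 0 e \<Longrightarrow> x $ 2 \<noteq> 0 \<Longrightarrow> \<delta>\<^sub>\<nu> x / \<delta>\<^sub>f x = \<kappa> x"
    and sg: "\<And>x. x \<in> ball 0 e \<Longrightarrow> sgn (\<kappa> x) = sgn (D\<^sub>v \<delta>\<^sub>\<nu> 0 * D\<^sub>v \<delta>\<^sub>f 0)"
    by (rule density_quotient_extends[OF d _ nz], erule (1) \<Lambda>, rule that)
  have er: "e \<le> r" using e(2) d(2) by simp
  have eS: "ball 0 e \<subseteq> S" using er S(2) by auto
  define D where "D = det3 (D\<^sub>u (\<lambda>x. f (\<phi> x)) 0) (D\<^sub>u (D\<^sub>u (\<lambda>x. f (\<phi> x))) 0) (\<nu> (\<phi> 0))"
  have neg: "D\<^sub>v \<delta>\<^sub>\<nu> 0 * D < 0"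
    unfolding D_def by (rule gauss_density_derivative_sign[OF Nu nz])
  have area_v: "D\<^sub>v \<delta>\<^sub>f 0 \<noteq> 0" using nondegenerate area_density_derivative by simp
  let ?\<kappa>s = "coord_singular_curvature (\<lambda>x. f (\<phi> x)) (\<lambda>x. \<nu> (\<phi> x)) 0"
  have ks: "?\<kappa>s = sgn (D\<^sub>v \<delta>\<^sub>f 0) * D / norm (D\<^sub>u (\<lambda>x. f (\<phi> x)) 0) ^ 3"
    by (simp add: coord_singular_curvature_def D_def)
  have "sgn ?\<kappa>s = sgn (D\<^sub>v \<delta>\<^sub>f 0) * sgn D"
    unfolding ks using Fu_nonzero by (simp add: sgn_mult sgn_divide)
  moreover have "sgn D = - sgn (D\<^sub>v \<delta>\<^sub>\<nu> 0)"
    using neg by (auto simp: sgn_if mult_less_0_iff)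
  ultimately have sks: "sgn ?\<kappa>s = - sgn (D\<^sub>v \<delta>\<^sub>\<nu> 0 * D\<^sub>v \<delta>\<^sub>f 0)" by (simp add: sgn_mult)
  show thesis
  proof (rule that[of "\<phi> ` ball 0 e"])
    show "open (\<phi> ` ball 0 e)" by (rule diffeomorphism_open_image[OF \<phi> S(3) open_ball eS])
    have "(0 :: real^2) \<in> ball 0 e" using e by simp
    then show "p \<in> \<phi> ` ball 0 e" using \<phi>0 by blast
    show "\<phi> ` ball 0 e \<subseteq> \<Sigma>" using eS S(4) by blast
    show "?\<kappa>s \<noteq> 0"
    proof
      assume "?\<kappa>s = 0"
      then show False using sks nz area_v by (simp add: sgn_mult sgn_zero_iff)
    qed
    fix w assume "w \<in> \<phi> ` ball 0 e"
    then obtain x where x: "x \<in> ball 0 e" "w = \<phi> x" by blast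
    have "extended_gaussian_curvature \<Sigma> f \<nu> (\<phi> x) = \<kappa> x"
      by (rule extended_curvature_eq[OF e(1) er \<kappa> _ _ x(1)], erule (1) a, erule (1) q)
    then show "sgn (extended_gaussian_curvature \<Sigma> f \<nu> w) = - sgn ?\<kappa>s"
      using sg[OF x(1)] sks by (simp add: x(2))
  qed
qed

end

theorem theorem1:
  fixes \<Sigma> :: "(real^2) set" and f \<nu> :: "real^2 \<Rightarrow> real^3" and p :: "real^2"
  assumes "open \<Sigma>" and "connected \<Sigma>"
    and "front \<Sigma> f \<nu>"
    and "p \<in> \<Sigma>" and "cuspidal_edge \<Sigma> f p"
    and "gauss_map_nondegenerate_singular \<Sigma> f \<nu> p"
    and "\<not> gauss_map_fold \<nu> p"
  shows "\<exists>V. open V \<and> p \<in> V \<and> V \<subseteq> \<Sigma> \<and>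
    (\<forall>U. U \<subseteq> V \<and> p \<in> interior U \<and>
         bounded (gaussian_curvature f \<nu> ` (U - singular_set \<Sigma> f)) \<longrightarrow>
       ((\<forall>q\<in>U. extended_gaussian_curvature \<Sigma> f \<nu> q > 0) \<longleftrightarrow> singular_curvature \<Sigma> f \<nu> p < 0) \<and>
       ((\<forall>q\<in>U. extended_gaussian_curvature \<Sigma> f \<nu> q < 0) \<longleftrightarrow> singular_curvature \<Sigma> f \<nu> p > 0))"
proof -
  have f: "smooth_on \<Sigma> f" using assms(3) by (simp add: front_def)
  obtain U U' \<theta> \<theta>' W W' \<Phi> \<Phi>' where "cuspidal_edge_data \<Sigma> f p U U' \<theta> \<theta>' W W' \<Phi> \<Phi>'"
    using cuspidal_edge_dataE[OF assms(1,4) f assms(5)] .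
  then have ex: "\<exists>\<phi> S. adapted_coordinates \<Sigma> f p S \<phi>" by (rule cuspidal_edge_data.adapted_coordinates_exist)
  define \<phi> where "\<phi> = (SOME \<phi>. \<exists>S. adapted_coordinates \<Sigma> f p S \<phi>)"
  obtain S where ad: "adapted_coordinates \<Sigma> f p S \<phi>"
    using someI_ex[OF ex] unfolding \<phi>_def by blast
  obtain r where r: "adapted_front r (\<lambda>x. f (\<phi> x)) (\<lambda>x. \<nu> (\<phi> x))" "ball 0 r \<subseteq> S"
    by (rule adapted_front_in_adapted_coordinates[OF assms(1,4,3,5) ad]) (rule that)
  obtain \<phi>' where "diffeomorphism S (\<phi> ` S) \<phi> \<phi>'" using ad by (auto simp: adapted_coordinates_def)
  then interpret front_chart \<Sigma> f \<nu> r \<phi> p S \<phi>'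
    using r assms(1,3) ad
    by (intro front_chart.intro front_germ.intro front_chart_axioms.intro) (auto simp: adapted_coordinates_def)
  let ?\<kappa>s = "coord_singular_curvature (\<lambda>x. f (\<phi> x)) (\<lambda>x. \<nu> (\<phi> x)) 0"
  have ks: "singular_curvature \<Sigma> f \<nu> p = ?\<kappa>s"
    by (simp add: singular_curvature_def \<phi>_def[symmetric] o_def)
  show ?thesis
  proof (cases "\<exists>d. 0 < d \<and> d \<le> r \<and> (\<forall>x\<in>ball 0 d. x $ 2 = 0 \<longrightarrow> \<delta>\<^sub>\<nu> x = 0)")
    case True
    then obtain d where d: "0 < d" "d \<le> r" "\<And>x. x \<in> ball 0 d \<Longrightarrow> x $ 2 = 0 \<Longrightarrow> \<delta>\<^sub>\<nu> x = 0" by blast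
    obtain V where V: "open V" "p \<in> V" "V \<subseteq> \<Sigma>" and nz: "?\<kappa>s \<noteq> 0"
      and sg: "\<And>q. q \<in> V \<Longrightarrow> sgn (extended_gaussian_curvature \<Sigma> f \<nu> q) = - sgn ?\<kappa>s"
      by (rule curvature_sign[OF d(1,2) _ assms(6,7)], erule (1) d(3), rule that)
    have pos: "extended_gaussian_curvature \<Sigma> f \<nu> q > 0 \<longleftrightarrow> ?\<kappa>s < 0"
      and neg: "extended_gaussian_curvature \<Sigma> f \<nu> q < 0 \<longleftrightarrow> ?\<kappa>s > 0" if "q \<in> V" for q
      using sg[OF that] nz by (auto simp: sgn_if split: if_splits)
    show ?thesis
    proof (intro exI[of _ V] conjI V allI impI; elim conjE)
      fix U assume "U \<subseteq> V" "p \<in> interior U"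
      then have U: "U \<subseteq> V" "p \<in> U" using interior_subset by auto
      show "(\<forall>q\<in>U. extended_gaussian_curvature \<Sigma> f \<nu> q > 0) \<longleftrightarrow> singular_curvature \<Sigma> f \<nu> p < 0"
        unfolding ks using U pos by blast
      show "(\<forall>q\<in>U. extended_gaussian_curvature \<Sigma> f \<nu> q < 0) \<longleftrightarrow> singular_curvature \<Sigma> f \<nu> p > 0"
        unfolding ks using U neg by blast
    qed
  next
    case False
    (* The curvature is unbounded on every neighbourhood of p, and the claim is vacuous. *)
    have "\<not> (p \<in> interior U \<and> bounded (gaussian_curvature f \<nu> ` (U - singular_set \<Sigma> f)))" for U
      using gauss_density_axis_if_curvature_bounded[of U] False by metis
    then show ?thesis using assms(1,4) by (intro exI[of _ \<Sigma>]) blast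
  qed
qed

end
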